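(* Let $\mathcal Z$ be a zigzag and let $\underline{c}$ be a permissible function with $\underline{c}(X)>0$ for every $X\in\mathrm{Ind}(\mathcal C_{\mathcal Z})$. (a) If $\mathcal T$ is a $\mathbf T$-cluster and $\Phi$ is a solution with respect to $\underline c$ in $\mathcal C_{\mathcal Z}$ such that $\Phi(X)=0$ for all $X\in\mathcal T$, then $\Phi$ is on the boundary of $\mathbb U_{\mathcal Z,\underline c}$. (b) Let $\mathcal T$ and $\mathcal T'$ be two $\mathbf T$-clusters such that there is a unique solution $\Phi$ vanishing on $\mathcal T$ and a unique solution $\Phi'$ vanishing on $\mathcal T'$. Then there is a $\mathbf T$-mutation $\mathcal T\to\mathcal T'$ if and only if there is an edge (a line segment with distinct endpoints) in $\mathbb U_{\mathcal Z,\underline c}$ connecting $\Phi$ to $\Phi'$ which is given by $$\Big(\bigcap_{X\in\mathcal T\cap\mathcal T'}\mathbb H_X\Big)\cap\mathbb U_{\mathcal Z,\underline c}.$$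
   Context: Indecomposables. $\mathrm{Ind}(\mathcal D)$ is the open strip $\mathbb R\times(-\frac{\pi}{2},\frac{\pi}{2})$ (its points are the indecomposable objects of a triangulated category $\mathcal D$), $0$ is the zero object, and every point on the lines $y=\pm\frac{\pi}{2}$ is read as $0$. The shift is $(x,y)[1]:=(x+\pi,-y)$. Tilting rectangle. Let $X=(x,y)\in\mathrm{Ind}(\mathcal D)$ and let $a,b$ be reals with $0<a\le\frac{\pi}{2}-y$, $0<b\le y+\frac{\pi}{2}$. Put $Y=(x+a,y+a)$, $Z=(x+b,y-b)$, $W=(x+a+b,y+a-b)$. The rectangle $XYWZ$ is a tilting rectangle with left, top, right, bottom corners $X,Y,W,Z$ ($Y$ or $Z$ may lie on $y=\pm\frac{\pi}{2}$, and is then read as $0$). Zigzag. Let $\ell_1,\dots,\ell_n$ be distinct line segments in $\mathbb R\times[-\frac{\pi}{2},\frac{\pi}{2}]$ such that $\ell_1$ has slope $\pm1$ and its top point lies on $y=\frac{\pi}{2}$; for $1\le i<n$, $\ell_{i+1}$ lies below $\ell_i$ and they meet at a right angle (sharing one endpoint); the bottom point of $\ell_n$ lies on $y=-\frac{\pi}{2}$. The zigzag is $\mathcal Z=(\bigcup_i\ell_i)\cap(\mathbb R\times(-\frac{\pi}{2},\frac{\pi}{2}))$. It meets each horizontal line $y=\text{const}$ in the open strip in exactly one point $(z(y),y)$. $\mathcal Z[1]$ is the set of shifts of points of $\mathcal Z$. $\mathrm{Ind}(\mathcal C_{\mathcal Z})$ is the set of points lying between $\mathcal Z$ and $\mathcal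 Z[1]$ inclusive: $\{(x,y)\in\mathrm{Ind}(\mathcal D): z(y)\le x\le z(-y)+\pi\}$. Permissible function. $\underline c:\mathrm{Ind}(\mathcal D)\sqcup\{0\}\to\mathbb R$ with $\underline c(0)=0$ such that for every tilting rectangle $XYWZ$ the surface integral $\int_{XYWZ}\underline c$ over the region it bounds yields a real number. Solution. A solution with respect to $\underline c$ in $\mathcal C_{\mathcal Z}$ is a function $\Phi:\mathrm{Ind}(\mathcal D)\sqcup\{0\}\to\mathbb R$ with $\Phi(0)=0$ such that $\Phi(X)+\Phi(W)=\Phi(Y)+\Phi(Z)+\int_{XYWZ}\underline c$ for every tilting rectangle $XYWZ$ and $\Phi(X)\ge0$ for all $X\in\mathrm{Ind}(\mathcal C_{\mathcal Z})$. Continuous associahedron. $\mathbb U_{\mathcal Z,\underline c}\subset\prod_{\mathrm{Ind}(\mathcal C_{\mathcal Z})}\mathbb R$ is the set of vectors $(\Phi(X))_{X\in\mathrm{Ind}(\mathcal C_{\mathcal Z})}$ for $\Phi$ a solution; a solution is identified with its vector. It is a convex set. $\mathbb H_X$ is the hyperplane of vectors in $\prod_{\mathrm{Ind}(\mathcal C_{\mathcal Z})}\mathbb R$ whose $X$-coordinate is $0$. Boundary. $\Phi\in\mathbb U_{\mathcal Z,\underline c}$ is on the boundary of $\mathbb U_{\mathcal Z,\underline c}$ if there is a line segment $\ell\subset\mathbb U_{\mathcal Z,\underline c}$ with distinct endpoints $\Phi_0$ and $\Phi_1=\Phi$ such that no line segment $\ell'$ containing $\ell$ for which $\Phi_1$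 is not an endpoint is contained in $\mathbb U_{\mathcal Z,\underline c}$. Compatibility. $X,Y\in\mathrm{Ind}(\mathcal C_{\mathcal Z})$ are incompatible if there is a tilting rectangle whose left and right corners are $X$ and $Y$, or $Y$ and $X$ (equivalently a nontrivial distinguished triangle $X\to E\to Y\to X[1]$ or $Y\to E\to X\to Y[1]$ in $\mathcal D$); otherwise they are compatible. $\mathbf T$-cluster. A set $\mathcal T\subset\mathrm{Ind}(\mathcal C_{\mathcal Z})$ of pairwise compatible elements such that every $W\in\mathrm{Ind}(\mathcal C_{\mathcal Z})\setminus\mathcal T$ is incompatible with some element of $\mathcal T$. $\mathbf T$-mutation. There is a $\mathbf T$-mutation $\mathcal T\to\mathcal T'$ between $\mathbf T$-clusters if $\mathcal T'=(\mathcal T\setminus\{T_0\})\cup\{T_1\}$ for some $T_0\in\mathcal T$ and $T_1\notin\mathcal T$. *)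

theory Defs
  imports "HOL-Analysis.Analysis" "HOL-Library.Function_Algebras"
begin

text \<open>
  Pointwise real vector space structure on functions, so that \<open>closed_segment\<close> applies to
  vectors indexed by an arbitrary set.
\<close>

instantiation "fun" :: (type, real_vector) real_vector
begin

definition scaleR_fun :: "real \<Rightarrow> ('a \<Rightarrow> 'b) \<Rightarrow> 'a \<Rightarrow> 'b" where
  "scaleR_fun r f = (\<lambda>x. r *\<^sub>R f x)"

instance
  by standard (simp_all add: scaleR_fun_def fun_eq_iff scaleR_add_right scaleR_add_left)

end

definition IndD :: "(real \<times> real) set" where
  "IndD = UNIV \<times> {- (pi/2) <..< pi/2}"

text \<open>
  A function on the indecomposables together with the zero object, taking the value 0 at the
  zero object, is represented by its extension by 0 to the whole plane. In particular the points
  on the lines \<open>y = \<plusminus>\<pi>/2\<close>, which are read as the zero object, get the value 0.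
\<close>

definition zero_extended :: "(real \<times> real \<Rightarrow> real) \<Rightarrow> bool" where
  "zero_extended f \<longleftrightarrow> (\<forall>X. X \<notin> IndD \<longrightarrow> f X = 0)"

text \<open>The corners are listed in the order left, top, right, bottom.\<close>

definition tilting_rectangle ::
    "real \<times> real \<Rightarrow> real \<times> real \<Rightarrow> real \<times> real \<Rightarrow> real \<times> real \<Rightarrow> bool" where
  "tilting_rectangle X Y W Z \<longleftrightarrow>
     (\<exists>x y a b. (x, y) \<in> IndD \<and> 0 < a \<and> a \<le> pi/2 - y \<and> 0 < b \<and> b \<le> y + pi/2 \<and>
        X = (x, y) \<and> Y = (x + a, y + a) \<and> W = (x + a + b, y + a - b) \<and> Z = (x + b, y - b))"

definition rectangle_region ::
    "real \<times> real \<Rightarrow> real \<times> real \<Rightarrow> real \<times> real \<Rightarrow> real \<times> real \<Rightarrow> (real \<times> real) set" where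
  "rectangle_region X Y W Z = convex hull {X, Y, W, Z}"

text \<open>
  The segments of the zigzag are \<open>[P i, P (i + 1)]\<close> for \<open>i < n\<close>, listed from top to bottom, with
  top point \<open>P i\<close> and bottom point \<open>P (i + 1)\<close>. Since the heights strictly decrease, the segments
  are distinct and contained in the closed strip.
\<close>

definition zigzag :: "(real \<times> real) set \<Rightarrow> bool" where
  "zigzag \<Z> \<longleftrightarrow>
     (\<exists>(n::nat) (P :: nat \<Rightarrow> real \<times> real).
        1 \<le> n \<and>
        snd (P 0) = pi/2 \<and>
        (snd (P 1) - snd (P 0)) / (fst (P 1) - fst (P 0)) \<in> {1, -1} \<and>
        (\<forall>i<n. snd (P (Suc i)) < snd (P i)) \<and>
        (\<forall>i. Suc i < n \<longrightarrow> orthogonal (P (Suc i) - P i) (P (Suc (Suc i)) - P (Suc i))) \<and>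
        snd (P n) = - (pi/2) \<and>
        \<Z> = (\<Union>i<n. closed_segment (P i) (P (Suc i))) \<inter> IndD)"

definition zigzag_abscissa :: "(real \<times> real) set \<Rightarrow> real \<Rightarrow> real" where
  "zigzag_abscissa \<Z> y = (THE x. (x, y) \<in> \<Z>)"

lemma descending_segment_unique:
  fixes A B :: "real \<times> real"
  assumes "snd B < snd A" "snd B \<le> y" "y \<le> snd A"
  shows "\<exists>!x. (x, y) \<in> closed_segment A B"
proof -
  define u where "u = (snd A - y) / (snd A - snd B)"
  have u: "0 \<le> u" "u \<le> 1" using assms by (auto simp: u_def field_simps)
  have eq: "y = (1 - v) * snd A + v * snd B \<longleftrightarrow> v = u" for v
    using assms by (auto simp: u_def field_simps)
  have "(x, y) \<in> closed_segment A B \<longleftrightarrow> x = (1 - u) * fst A + u * fst B" for x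
  proof -
    have "(x, y) \<in> closed_segment A B \<longleftrightarrow>
        (\<exists>v. 0 \<le> v \<and> v \<le> 1 \<and> x = (1 - v) * fst A + v * fst B \<and> y = (1 - v) * snd A + v * snd B)"
      by (auto simp: closed_segment_def prod_eq_iff)
    then show ?thesis using u by (auto simp: eq)
  qed
  then show ?thesis by auto
qed

lemma descending_segment_bounds:
  fixes A B :: "real \<times> real"
  assumes "snd B < snd A" "(x, y) \<in> closed_segment A B"
  shows "snd B \<le> y" "y \<le> snd A"
proof -
  obtain v where v: "0 \<le> v" "v \<le> 1" "y = (1 - v) * snd A + v * snd B"
    using assms(2) by (auto simp: closed_segment_def prod_eq_iff)
  have "y = snd A - v * (snd A - snd B)" "y = snd B + (1 - v) * (snd A - snd B)"
    using v by (auto simp: algebra_simps)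
  moreover have "0 \<le> v * (snd A - snd B)" "0 \<le> (1 - v) * (snd A - snd B)"
    using v assms(1) by auto
  ultimately show "snd B \<le> y" "y \<le> snd A" by auto
qed

lemma descending_polyline_unique:
  fixes P :: "nat \<Rightarrow> real \<times> real"
  assumes "\<forall>i\<le>n. snd (P (Suc i)) < snd (P i)" "snd (P (Suc n)) \<le> y" "y \<le> snd (P 0)"
  shows "\<exists>!x. (x, y) \<in> (\<Union>i\<le>n. closed_segment (P i) (P (Suc i)))"
  using assms
proof (induction n)
  case 0
  then show ?case using descending_segment_unique[of "P 1" "P 0" y] by simp
next
  case (Suc n)
  let ?U = "\<Union>i\<le>n. closed_segment (P i) (P (Suc i))"
  let ?S = "closed_segment (P (Suc n)) (P (Suc (Suc n)))"
  have un: "(\<Union>i\<le>Suc n. closed_segment (P i) (P (Suc i))) = ?S \<union> ?U"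
    by (simp add: atMost_Suc)
  have desc: "snd (P (Suc (Suc n))) < snd (P (Suc n))" using Suc.prems by auto
  have mono: "snd (P (Suc n)) \<le> snd (P (Suc i))" if "i \<le> n" for i
    using that
  proof (induction rule: inc_induct)
    case (step m)
    have "snd (P (Suc (Suc m))) < snd (P (Suc m))" using step.hyps Suc.prems(1) by auto
    then show ?case using step.IH by simp
  qed simp
  have low: "snd (P (Suc n)) \<le> y'" if xy: "(x', y') \<in> ?U" for x' y'
  proof -
    obtain i where i: "i \<le> n" "(x', y') \<in> closed_segment (P i) (P (Suc i))" using xy by auto
    have "snd (P (Suc i)) \<le> y'"
      by (rule descending_segment_bounds(1)[OF _ i(2)]) (use Suc.prems i in auto)
    then show ?thesis using mono[OF i(1)] by simp
  qed
  show ?case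
  proof (cases "snd (P (Suc n)) \<le> y")
    case True
    have ex: "\<exists>!x. (x, y) \<in> ?U" using Suc.IH Suc.prems True by auto
    have "(x, y) \<in> ?U" if xy: "(x, y) \<in> ?S" for x
    proof -
      have "y \<le> snd (P (Suc n))" using descending_segment_bounds(2)[OF desc xy] .
      then have y: "y = snd (P (Suc n))" using True by simp
      have "(fst (P (Suc n)), y) \<in> ?S" by (simp add: y)
      then have "x = fst (P (Suc n))"
        using descending_segment_unique[OF desc, of y] xy y desc by auto
      then have "(x, y) = P (Suc n)" using y by simp
      then show ?thesis by auto
    qed
    then have "(x, y) \<in> ?S \<union> ?U \<longleftrightarrow> (x, y) \<in> ?U" for x by blast
    then show ?thesis using ex unfolding un by simp
  next
    case False
    then have "(x, y) \<notin> ?U" for x using low by blast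
    then have "(x, y) \<in> ?S \<union> ?U \<longleftrightarrow> (x, y) \<in> ?S" for x by blast
    then show ?thesis
      using descending_segment_unique[OF desc, of y] False Suc.prems unfolding un by simp
  qed
qed

text \<open>This justifies the definite description in the definition of \<open>zigzag_abscissa\<close>.\<close>

lemma zigzag_unique_abscissa:
  assumes "zigzag \<Z>" "- (pi/2) < y" "y < pi/2"
  shows "\<exists>!x. (x, y) \<in> \<Z>"
proof -
  obtain n and P :: "nat \<Rightarrow> real \<times> real" where P: "1 \<le> n" "snd (P 0) = pi/2"
      "\<forall>i<n. snd (P (Suc i)) < snd (P i)" "snd (P n) = - (pi/2)"
      "\<Z> = (\<Union>i<n. closed_segment (P i) (P (Suc i))) \<inter> IndD"
    using assms(1) unfolding zigzag_def by auto
  obtain m where m: "n = Suc m" using P(1) by (cases n) auto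
  have "\<exists>!x. (x, y) \<in> (\<Union>i\<le>m. closed_segment (P i) (P (Suc i)))"
    by (rule descending_polyline_unique) (use P m assms in auto)
  then show ?thesis
    using assms by (simp add: P(5) m lessThan_Suc_atMost IndD_def)
qed

definition IndC :: "(real \<times> real) set \<Rightarrow> (real \<times> real) set" where
  "IndC \<Z> = {(x, y). (x, y) \<in> IndD \<and>
     zigzag_abscissa \<Z> y \<le> x \<and> x \<le> zigzag_abscissa \<Z> (- y) + pi}"

text \<open>
  The surface integral is the Lebesgue integral in the plane; that it yields a real number is
  Lebesgue integrability.
\<close>

definition permissible :: "(real \<times> real \<Rightarrow> real) \<Rightarrow> bool" where
  "permissible c \<longleftrightarrow> zero_extended c \<and>
     (\<forall>X Y W Z. tilting_rectangle X Y W Z \<longrightarrow>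
        set_integrable lebesgue (rectangle_region X Y W Z) c)"

definition solution ::
    "(real \<times> real) set \<Rightarrow> (real \<times> real \<Rightarrow> real) \<Rightarrow> (real \<times> real \<Rightarrow> real) \<Rightarrow> bool" where
  "solution \<Z> c \<Phi> \<longleftrightarrow> zero_extended \<Phi> \<and>
     (\<forall>X Y W Z. tilting_rectangle X Y W Z \<longrightarrow>
        \<Phi> X + \<Phi> W = \<Phi> Y + \<Phi> Z + set_lebesgue_integral lebesgue (rectangle_region X Y W Z) c) \<and>
     (\<forall>X\<in>IndC \<Z>. 0 \<le> \<Phi> X)"

text \<open>
  The product of copies of the reals over \<open>IndC \<Z>\<close> is represented by the linear subspace of
  functions vanishing outside \<open>IndC \<Z>\<close>.
\<close>

definition ambient :: "(real \<times> real) set \<Rightarrow> (real \<times> real \<Rightarrow> real) set" where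
  "ambient \<Z> = {v. \<forall>X. X \<notin> IndC \<Z> \<longrightarrow> v X = 0}"

definition coords :: "(real \<times> real) set \<Rightarrow> (real \<times> real \<Rightarrow> real) \<Rightarrow> real \<times> real \<Rightarrow> real" where
  "coords \<Z> \<Phi> = (\<lambda>X. if X \<in> IndC \<Z> then \<Phi> X else 0)"

definition continuous_associahedron ::
    "(real \<times> real) set \<Rightarrow> (real \<times> real \<Rightarrow> real) \<Rightarrow> (real \<times> real \<Rightarrow> real) set" where
  "continuous_associahedron \<Z> c = {coords \<Z> \<Phi> | \<Phi>. solution \<Z> c \<Phi>}"

definition hyperplane :: "(real \<times> real) set \<Rightarrow> real \<times> real \<Rightarrow> (real \<times> real \<Rightarrow> real) set" where
  "hyperplane \<Z> X = {v \<in> ambient \<Z>. v X = 0}"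

definition on_boundary :: "'a::real_vector \<Rightarrow> 'a set \<Rightarrow> bool" where
  "on_boundary \<Phi>\<^sub>1 U \<longleftrightarrow> \<Phi>\<^sub>1 \<in> U \<and>
     (\<exists>\<Phi>\<^sub>0. \<Phi>\<^sub>0 \<noteq> \<Phi>\<^sub>1 \<and> closed_segment \<Phi>\<^sub>0 \<Phi>\<^sub>1 \<subseteq> U \<and>
        \<not> (\<exists>A B. closed_segment \<Phi>\<^sub>0 \<Phi>\<^sub>1 \<subseteq> closed_segment A B \<and>
               \<Phi>\<^sub>1 \<noteq> A \<and> \<Phi>\<^sub>1 \<noteq> B \<and> closed_segment A B \<subseteq> U))"

definition incompatible :: "real \<times> real \<Rightarrow> real \<times> real \<Rightarrow> bool" where
  "incompatible X Y \<longleftrightarrow> (\<exists>T B. tilting_rectangle X T Y B \<or> tilting_rectangle Y T X B)"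

definition T_cluster :: "(real \<times> real) set \<Rightarrow> (real \<times> real) set \<Rightarrow> bool" where
  "T_cluster \<Z> \<T> \<longleftrightarrow> \<T> \<subseteq> IndC \<Z> \<and>
     (\<forall>X\<in>\<T>. \<forall>Y\<in>\<T>. \<not> incompatible X Y) \<and>
     (\<forall>W\<in>IndC \<Z> - \<T>. \<exists>X\<in>\<T>. incompatible W X)"

definition T_mutation :: "(real \<times> real) set \<Rightarrow> (real \<times> real) set \<Rightarrow> bool" where
  "T_mutation \<T> \<T>' \<longleftrightarrow> (\<exists>T\<^sub>0\<in>\<T>. \<exists>T\<^sub>1. T\<^sub>1 \<notin> \<T> \<and> \<T>' = (\<T> - {T\<^sub>0}) \<union> {T\<^sub>1})"

text \<open>Uniqueness is up to the identification of a solution with its vector of coordinates.\<close>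

definition unique_vanishing_solution ::
    "(real \<times> real) set \<Rightarrow> (real \<times> real \<Rightarrow> real) \<Rightarrow> (real \<times> real) set \<Rightarrow> (real \<times> real \<Rightarrow> real) \<Rightarrow> bool"
  where
  "unique_vanishing_solution \<Z> c \<T> \<Phi> \<longleftrightarrow>
     solution \<Z> c \<Phi> \<and> (\<forall>X\<in>\<T>. \<Phi> X = 0) \<and>
     (\<forall>\<Psi>. solution \<Z> c \<Psi> \<and> (\<forall>X\<in>\<T>. \<Psi> X = 0) \<longrightarrow> coords \<Z> \<Psi> = coords \<Z> \<Phi>)"

end

theory Submission
  imports Defs "HOL-Library.Multiset"
begin

text \<open>
  In the coordinates \<open>s = x + y\<close>, \<open>t = x - y + \<pi>\<close> the strip is \<open>s < t < s + 2\<pi>\<close>, the shift is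
  \<open>(s, t) \<mapsto> (t, s + 2\<pi>)\<close>, and points modulo the square of the shift are oriented arcs \<open>s \<rightarrow> t\<close> on a
  circle. Two solutions differ by \<open>f s - f t\<close> for a \<open>2\<pi>\<close>-periodic \<open>f\<close>, so relative to a fixed
  solution \<open>\<Phi>\<close> the associahedron is the set of potentials: functions on the circle with
  \<open>f t - f s \<le> \<Phi>(s, t)\<close> for all arcs of \<open>\<C>\<^sub>\<Z>\<close>. Positivity of \<open>c\<close> makes \<open>\<Phi>\<close> a strict Monge
  weight: uncrossing two arcs decreases the total weight. Hence the zeros of a solution
  that vanishes on a cluster are exactly the elements of the cluster.

  Shortest path distances are potentials, and since a noncrossing matching of sources and
  sinks is optimal, a solution vanishing on a set of arcs can be moved to one that vanishes in
  addition on any given arc compatible with that set. This yields part (a), and it shows that if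
  the face of \<open>\<T> \<inter> \<T>'\<close> is a segment, then every arc compatible with \<open>\<T> \<inter> \<T>'\<close> and one element
  of \<open>\<T> - \<T>'\<close> lies in \<open>\<T>\<close>; thus \<open>\<T> - \<T>'\<close> and \<open>\<T>' - \<T>\<close> are singletons.

  Conversely, let \<open>\<T>\<close> and \<open>\<T>'\<close> differ by exchanging \<open>(s, r)\<close> for the crossing arc \<open>(p, q)\<close>. The points
  \<open>s, p, r, q\<close> divide the circle into four gaps. A potential that is constant along the common arcs can be
  truncated on a gap to the value at a vertex, and uniqueness of \<open>\<Phi>\<close> or of \<open>\<Phi>'\<close> shows that
  it already has this value on the gap. So these potentials form a one-parameter family.
\<close>

section \<open>Arcs on a circle\<close>

text \<open>
  \<open>(s, t)\<close> and \<open>(s', t')\<close> are the left and right corners of a tilting rectangle; its other corners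
  are \<open>(s', t)\<close> and \<open>(s, t')\<close>.
\<close>

definition cross :: "real \<Rightarrow> real \<Rightarrow> real \<Rightarrow> real \<Rightarrow> bool" where
  "cross s t s' t' \<longleftrightarrow> s < s' \<and> s' \<le> t \<and> t < t' \<and> t' \<le> s + 2 * pi"

definition noncrossing :: "(real \<Rightarrow> real \<Rightarrow> bool) \<Rightarrow> bool" where
  "noncrossing S \<longleftrightarrow> (\<forall>s t s' t'. S s t \<and> S s' t' \<longrightarrow> \<not> cross s t s' t')"

definition congr2pi :: "real \<Rightarrow> real \<Rightarrow> bool" where
  "congr2pi x y \<longleftrightarrow> (\<exists>n::int. y = x + 2 * pi * n)"

lemma congr2pi_refl [simp]: "congr2pi x x"
  by (auto simp: congr2pi_def intro: exI[of _ 0])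

lemma congr2pi_sym: "congr2pi x y \<Longrightarrow> congr2pi y x"
  unfolding congr2pi_def by (metis add_diff_cancel_right' diff_conv_add_uminus mult_minus_right of_int_minus)

lemma congr2pi_trans: "congr2pi x y \<Longrightarrow> congr2pi y z \<Longrightarrow> congr2pi x z"
  unfolding congr2pi_def by (metis add.assoc distrib_left of_int_add)

definition periodic2pi :: "(real \<Rightarrow> real) \<Rightarrow> bool" where
  "periodic2pi f \<longleftrightarrow> (\<forall>x y. congr2pi x y \<longrightarrow> f x = f y)"

lemma congr2pi_cases:
  assumes "congr2pi x y" "y \<noteq> x"
  shows "x + 2 * pi \<le> y \<or> y + 2 * pi \<le> x"
proof -
  obtain n :: int where n: "y = x + 2 * pi * n" using assms(1) by (auto simp: congr2pi_def)
  have "n \<noteq> 0" using n assms(2) by auto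
  then consider "n \<ge> 1" | "n \<le> -1" by linarith
  then show ?thesis
  proof cases
    case 1
    then have "2 * pi * 1 \<le> 2 * pi * real_of_int n" by (intro mult_left_mono) auto
    then show ?thesis using n by simp
  next
    case 2
    then have "2 * pi * real_of_int n \<le> 2 * pi * (-1)" by (intro mult_left_mono) auto
    then show ?thesis using n by simp
  qed
qed

lemma congr2pi_shift: "congr2pi x (x + 2 * pi)" "congr2pi (x + 2 * pi) x"
  "congr2pi x (x - 2 * pi)" "congr2pi (x - 2 * pi) x"
  unfolding congr2pi_def
  by (rule exI[of _ 1], simp) (rule exI[of _ "-1"], simp, rule exI[of _ "-1"], simp, rule exI[of _ 1], simp)

text \<open>
  The assumption \<open>spread\<close> says that no arc lies strictly beyond the shift of another one; it makes
  the lift of a point of the circle to an endpoint of an arc unique.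
\<close>

locale arcs =
  fixes C :: "real \<Rightarrow> real \<Rightarrow> bool"
  assumes strip: "C s t \<Longrightarrow> s < t \<and> t < s + 2 * pi"
    and spread: "C s t \<Longrightarrow> C s' t' \<Longrightarrow> t < s' \<Longrightarrow> s + 2 * pi < t' \<Longrightarrow> False"
    and top_corner: "C s t \<Longrightarrow> C s' t' \<Longrightarrow> cross s t s' t' \<Longrightarrow> s' < t \<Longrightarrow> C s' t"
    and bottom_corner: "C s t \<Longrightarrow> C s' t' \<Longrightarrow> cross s t s' t' \<Longrightarrow> t' < s + 2 * pi \<Longrightarrow> C s t'"
begin

text \<open>The last clause is the Monge condition. The zeros at \<open>s\<close> and
  \<open>s + 2 * pi\<close> are the values on the two boundary lines of the strip, where a corner of
  a crossing may lie.\<close>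

definition weight :: "(real \<Rightarrow> real \<Rightarrow> real) \<Rightarrow> bool" where
  "weight \<Psi> \<longleftrightarrow> (\<forall>s t. C s t \<longrightarrow> 0 \<le> \<Psi> s t) \<and> (\<forall>s. \<Psi> s s = 0 \<and> \<Psi> s (s + 2 * pi) = 0) \<and>
     (\<forall>s t s' t'. C s t \<and> C s' t' \<and> cross s t s' t' \<longrightarrow> \<Psi> s' t + \<Psi> s t' \<le> \<Psi> s t + \<Psi> s' t')"

definition source :: "real \<Rightarrow> bool" where "source s \<longleftrightarrow> (\<exists>t. C s t)"
definition sink :: "real \<Rightarrow> bool" where "sink t \<longleftrightarrow> (\<exists>s. C s t)"

text \<open>Degenerate arcs on the boundary of the strip. They cost nothing; adjoining them closes
  the arcs under taking corners and lets a path switch between the two roles of a point as source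
  and sink.\<close>

definition trivial_arc :: "real \<Rightarrow> real \<Rightarrow> bool" where
  "trivial_arc s t \<longleftrightarrow> source s \<and> sink t \<and> (t = s \<or> t = s + 2 * pi)"

definition Cbar :: "real \<Rightarrow> real \<Rightarrow> bool" where
  "Cbar s t \<longleftrightarrow> C s t \<or> trivial_arc s t"

lemma Cbar_bounds: "Cbar s t \<Longrightarrow> s \<le> t \<and> t \<le> s + 2 * pi"
  using strip[of s t] pi_gt_zero by (auto simp: Cbar_def trivial_arc_def)

lemma Cbar_interior: "Cbar s t \<Longrightarrow> s < t \<Longrightarrow> t < s + 2 * pi \<Longrightarrow> C s t"
  by (auto simp: Cbar_def trivial_arc_def)

text \<open>If \<open>s + 2 * pi \<le> s'\<close>, an arc from \<open>s\<close> ends before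
  \<open>s'\<close>, while an arc from \<open>s'\<close> ends beyond \<open>s + 2 * pi\<close>,
  against \<open>spread\<close>.\<close>

lemma source_unique:
  assumes "source s" "source s'" "congr2pi s s'"
  shows "s = s'"
proof (rule ccontr)
  assume "s \<noteq> s'"
  obtain t t' where t: "C s t" "C s' t'" using assms by (auto simp: source_def)
  consider "s + 2 * pi \<le> s'" | "s' + 2 * pi \<le> s"
    using congr2pi_cases[OF assms(3)] \<open>s \<noteq> s'\<close> by auto
  then show False
  proof cases
    case 1 then show False using spread[OF t] strip[OF t(1)] strip[OF t(2)] by linarith
  next
    case 2 then show False using spread[OF t(2,1)] strip[OF t(1)] strip[OF t(2)] by linarith
  qed
qed

lemma sink_unique:
  assumes "sink t" "sink t'" "congr2pi t t'"
  shows "t = t'"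
proof (rule ccontr)
  assume "t \<noteq> t'"
  obtain s s' where t: "C s t" "C s' t'" using assms by (auto simp: sink_def)
  consider "t + 2 * pi \<le> t'" | "t' + 2 * pi \<le> t"
    using congr2pi_cases[OF assms(3)] \<open>t \<noteq> t'\<close> by auto
  then show False
  proof cases
    case 1 then show False using spread[OF t] strip[OF t(1)] strip[OF t(2)] by linarith
  next
    case 2 then show False using spread[OF t(2,1)] strip[OF t(1)] strip[OF t(2)] by linarith
  qed
qed

text \<open>A lift \<open>t\<close> other than \<open>s\<close> and \<open>s + 2 * pi\<close> is at
  least \<open>s + 4 * pi\<close> or at most \<open>s - 2 * pi\<close>; then an arc starting at
  \<open>s\<close> and an arc ending at \<open>t\<close> violate \<open>spread\<close>.\<close>

lemma congr_trivial_arc: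
  assumes "source s" "sink t" "congr2pi s t"
  shows "trivial_arc s t"
proof -
  obtain t' s' where t: "C s t'" "C s' t" using assms by (auto simp: source_def sink_def)
  have "t = s \<or> t = s + 2 * pi"
  proof (rule ccontr)
    assume n: "\<not> (t = s \<or> t = s + 2 * pi)"
    have "congr2pi (s + 2 * pi) t"
      using congr2pi_shift(2) assms(3) congr2pi_trans by blast
    then consider "s + 2 * pi + 2 * pi \<le> t" | "t + 2 * pi \<le> s"
      using congr2pi_cases[OF assms(3)] congr2pi_cases[of "s + 2 * pi" t] n pi_gt_zero by fastforce
    then show False
    proof cases
      case 1 then show False using spread[OF t] strip[OF t(1)] strip[OF t(2)] by linarith
    next
      case 2 then show False using spread[OF t(2,1)] strip[OF t(1)] strip[OF t(2)] by linarith
    qed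
  qed
  then show ?thesis using assms by (simp add: trivial_arc_def)
qed

text \<open>A degenerate arc shares an end with a genuine arc that is no larger in both coordinates,
  and with one that is no smaller. Passing to these reduces the claim to
  \<open>spread\<close>.\<close>

lemma Cbar_spread:
  assumes 1: "Cbar s t" and 2: "Cbar s' t'" and lt: "t < s'" "s + 2 * pi < t'"
  shows False
proof -
  obtain a b where ab: "C a b" "b \<le> t" "a \<le> s"
  proof (cases "C s t")
    case True then show ?thesis using that by auto
  next
    case False
    then have "trivial_arc s t" using 1 by (simp add: Cbar_def)
    then obtain t1 s1 where "C s t1" "C s1 t" "t = s \<or> t = s + 2 * pi"
      by (auto simp: trivial_arc_def source_def sink_def)
    then show ?thesis using that[of s1 t] that[of s t1] strip[of s t1] strip[of s1 t] by fastforce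
  qed
  obtain a' b' where ab': "C a' b'" "t' \<le> b'" "s' \<le> a'"
  proof (cases "C s' t'")
    case True then show ?thesis using that by auto
  next
    case False
    then have "trivial_arc s' t'" using 2 by (simp add: Cbar_def)
    then obtain t1 s1 where "C s' t1" "C s1 t'" "t' = s' \<or> t' = s' + 2 * pi"
      by (auto simp: trivial_arc_def source_def sink_def)
    then show ?thesis using that[of s1 t'] that[of s' t1] strip[of s' t1] strip[of s1 t'] by fastforce
  qed
  show False using spread[OF ab(1) ab'(1)] ab ab' lt by linarith
qed

text \<open>The inequalities in \<open>cross\<close> exclude degenerate arcs, so the Monge condition
  applies; a corner outside \<open>C\<close> lies on the boundary and is a
  \<open>trivial_arc\<close>.\<close>

lemma Cbar_uncross:
  assumes w: "weight \<Psi>" and 1: "Cbar s t" and 2: "Cbar s' t'" and x: "cross s t s' t'"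
  shows "\<Psi> s' t + \<Psi> s t' \<le> \<Psi> s t + \<Psi> s' t'" "Cbar s t'" "Cbar s' t" "C s t" "C s' t'"
proof -
  have C: "C s t" "C s' t'"
    using Cbar_interior[OF 1] Cbar_interior[OF 2] x unfolding cross_def by linarith+
  then show "C s t" "C s' t'" by auto
  show "\<Psi> s' t + \<Psi> s t' \<le> \<Psi> s t + \<Psi> s' t'" using w C x unfolding weight_def by blast
  have ends: "source s" "source s'" "sink t" "sink t'" using C by (auto simp: source_def sink_def)
  show "Cbar s t'"
    using bottom_corner[OF C x] x ends by (cases "t' < s + 2 * pi") (auto simp: Cbar_def trivial_arc_def cross_def)
  show "Cbar s' t"
    using top_corner[OF C x] x ends by (cases "s' < t") (auto simp: Cbar_def trivial_arc_def cross_def)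
qed

lemma Cbar_nonneg: "weight \<Psi> \<Longrightarrow> Cbar s t \<Longrightarrow> 0 \<le> \<Psi> s t"
  by (auto simp: Cbar_def trivial_arc_def weight_def)

lemma trivial_arc_weight: "weight \<Psi> \<Longrightarrow> trivial_arc s t \<Longrightarrow> \<Psi> s t = 0"
  by (auto simp: trivial_arc_def weight_def)

lemma trivial_not_cross:
  assumes "trivial_arc s t" shows "\<not> cross s t s' t'" "\<not> cross s' t' s t"
  using assms unfolding trivial_arc_def cross_def by auto

section \<open>Noncrossing matchings are optimal\<close>

definition total :: "(real \<Rightarrow> real \<Rightarrow> real) \<Rightarrow> (real \<times> real) multiset \<Rightarrow> real" where
  "total \<Psi> M = (\<Sum>p\<in>#M. \<Psi> (fst p) (snd p))"

lemma total_simps [simp]: "total \<Psi> {#} = 0"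
  "total \<Psi> (add_mset p M) = \<Psi> (fst p) (snd p) + total \<Psi> M"
  "total \<Psi> (M + N) = total \<Psi> M + total \<Psi> N"
  by (auto simp: total_def)

lemma image_mset_memD: "image_mset f M = image_mset f N \<Longrightarrow> p \<in># M \<Longrightarrow> \<exists>q. q \<in># N \<and> f q = f p"
  by (metis (no_types, lifting) imageE image_eqI set_image_mset)

text \<open>
  The smallest or the largest sink is reachable without wrapping around, by \<open>spread\<close>. Its extremal
  partner in the noncrossing matching can be split off from the other matching by one uncrossing.
\<close>

lemma noncrossing_matching_optimal:
  assumes w: "weight \<Psi>"
  shows "\<forall>p\<in>#M. Cbar (fst p) (snd p) \<Longrightarrow> \<forall>p\<in>#M0. Cbar (fst p) (snd p) \<Longrightarrow>
    \<forall>p\<in>#M0. \<forall>q\<in>#M0. \<not> cross (fst p) (snd p) (fst q) (snd q) \<Longrightarrow>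
    image_mset fst M = image_mset fst M0 \<Longrightarrow> image_mset snd M = image_mset snd M0 \<Longrightarrow>
    total \<Psi> M0 \<le> total \<Psi> M"
proof (induction "size M" arbitrary: M M0)
  case 0
  then show ?case by simp
next
  case (Suc n)
  note CM = Suc.prems(1) and CM0 = Suc.prems(2) and nc = Suc.prems(3)
    and srcs = Suc.prems(4) and snks = Suc.prems(5)
  \<comment> \<open>An arc \<open>(x0, y0)\<close> of \<open>M0\<close> that occurs in
    \<open>M\<close> is removed from both. If its ends have other partners in \<open>M\<close>,
    uncrossing replaces these two arcs by \<open>(x0, y0)\<close> and \<open>(x', y')\<close>
    without raising the total.\<close>
  have step: "total \<Psi> M0 \<le> total \<Psi> M"
    if p0: "(x0, y0) \<in># M0" and M: "(x', y0) \<in># M" "(x0, y') \<in># M"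
      and x: "(x', y0) \<noteq> (x0, y') \<Longrightarrow> Cbar x' y' \<and> \<Psi> x0 y0 + \<Psi> x' y' \<le> \<Psi> x' y0 + \<Psi> x0 y'"
    for x0 y0 x' y'
  proof (cases "(x', y0) = (x0, y')")
    case True
    then have m: "(x0, y0) \<in># M" using M by simp
    obtain N where N: "M = add_mset (x0, y0) N" using m by (metis insert_DiffM)
    obtain N0 where N0: "M0 = add_mset (x0, y0) N0" using p0 by (metis insert_DiffM)
    have "total \<Psi> N0 \<le> total \<Psi> N"
      by (rule Suc.hyps(1)) (use Suc.hyps(2) CM CM0 nc srcs snks in \<open>auto simp: N N0\<close>)
    then show ?thesis by (simp add: N N0)
  next
    case False
    note x = x[OF False]
    obtain N1 where N1: "M = add_mset (x', y0) N1" using M(1) by (metis insert_DiffM)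
    have "(x0, y') \<in># N1" using M(2) False N1 by auto
    then obtain N where N: "M = add_mset (x', y0) (add_mset (x0, y') N)" using N1 by (metis insert_DiffM)
    obtain N0 where N0: "M0 = add_mset (x0, y0) N0" using p0 by (metis insert_DiffM)
    have "total \<Psi> N0 \<le> total \<Psi> (add_mset (x', y') N)"
      by (rule Suc.hyps(1)) (use Suc.hyps(2) CM CM0 nc srcs snks x in \<open>auto simp: N N0\<close>)
    then show ?thesis using x by (simp add: N N0)
  qed
  have ne: "M0 \<noteq> {#}" using Suc.hyps(2) srcs by auto
  define Y where "Y = snd ` set_mset M0"
  have Y: "finite Y" "Y \<noteq> {}" using ne by (auto simp: Y_def)
  have YM: "Y = snd ` set_mset M" using snks unfolding Y_def by (metis set_image_mset)
  have srcM: "\<exists>y. (x, y) \<in># M" if "(x, y') \<in># M0" for x y'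
    using image_mset_memD[OF srcs[symmetric] that] by force
  have srcM0: "\<exists>y. (x, y) \<in># M0" if "(x, y') \<in># M" for x y'
    using image_mset_memD[OF srcs that] by force
  have snkM: "\<exists>x. (x, y) \<in># M" if "(x', y) \<in># M0" for x' y
    using image_mset_memD[OF snks[symmetric] that] by force
  consider (min) "\<forall>x. (x, Min Y) \<in># M + M0 \<longrightarrow> (\<forall>y\<in>Y. y \<le> x + 2 * pi)"
    | (max) "\<forall>x. (x, Max Y) \<in># M + M0 \<longrightarrow> (\<forall>y\<in>Y. x \<le> y)"
  proof (rule ccontr)
    assume n: "\<not> thesis"
    from n that(1) obtain x1 y1 where 1: "(x1, Min Y) \<in># M + M0" "y1 \<in> Y" "x1 + 2 * pi < y1"
      by fastforce
    from n that(2) obtain x2 y2 where 2: "(x2, Max Y) \<in># M + M0" "y2 \<in> Y" "y2 < x2" by fastforce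
    have "Cbar x1 (Min Y)" "Cbar x2 (Max Y)" using 1 2 CM CM0 by fastforce+
    moreover have "Min Y \<le> y2" "y1 \<le> Max Y" using 1 2 Y by auto
    ultimately show False using Cbar_spread[of x1 "Min Y" x2 "Max Y"] 1 2 by linarith
  qed
  then show ?case
  proof cases
    case min
    define y0 where "y0 = Min Y"
    have y0: "y0 \<in> Y" "\<And>y. y \<in> Y \<Longrightarrow> y0 \<le> y" using Y by (auto simp: y0_def)
    define A where "A = {x. (x, y0) \<in># M0}"
    have "A \<subseteq> fst ` set_mset M0" by (force simp: A_def)
    then have A: "finite A" "A \<noteq> {}" using y0(1) by (auto simp: Y_def A_def finite_subset)
    define x0 where "x0 = Max A"
    have x0: "(x0, y0) \<in># M0" "\<And>x. (x, y0) \<in># M0 \<Longrightarrow> x \<le> x0"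
      using Max_in[OF A] Max_ge[OF A(1)] by (auto simp: x0_def A_def)
    obtain y' where y': "(x0, y') \<in># M" using srcM[OF x0(1)] by auto
    obtain x' where x': "(x', y0) \<in># M" using snkM[OF x0(1)] by auto
    have yy: "y0 \<le> y'" using y' y0(2) YM by force
    show ?thesis
    proof (cases "(x0, y0) \<in># M")
      case True
      then show ?thesis using step[of x0 y0 x0 y0] x0(1) by simp
    next
      case False
      then have ne: "x' \<noteq> x0" "y' \<noteq> y0" using x' y' by auto
      have cb: "Cbar x' y0" "Cbar x0 y'" "Cbar x0 y0" using x' y' x0 CM CM0 by auto
      \<comment> \<open>Otherwise the arc that starts at \<open>x'\<close> in \<open>M0\<close>
        would cross \<open>(x0, y0)\<close>, because \<open>x0\<close> is the largest partner of the
        least sink.\<close>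
      have "x' < x0"
      proof (rule ccontr)
        assume "\<not> x' < x0"
        then have lt: "x0 < x'" using ne by simp
        obtain y2 where y2: "(x', y2) \<in># M0" using srcM0[OF x'] by auto
        have "y2 \<noteq> y0" using y2 x0(2)[of x'] lt by auto
        moreover have "y0 \<le> y2" using y2 y0(2) by (force simp: Y_def)
        moreover have "y2 \<le> x0 + 2 * pi" using min x0(1) y2 by (force simp: y0_def Y_def)
        ultimately have "cross x0 y0 x' y2" using lt Cbar_bounds[OF cb(1)] by (auto simp: cross_def)
        then show False using nc x0(1) y2 by fastforce
      qed
      moreover have "y' \<le> x' + 2 * pi" using min x' y' YM by (force simp: y0_def)
      ultimately have "cross x' y0 x0 y'" using ne yy Cbar_bounds[OF cb(3)] by (auto simp: cross_def)
      from Cbar_uncross[OF w cb(1,2) this] show ?thesis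
        using step[OF x0(1) x' y'] by auto
    qed
  next
    case max
    define y0 where "y0 = Max Y"
    have y0: "y0 \<in> Y" "\<And>y. y \<in> Y \<Longrightarrow> y \<le> y0" using Y by (auto simp: y0_def)
    define A where "A = {x. (x, y0) \<in># M0}"
    have "A \<subseteq> fst ` set_mset M0" by (force simp: A_def)
    then have A: "finite A" "A \<noteq> {}" using y0(1) by (auto simp: Y_def A_def finite_subset)
    define x0 where "x0 = Min A"
    have x0: "(x0, y0) \<in># M0" "\<And>x. (x, y0) \<in># M0 \<Longrightarrow> x0 \<le> x"
      using Min_in[OF A] Min_le[OF A(1)] by (auto simp: x0_def A_def)
    obtain y' where y': "(x0, y') \<in># M" using srcM[OF x0(1)] by auto
    obtain x' where x': "(x', y0) \<in># M" using snkM[OF x0(1)] by auto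
    have yy: "y' \<le> y0" using y' y0(2) YM by force
    show ?thesis
    proof (cases "(x0, y0) \<in># M")
      case True
      then show ?thesis using step[of x0 y0 x0 y0] x0(1) by simp
    next
      case False
      then have ne: "x' \<noteq> x0" "y' \<noteq> y0" using x' y' by auto
      have cb: "Cbar x' y0" "Cbar x0 y'" "Cbar x0 y0" using x' y' x0 CM CM0 by auto
      have "x0 < x'"
      proof (rule ccontr)
        assume "\<not> x0 < x'"
        then have lt: "x' < x0" using ne by simp
        obtain y2 where y2: "(x', y2) \<in># M0" using srcM0[OF x'] by auto
        have "y2 \<noteq> y0" using y2 x0(2)[of x'] lt by auto
        moreover have "y2 \<le> y0" using y2 y0(2) by (force simp: Y_def)
        moreover have "x0 \<le> y2" using max x0(1) y2 by (force simp: y0_def Y_def)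
        ultimately have "cross x' y2 x0 y0" using lt Cbar_bounds[OF cb(1)] by (auto simp: cross_def)
        then show False using nc x0(1) y2 by fastforce
      qed
      moreover have "x' \<le> y'" using max x' y' YM by (force simp: y0_def)
      ultimately have "cross x0 y' x' y0" using ne yy Cbar_bounds[OF cb(3)] by (auto simp: cross_def)
      from Cbar_uncross[OF w cb(2,1) this] show ?thesis
        using step[OF x0(1) x' y'] by auto
    qed
  qed
qed

section \<open>Shortest path potentials\<close>

definition potential :: "(real \<Rightarrow> real \<Rightarrow> real) \<Rightarrow> (real \<Rightarrow> real) \<Rightarrow> bool" where
  "potential \<Psi> f \<longleftrightarrow> periodic2pi f \<and> (\<forall>s t. C s t \<longrightarrow> f t - f s \<le> \<Psi> s t)"

text \<open>
  \<open>reach \<Psi> S u b z k\<close>: some path of length \<open>k\<close> leads from \<open>u\<close> to \<open>z\<close>, regarded as a source or as a sink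
  according to \<open>b\<close>. Arcs are traversed forwards at cost \<open>\<Psi>\<close>, arcs of \<open>S\<close> also backwards at cost 0.
\<close>

inductive reach :: "(real \<Rightarrow> real \<Rightarrow> real) \<Rightarrow> (real \<Rightarrow> real \<Rightarrow> bool) \<Rightarrow> real \<Rightarrow> bool \<Rightarrow> real \<Rightarrow> real \<Rightarrow> bool"
  for \<Psi> S u where
  start: "reach \<Psi> S u True u 0"
| forward: "reach \<Psi> S u True x k \<Longrightarrow> C x y \<Longrightarrow> reach \<Psi> S u False y (k + \<Psi> x y)"
| backward: "reach \<Psi> S u False y k \<Longrightarrow> S x y \<Longrightarrow> reach \<Psi> S u True x k"
| to_source: "reach \<Psi> S u False y k \<Longrightarrow> source x \<Longrightarrow> congr2pi x y \<Longrightarrow> reach \<Psi> S u True x k"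
| to_sink: "reach \<Psi> S u True x k \<Longrightarrow> sink y \<Longrightarrow> congr2pi x y \<Longrightarrow> reach \<Psi> S u False y k"

lemma reach_ends:
  assumes "reach \<Psi> S u b z k" "source u" "\<And>s t. S s t \<Longrightarrow> C s t"
  shows "if b then source z else sink z"
  using assms(1) by induction (use assms in \<open>auto simp: source_def sink_def\<close>)

lemma reach_nonneg:
  assumes "reach \<Psi> S u b z k" "weight \<Psi>"
  shows "0 \<le> k"
  using assms(1)
proof induction
  case (forward x k y)
  then show ?case using assms(2) by (simp add: weight_def)
qed auto

text \<open>Arcs traversed forwards form \<open>M\<close>, those traversed backwards
  \<open>M0\<close>; these are multisets since paths may repeat arcs. A change of role is a trivial
  arc, forwards for \<open>to_sink\<close> and backwards for \<open>to_source\<close>. Intermediate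
  points cancel, so only \<open>u\<close> and \<open>z\<close> unbalance the ends.\<close>

lemma reach_matching:
  assumes "reach \<Psi> S u b z k" and w: "weight \<Psi>" and u: "source u"
    and S: "\<And>s t. S s t \<Longrightarrow> C s t \<and> \<Psi> s t = 0"
  shows "\<exists>M M0. (\<forall>p\<in>#M. Cbar (fst p) (snd p)) \<and>
    (\<forall>p\<in>#M0. S (fst p) (snd p) \<or> trivial_arc (fst p) (snd p)) \<and> total \<Psi> M = k \<and>
    (if b then add_mset z (image_mset fst M) = add_mset u (image_mset fst M0) \<and> image_mset snd M = image_mset snd M0
     else image_mset fst M = add_mset u (image_mset fst M0) \<and> image_mset snd M = add_mset z (image_mset snd M0))"
  using assms(1)
proof induction
  case start
  show ?case by (rule exI[of _ "{#}"], rule exI[of _ "{#}"]) simp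
next
  case (forward x k y)
  then obtain M M0 where M: "\<forall>p\<in>#M. Cbar (fst p) (snd p)"
    "\<forall>p\<in>#M0. S (fst p) (snd p) \<or> trivial_arc (fst p) (snd p)" "total \<Psi> M = k"
    "add_mset x (image_mset fst M) = add_mset u (image_mset fst M0)" "image_mset snd M = image_mset snd M0"
    by auto
  show ?case
    by (rule exI[of _ "add_mset (x, y) M"], rule exI[of _ M0]) (use M forward in \<open>auto simp: Cbar_def\<close>)
next
  case (backward y k x)
  then obtain M M0 where M: "\<forall>p\<in>#M. Cbar (fst p) (snd p)"
    "\<forall>p\<in>#M0. S (fst p) (snd p) \<or> trivial_arc (fst p) (snd p)" "total \<Psi> M = k"
    "image_mset fst M = add_mset u (image_mset fst M0)" "image_mset snd M = add_mset y (image_mset snd M0)"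
    by auto
  show ?case
    by (rule exI[of _ M], rule exI[of _ "add_mset (x, y) M0"]) (use M backward in auto)
next
  case (to_source y k x)
  then have y: "sink y" using reach_ends[of \<Psi> S u False y k] u S by auto
  obtain M M0 where M: "\<forall>p\<in>#M. Cbar (fst p) (snd p)"
    "\<forall>p\<in>#M0. S (fst p) (snd p) \<or> trivial_arc (fst p) (snd p)" "total \<Psi> M = k"
    "image_mset fst M = add_mset u (image_mset fst M0)" "image_mset snd M = add_mset y (image_mset snd M0)"
    using to_source by auto
  show ?case
    by (rule exI[of _ M], rule exI[of _ "add_mset (x, y) M0"])
      (use M congr_trivial_arc[OF to_source(2) y to_source(3)] in auto)
next
  case (to_sink x k y)
  then have x: "source x" using reach_ends[of \<Psi> S u True x k] u S by auto
  obtain M M0 where M: "\<forall>p\<in>#M. Cbar (fst p) (snd p)"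
    "\<forall>p\<in>#M0. S (fst p) (snd p) \<or> trivial_arc (fst p) (snd p)" "total \<Psi> M = k"
    "add_mset x (image_mset fst M) = add_mset u (image_mset fst M0)" "image_mset snd M = image_mset snd M0"
    using to_sink by auto
  have t: "trivial_arc x y" by (rule congr_trivial_arc[OF x to_sink(2,3)])
  show ?case
    by (rule exI[of _ "add_mset (x, y) M"], rule exI[of _ M0])
      (use M t trivial_arc_weight[OF w t] in \<open>auto simp: Cbar_def\<close>)
qed

text \<open>Adding \<open>(u, v)\<close> to the backward arcs closes the path to two matchings with
  the same ends. The backward one has no crossings, so it is optimal, and its weight is just
  \<open>\<Psi> u v\<close>.\<close>

lemma reach_lower_bound:
  assumes r: "reach \<Psi> S u False v k" and w: "weight \<Psi>" and uv: "C u v"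
    and S: "\<And>s t. S s t \<Longrightarrow> C s t \<and> \<Psi> s t = 0"
    and nc: "noncrossing S"
    and uvS: "\<And>s t. S s t \<Longrightarrow> \<not> cross s t u v \<and> \<not> cross u v s t"
  shows "\<Psi> u v \<le> k"
proof -
  have u: "source u" using uv by (auto simp: source_def)
  obtain M M0 where M: "\<forall>p\<in>#M. Cbar (fst p) (snd p)"
    "\<forall>p\<in>#M0. S (fst p) (snd p) \<or> trivial_arc (fst p) (snd p)" "total \<Psi> M = k"
    "image_mset fst M = add_mset u (image_mset fst M0)" "image_mset snd M = add_mset v (image_mset snd M0)"
    using reach_matching[OF r w u S] by auto
  have zero: "\<Psi> (fst p) (snd p) = 0" if "p \<in># M0" for p
    using M(2) that S trivial_arc_weight[OF w] by blast
  have "total \<Psi> M0 = 0" unfolding total_def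
    by (simp add: zero cong: image_mset_cong)
  moreover have "total \<Psi> (add_mset (u, v) M0) \<le> total \<Psi> M"
  proof (rule noncrossing_matching_optimal[OF w M(1)])
    show "\<forall>p\<in>#add_mset (u, v) M0. Cbar (fst p) (snd p)" using M(2) S uv by (auto simp: Cbar_def)
    have "\<not> cross u v u v" by (auto simp: cross_def)
    then have a: "\<not> cross u v (fst p) (snd p) \<and> \<not> cross (fst p) (snd p) u v" if "p \<in># add_mset (u, v) M0" for p
      using M(2) uvS trivial_not_cross that by fastforce
    have b: "\<not> cross (fst p) (snd p) (fst q) (snd q)" if "p \<in># M0" "q \<in># M0" for p q
      using M(2) nc trivial_not_cross that unfolding noncrossing_def by blast
    show "\<forall>p\<in>#add_mset (u, v) M0. \<forall>q\<in>#add_mset (u, v) M0. \<not> cross (fst p) (snd p) (fst q) (snd q)"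
      using a b by auto
  qed (use M in auto)
  ultimately show ?thesis using M(3) by simp
qed

text \<open>The potential is the shortest path distance from \<open>u\<close>, capped at
  \<open>\<Psi> u v\<close>. Backward steps of cost 0 make it constant along \<open>S\<close>, and
  the lower bound for paths gives the value at \<open>v\<close>.\<close>

lemma tight_potential_exists:
  assumes w: "weight \<Psi>" and uv: "C u v"
    and S: "\<And>s t. S s t \<Longrightarrow> C s t \<and> \<Psi> s t = 0"
    and nc: "noncrossing S"
    and uvS: "\<And>s t. S s t \<Longrightarrow> \<not> cross s t u v \<and> \<not> cross u v s t"
  shows "\<exists>f. potential \<Psi> f \<and> (\<forall>s t. S s t \<longrightarrow> f s = f t) \<and> f v - f u = \<Psi> u v"
proof -
  have u: "source u" "sink v" using uv by (auto simp: source_def sink_def)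
  \<comment> \<open>Inserting \<open>\<Psi> u v\<close> is the cap: the infimum is taken over a
    nonempty set even at points that no path reaches. Congruent points share their paths, which
    makes \<open>f\<close> periodic.\<close>
  define R where "R r = insert (\<Psi> u v) {k. \<exists>b z. reach \<Psi> S u b z k \<and> congr2pi z r}" for r
  define f where "f r = Inf (R r)" for r
  have uv0: "0 \<le> \<Psi> u v" using w uv by (auto simp: weight_def)
  have R0: "0 \<le> k" if "k \<in> R r" for k r
    using that reach_nonneg[OF _ w] uv0 by (auto simp: R_def)
  have bdd: "bdd_below (R r)" for r using R0 by (meson bdd_below.I)
  have ne: "R r \<noteq> {}" for r by (auto simp: R_def)
  have le: "f r \<le> k" if "k \<in> R r" for r k using cInf_lower[OF that bdd] by (simp add: f_def)
  have ge: "m \<le> f r" if "\<And>k. k \<in> R r \<Longrightarrow> m \<le> k" for r m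
    using cInf_greatest[OF ne that] by (simp add: f_def)
  have ends: "if b then source z else sink z" if "reach \<Psi> S u b z k" for b z k
    using reach_ends[OF that] u S by auto
  have src: "reach \<Psi> S u True x k" if "reach \<Psi> S u b z k" "congr2pi z x" "source x" for b z x k
  proof (cases b)
    case True
    then have "z = x" using ends[OF that(1)] source_unique that by auto
    then show ?thesis using that True by simp
  next
    case False
    then show ?thesis using reach.to_source that congr2pi_sym by auto
  qed
  have snk: "reach \<Psi> S u False y k" if "reach \<Psi> S u b z k" "congr2pi z y" "sink y" for b z y k
  proof (cases b)
    case False
    then have "z = y" using ends[OF that(1)] sink_unique that by auto
    then show ?thesis using that False by simp
  next
    case True
    then show ?thesis using reach.to_sink that by auto
  qed
  have edge: "f t - f s \<le> \<Psi> s t" if st: "C s t" for s t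
  proof -
    have "f t - \<Psi> s t \<le> f s"
    proof (rule ge)
      fix k assume "k \<in> R s"
      then consider "k = \<Psi> u v" | b z where "reach \<Psi> S u b z k" "congr2pi z s" by (auto simp: R_def)
      then show "f t - \<Psi> s t \<le> k"
      proof cases
        case 1
        have "f t \<le> \<Psi> u v" by (rule le) (simp add: R_def)
        moreover have "0 \<le> \<Psi> s t" using w st by (auto simp: weight_def)
        ultimately show ?thesis using 1 by simp
      next
        case 2
        have "reach \<Psi> S u True s k" using src[OF 2] st by (auto simp: source_def)
        then have "reach \<Psi> S u False t (k + \<Psi> s t)" using reach.forward st by blast
        then have "f t \<le> k + \<Psi> s t" by (intro le) (auto simp: R_def intro: congr2pi_refl)
        then show ?thesis by simp
      qed
    qed
    then show ?thesis by simp
  qed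
  have per: "periodic2pi f" unfolding periodic2pi_def
  proof (intro allI impI)
    fix x y assume "congr2pi x y"
    then have "R x = R y" unfolding R_def using congr2pi_trans congr2pi_sym by blast
    then show "f x = f y" by (simp add: f_def)
  qed
  have Seq: "f s = f t" if st: "S s t" for s t
  proof (rule antisym)
    show "f s \<le> f t"
    proof (rule ge)
      fix k assume "k \<in> R t"
      then consider "k = \<Psi> u v" | b z where "reach \<Psi> S u b z k" "congr2pi z t" by (auto simp: R_def)
      then show "f s \<le> k"
      proof cases
        case 1
        then show ?thesis by (intro le) (simp add: R_def)
      next
        case 2
        have "reach \<Psi> S u False t k" using snk[OF 2] S[OF st] by (auto simp: sink_def)
        then have "reach \<Psi> S u True s k" using reach.backward st by blast
        then show ?thesis by (intro le) (auto simp: R_def intro: congr2pi_refl)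
      qed
    qed
    show "f t \<le> f s" using edge[of s t] S[OF st] by simp
  qed
  have "f u = 0"
  proof (rule antisym)
    show "f u \<le> 0" by (rule le) (auto simp: R_def intro!: exI reach.start)
    show "0 \<le> f u" by (rule ge) (rule R0)
  qed
  moreover have "f v = \<Psi> u v"
  proof (rule antisym)
    show "f v \<le> \<Psi> u v" by (rule le) (simp add: R_def)
    show "\<Psi> u v \<le> f v"
    proof (rule ge)
      fix k assume "k \<in> R v"
      then consider "k = \<Psi> u v" | b z where "reach \<Psi> S u b z k" "congr2pi z v" by (auto simp: R_def)
      then show "\<Psi> u v \<le> k"
      proof cases
        case 2
        then show ?thesis using reach_lower_bound[OF snk[OF 2 u(2)] w uv S nc uvS] by blast
      qed simp
    qed
  qed
  ultimately show ?thesis using edge per Seq unfolding potential_def by (intro exI[of _ f]) auto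
qed

end

section \<open>Potentials on the gaps of the circle\<close>

definition circ :: "real \<Rightarrow> real \<Rightarrow> real set" where
  "circ a b = {x. \<exists>y. congr2pi x y \<and> a < y \<and> y < b}"

lemma circI: "congr2pi x y \<Longrightarrow> a < y \<Longrightarrow> y < b \<Longrightarrow> x \<in> circ a b"
  by (auto simp: circ_def)

lemma circ_congr: "congr2pi x y \<Longrightarrow> x \<in> circ a b \<longleftrightarrow> y \<in> circ a b"
  unfolding circ_def using congr2pi_trans congr2pi_sym by blast

lemma congr2pi_near_or_far:
  assumes "congr2pi x y"
  shows "y = x \<or> y = x + 2 * pi \<or> x + 4 * pi \<le> y \<or> y \<le> x - 2 * pi"
proof -
  have "congr2pi (x + 2 * pi) y" using congr2pi_shift(2) assms congr2pi_trans by blast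
  then show ?thesis using congr2pi_cases[of x y] congr2pi_cases[of "x + 2 * pi" y] assms by fastforce
qed

context arcs
begin

lemma Cbar_potential:
  assumes "potential \<Psi> f" "weight \<Psi>" "Cbar s t"
  shows "f t - f s \<le> \<Psi> s t"
proof (cases "C s t")
  case True
  then show ?thesis using assms by (auto simp: potential_def)
next
  case False
  then have t: "trivial_arc s t" using assms by (simp add: Cbar_def)
  then have "congr2pi s t" using congr2pi_shift by (auto simp: trivial_arc_def)
  then have "f s = f t" using assms(1) by (auto simp: potential_def periodic2pi_def)
  then show ?thesis using trivial_arc_weight[OF assms(2) t] by simp
qed

text \<open>Uniqueness of the solution vanishing on \<open>T\<close>, in terms of potentials: a
  potential that is constant along all arcs of \<open>C\<close> changes no coordinate.\<close>

definition determined :: "(real \<Rightarrow> real \<Rightarrow> real) \<Rightarrow> (real \<Rightarrow> real \<Rightarrow> bool) \<Rightarrow> bool" where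
  "determined \<Psi> T \<longleftrightarrow> (\<forall>g. potential \<Psi> g \<and> (\<forall>s t. T s t \<longrightarrow> g s = g t) \<longrightarrow> (\<forall>s t. C s t \<longrightarrow> g s = g t))"

text \<open>Only differences along arcs matter. So the value \<open>a\<close> is required just where
  an arc leaves or enters \<open>J\<close>, and arcs within \<open>J\<close> need only have equal
  values at their ends.\<close>

definition rigid_on :: "real set \<Rightarrow> (real \<Rightarrow> real) \<Rightarrow> real \<Rightarrow> bool" where
  "rigid_on J f a \<longleftrightarrow> (\<forall>x y. C x y \<longrightarrow> (x \<in> J \<and> y \<in> J \<longrightarrow> f x = f y) \<and>
     (x \<in> J \<and> y \<notin> J \<longrightarrow> f x = a) \<and> (x \<notin> J \<and> y \<in> J \<longrightarrow> f y = a))"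

text \<open>
  The bounds say that the truncations of \<open>f - a\<close> on \<open>J\<close> to its positive and negative parts,
  extended by 0, are again potentials; by uniqueness both are constant along all arcs.
\<close>

lemma rigid_onI:
  assumes det: "determined \<Psi> T" and w: "weight \<Psi>" and f: "potential \<Psi> f"
    and J: "\<And>x y. congr2pi x y \<Longrightarrow> x \<in> J \<longleftrightarrow> y \<in> J"
    and T: "\<And>s t. T s t \<Longrightarrow> C s t" "\<And>s t. T s t \<Longrightarrow> s \<in> J \<Longrightarrow> t \<in> J \<Longrightarrow> f s = f t"
    and entry: "\<And>x y. C x y \<Longrightarrow> x \<notin> J \<Longrightarrow> y \<in> J \<Longrightarrow> f y - a \<le> \<Psi> x y \<and> (T x y \<longrightarrow> f y = a)"
    and exit: "\<And>x y. C x y \<Longrightarrow> x \<in> J \<Longrightarrow> y \<notin> J \<Longrightarrow> a - f x \<le> \<Psi> x y \<and> (T x y \<longrightarrow> f x = a)"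
  shows "rigid_on J f a"
proof -
  define g where "g x = (if x \<in> J then max (f x - a) 0 else 0)" for x
  define h where "h x = (if x \<in> J then min (f x - a) 0 else 0)" for x
  have fp: "periodic2pi f" using f by (simp add: potential_def)
  have per: "periodic2pi g" "periodic2pi h"
    using fp J unfolding periodic2pi_def g_def h_def by metis+
  have nn: "0 \<le> \<Psi> x y" if "C x y" for x y using w that by (auto simp: weight_def)
  have fe: "f y - f x \<le> \<Psi> x y" if "C x y" for x y using f that by (auto simp: potential_def)
  have "potential \<Psi> g" unfolding potential_def
  proof (intro conjI allI impI per)
    fix x y assume c: "C x y"
    show "g y - g x \<le> \<Psi> x y"
      using entry[OF c] nn[OF c] fe[OF c] unfolding g_def by (auto simp: max_def)
  qed
  moreover have "potential \<Psi> h" unfolding potential_def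
  proof (intro conjI allI impI per)
    fix x y assume c: "C x y"
    show "h y - h x \<le> \<Psi> x y"
      using exit[OF c] nn[OF c] fe[OF c] unfolding h_def by (auto simp: min_def)
  qed
  moreover have "g x = g y \<and> h x = h y" if t: "T x y" for x y
    using T(1)[OF t] T(2)[OF t] entry[of x y] exit[of x y] t unfolding g_def h_def by auto
  ultimately have gh: "g x = g y \<and> h x = h y" if "C x y" for x y
    using det that unfolding determined_def by metis
  have sum: "g x + h x = (if x \<in> J then f x - a else 0)" for x by (auto simp: g_def h_def)
  show ?thesis unfolding rigid_on_def
  proof (intro allI impI)
    fix x y assume c: "C x y"
    have "g x + h x = g y + h y" using gh[OF c] by simp
    then show "(x \<in> J \<and> y \<in> J \<longrightarrow> f x = f y) \<and> (x \<in> J \<and> y \<notin> J \<longrightarrow> f x = a) \<and> (x \<notin> J \<and> y \<in> J \<longrightarrow> f y = a)"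
      unfolding sum by (auto split: if_splits)
  qed
qed

text \<open>An arc with just one end in the gap has its other end at a vertex where \<open>f\<close>
  equals \<open>f s\<close>, or it crosses \<open>(s, q)\<close> or \<open>(p, q)\<close>. These
  have weight zero, so uncrossing yields the bounds for \<open>rigid_onI\<close>. The hypothesis on
  arcs from \<open>p\<close> excludes arcs from outside that end in the lift of the gap by
  \<open>2 * pi\<close>.\<close>

lemma rigid_first_gap:
  assumes sr: "C s r" and pq: "C p q" and x: "cross s r p q"
    and w: "weight \<Psi>" and f: "potential \<Psi> f" and det: "determined \<Psi> T"
    and T: "\<And>s t. T s t \<Longrightarrow> C s t \<and> \<Psi> s t = 0"
    and Tf: "\<And>x y. T x y \<Longrightarrow> x \<in> circ s p \<or> y \<in> circ s p \<Longrightarrow> f x = f y"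
    and fq: "f q = f s"
    and nc: "noncrossing T" and Tpq: "T p q" and Tsq: "q < s + 2 * pi \<Longrightarrow> T s q"
    and no: "\<And>w. s < w \<Longrightarrow> w < p \<Longrightarrow> \<not> C p (w + 2 * pi)"
  shows "rigid_on (circ s p) f (f s)"
proof (rule rigid_onI[OF det w f circ_congr])
  have b: "s < p" "p \<le> r" "r < q" "q \<le> s + 2 * pi" using x by (auto simp: cross_def)
  have rb: "s < r" "r < s + 2 * pi" using strip[OF sr] by auto
  have qb: "p < q" "q < p + 2 * pi" using strip[OF pq] by auto
  have fp: "\<And>x y. congr2pi x y \<Longrightarrow> f x = f y" using f by (simp add: potential_def periodic2pi_def)
  have fs2: "f (s + 2 * pi) = f s" using fp congr2pi_shift by blast
  have csq: "Cbar s q"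
    using Tsq T[of s q] sr pq b by (cases "q < s + 2 * pi") (auto simp: Cbar_def trivial_arc_def source_def sink_def)
  show "\<And>x y. T x y \<Longrightarrow> C x y" using T by auto
  show "\<And>x y. T x y \<Longrightarrow> x \<in> circ s p \<Longrightarrow> y \<in> circ s p \<Longrightarrow> f x = f y" using Tf by auto
  fix x y assume c: "C x y"
  note cs = strip[OF c]
  have fxy: "f y - f x \<le> \<Psi> x y" using f c by (simp add: potential_def)
  have Tnc: "\<not> cross x y x' y'" "\<not> cross x' y' x y" if "T x y" "T x' y'" for x' y'
    using nc that unfolding noncrossing_def by auto
  {
    assume xJ: "x \<notin> circ s p" and yJ: "y \<in> circ s p"
    obtain w where w': "congr2pi w y" "s < w" "w < p" using yJ congr2pi_sym by (auto simp: circ_def)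
    have xn: "\<not> (s < x \<and> x < p)" "\<not> (s + 2 * pi < x \<and> x < p + 2 * pi)"
      using circI[of x x s p] circI[of x "x - 2 * pi" s p] xJ congr2pi_shift by auto
    have "x = s \<or> (cross x y s q \<and> q < s + 2 * pi)"
      using congr2pi_near_or_far[OF w'(1)]
    proof (elim disjE)
      assume y: "y = w"
      show ?thesis
      proof (cases "q > x + 2 * pi")
        case True
        then show ?thesis using spread[OF c pq] y w' by auto
      next
        case False
        then show ?thesis using xn y w' cs b by (auto simp: cross_def)
      qed
    next
      \<comment> \<open>Either the arc itself starts at \<open>p\<close>, or its bottom corner with
        \<open>(p, q)\<close> does; both contradict the assumption on arcs from
        \<open>p\<close>.\<close>
      assume y: "y = w + 2 * pi"
      have xr: "x \<le> r" using spread[OF sr c] y w' by fastforce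
      have px: "p \<le> x" using xn y cs w' by auto
      have "C p (w + 2 * pi)"
      proof (cases "x = p")
        case True then show ?thesis using c y by simp
      next
        case False
        have "cross p q x y" using False px xr b y w' by (auto simp: cross_def)
        then show ?thesis using bottom_corner[OF pq c] y w' by simp
      qed
      then show ?thesis using no w' by auto
    next
      assume "w + 4 * pi \<le> y"
      then show ?thesis using spread[OF sr c] cs w' rb by - (rule FalseE, linarith)
    next
      assume "y \<le> w - 2 * pi"
      then show ?thesis using spread[OF c pq] cs w' qb by - (rule FalseE, linarith)
    qed
    then show "f y - f s \<le> \<Psi> x y \<and> (T x y \<longrightarrow> f y = f s)"
    proof (elim disjE conjE)
      assume "x = s"
      then show ?thesis using Tf[of x y] T[of x y] xJ yJ fxy by auto
    next
      assume cr: "cross x y s q" and lt: "q < s + 2 * pi"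
      have "Cbar x y" using c by (simp add: Cbar_def)
      note u = Cbar_uncross[OF w this csq cr]
      have "\<Psi> s q = 0" using T Tsq lt by auto
      then have "f y - f s \<le> \<Psi> x y"
        using u(1) Cbar_nonneg[OF w u(2)] Cbar_potential[OF f w u(3)] by linarith
      then show ?thesis using Tnc Tsq[OF lt] cr by auto
    qed
  next
    assume xJ: "x \<in> circ s p" and yJ: "y \<notin> circ s p"
    obtain w where w': "congr2pi w x" "s < w" "w < p" using xJ congr2pi_sym by (auto simp: circ_def)
    have yn: "\<not> (s < y \<and> y < p)" "\<not> (s + 2 * pi < y \<and> y < p + 2 * pi)"
      using circI[of y y s p] circI[of y "y - 2 * pi" s p] yJ congr2pi_shift by auto
    have xw: "x = w"
      using congr2pi_near_or_far[OF w'(1)]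
    proof (elim disjE)
      assume "x = w + 2 * pi"
      then show ?thesis using spread[OF sr c] cs w' rb by - (rule FalseE, linarith)
    next
      assume "w + 4 * pi \<le> x"
      then show ?thesis using spread[OF sr c] cs w' rb by - (rule FalseE, linarith)
    next
      assume "x \<le> w - 2 * pi"
      then show ?thesis using spread[OF c pq] cs w' qb by - (rule FalseE, linarith)
    qed
    have "y = s + 2 * pi \<or> y = q \<or> (cross s q x y \<and> q < s + 2 * pi) \<or> cross x y p q"
      using xw yn w' cs b unfolding cross_def by linarith
    then show "f s - f x \<le> \<Psi> x y \<and> (T x y \<longrightarrow> f x = f s)"
    proof (elim disjE conjE)
      assume "y = s + 2 * pi"
      then show ?thesis using Tf[of x y] T[of x y] xJ yJ fxy fs2 by auto
    next
      assume "y = q"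
      then show ?thesis using Tf[of x y] T[of x y] xJ yJ fxy fq by auto
    next
      assume cr: "cross s q x y" and lt: "q < s + 2 * pi"
      have "Cbar x y" using c by (simp add: Cbar_def)
      note u = Cbar_uncross[OF w csq this cr]
      have "\<Psi> s q = 0" using T Tsq lt by auto
      then have "f s - f x \<le> \<Psi> x y"
        using u(1) Cbar_nonneg[OF w u(2)] Cbar_potential[OF f w u(3)] fq by linarith
      then show ?thesis using Tnc Tsq[OF lt] cr by auto
    next
      assume cr: "cross x y p q"
      have "Cbar x y" "Cbar p q" using c pq by (simp_all add: Cbar_def)
      note u = Cbar_uncross[OF w this cr]
      have "\<Psi> p q = 0" using T Tpq by auto
      then have "f s - f x \<le> \<Psi> x y"
        using u(1) Cbar_nonneg[OF w u(3)] Cbar_potential[OF f w u(2)] fq by linarith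
      then show ?thesis using Tnc Tpq cr by auto
    qed
  }
qed

text \<open>The gap is cut off by the single arc \<open>(p, r)\<close> of \<open>T\<close>. An arc
  with just one end in it crosses \<open>(p, r)\<close>, where one uncrossing bounds
  \<open>f\<close>, or has its other end at a lift of \<open>p\<close> or \<open>r\<close>.\<close>

lemma rigid_side:
  assumes w: "weight \<Psi>" and f: "potential \<Psi> f" and det: "determined \<Psi> T"
    and T: "\<And>s t. T s t \<Longrightarrow> C s t \<and> \<Psi> s t = 0"
    and Tf: "\<And>x y. T x y \<Longrightarrow> x \<in> circ p r \<or> y \<in> circ p r \<Longrightarrow> f x = f y"
    and fr: "f r = f p"
    and nc: "noncrossing T" and Tpr: "p < r \<Longrightarrow> T p r"
  shows "rigid_on (circ p r) f (f p)"
proof (cases "p < r")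
  case False
  then have "circ p r = {}" by (auto simp: circ_def)
  then show ?thesis by (simp add: rigid_on_def)
next
  case True
  note Tpr = Tpr[OF True]
  have pr: "C p r" using T Tpr by blast
  show ?thesis
  proof (rule rigid_onI[OF det w f circ_congr])
    have b: "p < r" "r < p + 2 * pi" using strip[OF pr] by auto
    have fp: "\<And>x y. congr2pi x y \<Longrightarrow> f x = f y" using f by (simp add: potential_def periodic2pi_def)
    have fe: "f (r - 2 * pi) = f p" "f r = f p" "f (p + 2 * pi) = f p"
      using fp[OF congr2pi_shift(3), of r] fr fp[OF congr2pi_shift(1), of p] by auto
    show "\<And>x y. T x y \<Longrightarrow> C x y" using T by auto
    show "\<And>x y. T x y \<Longrightarrow> x \<in> circ p r \<Longrightarrow> y \<in> circ p r \<Longrightarrow> f x = f y" using Tf by auto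
    have z: "\<Psi> p r = 0" "Cbar p r" using T[OF Tpr] by (auto simp: Cbar_def)
    fix x y assume c: "C x y"
    note cs = strip[OF c]
    have fxy: "f y - f x \<le> \<Psi> x y" using f c by (simp add: potential_def)
    have cb: "Cbar x y" using c by (simp add: Cbar_def)
    have Tnc: "\<not> cross x y x' y'" "\<not> cross x' y' x y" if "T x y" "T x' y'" for x' y'
      using nc that unfolding noncrossing_def by auto
    {
      assume xJ: "x \<notin> circ p r" and yJ: "y \<in> circ p r"
      obtain w where w': "congr2pi w y" "p < w" "w < r" using yJ congr2pi_sym by (auto simp: circ_def)
      have xn: "\<not> (p < x \<and> x < r)" "\<not> (p - 2 * pi < x \<and> x < r - 2 * pi)"
        using circI[of x x p r] circI[of x "x + 2 * pi" p r] xJ congr2pi_shift by auto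
      have "x = r \<or> x = p \<or> x = r - 2 * pi \<or> cross x y p r"
        using congr2pi_near_or_far[OF w'(1)]
      proof (elim disjE)
        assume "y = w"
        then show ?thesis using xn w' cs b unfolding cross_def by linarith
      next
        assume "y = w + 2 * pi"
        moreover from this have "\<not> r < x" using spread[OF pr c] w' by auto
        ultimately have "x = r" using xn w' cs by linarith
        then show ?thesis by simp
      next
        assume "w + 4 * pi \<le> y"
        then show ?thesis using spread[OF pr c] w' cs b by - (rule FalseE, linarith)
      next
        assume "y \<le> w - 2 * pi"
        then show ?thesis using spread[OF c pr] w' cs b by - (rule FalseE, linarith)
      qed
      then have "f x = f p \<or> cross x y p r" using fe by auto
      then show "f y - f p \<le> \<Psi> x y \<and> (T x y \<longrightarrow> f y = f p)"
      proof
        assume "f x = f p"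
        then show ?thesis using Tf[of x y] T[of x y] xJ yJ fxy by auto
      next
        assume cr: "cross x y p r"
        note u = Cbar_uncross[OF w cb z(2) cr]
        have "f y - f p \<le> \<Psi> x y"
          using u(1) z Cbar_nonneg[OF w u(2)] Cbar_potential[OF f w u(3)] by linarith
        then show ?thesis using Tnc Tpr cr by auto
      qed
    next
      assume xJ: "x \<in> circ p r" and yJ: "y \<notin> circ p r"
      obtain w where w': "congr2pi w x" "p < w" "w < r" using xJ congr2pi_sym by (auto simp: circ_def)
      have yn: "\<not> (p < y \<and> y < r)" "\<not> (p - 2 * pi < y \<and> y < r - 2 * pi)" "\<not> (p + 2 * pi < y \<and> y < r + 2 * pi)"
        using circI[of y y p r] circI[of y "y + 2 * pi" p r] circI[of y "y - 2 * pi" p r] yJ congr2pi_shift by auto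
      have "y = r \<or> y = p \<or> y = p + 2 * pi \<or> cross p r x y"
        using congr2pi_near_or_far[OF w'(1)]
      proof (elim disjE)
        assume "x = w"
        then show ?thesis using yn w' cs b unfolding cross_def by linarith
      next
        assume "x = w + 2 * pi"
        then show ?thesis using spread[OF pr c] w' cs b by - (rule FalseE, linarith)
      next
        assume "w + 4 * pi \<le> x"
        then show ?thesis using spread[OF pr c] w' cs b by - (rule FalseE, linarith)
      next
        assume "x \<le> w - 2 * pi"
        moreover from this have "\<not> y < p" using spread[OF c pr] w' cs by auto
        ultimately have "y = p" using yn w' cs b by linarith
        then show ?thesis by simp
      qed
      then have "f y = f p \<or> cross p r x y" using fe by auto
      then show "f p - f x \<le> \<Psi> x y \<and> (T x y \<longrightarrow> f x = f p)"
      proof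
        assume "f y = f p"
        then show ?thesis using Tf[of x y] T[of x y] xJ yJ fxy by auto
      next
        assume cr: "cross p r x y"
        note u = Cbar_uncross[OF w z(2) cb cr]
        have "f p - f x \<le> \<Psi> x y"
          using u(1) z Cbar_nonneg[OF w u(2)] Cbar_potential[OF f w u(3)] fe by linarith
        then show ?thesis using Tnc Tpr cr by auto
      qed
    }
  qed
qed

end

lemma congr2pi_uminus: "congr2pi x y \<Longrightarrow> congr2pi (- x) (- y)"
  unfolding congr2pi_def by (metis minus_add_distrib mult_minus_right of_int_minus)

lemma periodic2pi_shift: "periodic2pi f \<Longrightarrow> f (x + 2 * pi) = f x" "periodic2pi f \<Longrightarrow> f (x - 2 * pi) = f x"
  unfolding periodic2pi_def using congr2pi_shift by blast+

lemma periodic2pi_uminus: "periodic2pi f \<Longrightarrow> periodic2pi (\<lambda>x. - f x)"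
  by (simp add: periodic2pi_def)

lemma periodic2pi_diff: "periodic2pi f \<Longrightarrow> periodic2pi g \<Longrightarrow> periodic2pi (\<lambda>x. f x - g x)"
  unfolding periodic2pi_def by metis

lemma periodic2pi_reflect: "periodic2pi f \<Longrightarrow> periodic2pi (\<lambda>x. f (- x))"
  unfolding periodic2pi_def using congr2pi_uminus by blast

lemma not_in_circ:
  assumes "a < b" "b \<le> a + 2 * pi"
  shows "a \<notin> circ a b" "b \<notin> circ a b" "\<And>x. b \<le> x \<Longrightarrow> x \<le> a + 2 * pi \<Longrightarrow> x \<notin> circ a b"
proof -
  show *: "x \<notin> circ a b" if x: "b \<le> x" "x \<le> a + 2 * pi" for x
  proof
    assume "x \<in> circ a b"
    then obtain y where "congr2pi x y" "a < y" "y < b" by (auto simp: circ_def)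
    then show False using congr2pi_cases[of x y] x assms by fastforce
  qed
  show "b \<notin> circ a b" using * assms by auto
  have "a + 2 * pi \<notin> circ a b" using * assms by auto
  then show "a \<notin> circ a b" using circ_congr[OF congr2pi_shift(1), of a a b] by simp
qed

section \<open>Exchanging two crossing arcs\<close>

text \<open>\<open>S\<close> stands for the common arcs of two clusters, completed by
  \<open>(s, r)\<close> and by \<open>(p, q)\<close>. Both uniqueness assumptions are used: the
  first gap is attached to \<open>s\<close> by uniqueness of \<open>\<Phi>'\<close> and to
  \<open>p\<close> by that of \<open>\<Phi>\<close>.\<close>

locale exchange = arcs +
  fixes s r p q :: real and S :: "real \<Rightarrow> real \<Rightarrow> bool" and \<Phi> \<Phi>' :: "real \<Rightarrow> real \<Rightarrow> real"
    and g :: "real \<Rightarrow> real"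
  assumes sr: "C s r" and pq: "C p q" and crossing: "cross s r p q"
    and weights: "weight \<Phi>" "weight \<Phi>'"
    and S: "S x y \<Longrightarrow> C x y \<and> \<Phi> x y = 0 \<and> \<Phi>' x y = 0"
    and zeros: "\<Phi> s r = 0" "\<Phi>' p q = 0"
    and nc: "noncrossing (\<lambda>x y. S x y \<or> x = s \<and> y = r)" "noncrossing (\<lambda>x y. S x y \<or> x = p \<and> y = q)"
    and corners: "p < r \<Longrightarrow> S p r" "q < s + 2 * pi \<Longrightarrow> S s q"
    and g: "periodic2pi g" "C x y \<Longrightarrow> \<Phi>' x y = \<Phi> x y + g x - g y"
    and det: "determined \<Phi> (\<lambda>x y. S x y \<or> x = s \<and> y = r)"
      "determined \<Phi>' (\<lambda>x y. S x y \<or> x = p \<and> y = q)"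
begin

lemma bounds: "s < p" "p \<le> r" "r < q" "q \<le> s + 2 * pi" "s < r" "r < s + 2 * pi" "p < q" "q < p + 2 * pi"
  using crossing strip[OF sr] strip[OF pq] by (auto simp: cross_def)

text \<open>Adding \<open>f x - f y\<close> to \<open>\<Phi> x y\<close> keeps the zeros on
  \<open>S\<close> exactly for these \<open>f\<close>, so they describe the face of the common
  arcs.\<close>

definition flat :: "(real \<Rightarrow> real) \<Rightarrow> bool" where
  "flat f \<longleftrightarrow> (\<forall>x y. S x y \<longrightarrow> f x = f y)"

text \<open>Each of the corners \<open>(p, r)\<close> and \<open>(s, q)\<close> lies in
  \<open>S\<close> or has ends that coincide on the circle. So a flat potential has only two
  independent values at the four vertices.\<close>

lemma flat_corners: "periodic2pi f \<Longrightarrow> flat f \<Longrightarrow> f r = f p" "periodic2pi f \<Longrightarrow> flat f \<Longrightarrow> f q = f s"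
  using corners bounds periodic2pi_shift(1)[of f s] unfolding flat_def
  by (metis order_le_less)+

lemma flat_g: "flat g"
  unfolding flat_def
proof (intro allI impI)
  fix x y assume "S x y"
  then show "g x = g y" using S[of x y] g(2)[of x y] by auto
qed

lemma potential_change:
  assumes "potential \<Phi> f"
  shows "potential \<Phi>' (\<lambda>x. f x - g x)"
  unfolding potential_def
proof (intro conjI allI impI)
  show "periodic2pi (\<lambda>x. f x - g x)"
    using assms g(1) periodic2pi_diff by (auto simp: potential_def)
  fix x y assume "C x y"
  then show "f y - g y - (f x - g x) \<le> \<Phi>' x y"
    using g(2)[of x y] assms unfolding potential_def by (smt (verit))
qed

lemma potential_zero: "potential \<Phi> (\<lambda>x. 0)"
  using weights by (auto simp: potential_def periodic2pi_def weight_def)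

lemma first_gap_from_left_end:
  assumes no: "\<And>w. s < w \<Longrightarrow> w < p \<Longrightarrow> \<not> C p (w + 2 * pi)"
    and h: "potential \<Phi>' h" "flat h"
  shows "rigid_on (circ s p) h (h s)"
proof (rule rigid_first_gap[OF sr pq crossing weights(2) h(1) det(2)])
  show "h q = h s" using flat_corners h by (auto simp: potential_def)
  show "noncrossing (\<lambda>x y. S x y \<or> x = p \<and> y = q)" by (rule nc)
  show "S s q \<or> s = p \<and> q = q" if "q < s + 2 * pi" using corners that by auto
  show "\<And>w. s < w \<Longrightarrow> w < p \<Longrightarrow> \<not> C p (w + 2 * pi)" by (rule no)
  have "p \<notin> circ s p" "q \<notin> circ s p" using not_in_circ[of s p] bounds by auto
  then show "\<And>x y. S x y \<or> x = p \<and> y = q \<Longrightarrow> x \<in> circ s p \<or> y \<in> circ s p \<Longrightarrow> h x = h y"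
    using h(2) by (auto simp: flat_def)
  show "\<And>x y. S x y \<or> x = p \<and> y = q \<Longrightarrow> C x y \<and> \<Phi>' x y = 0" using S pq zeros by auto
qed auto

lemma second_gap:
  assumes f: "potential \<Phi> f" "flat f"
  shows "rigid_on (circ p r) f (f p)"
proof (rule rigid_side[OF weights(1) f(1) det(1)])
  show "f r = f p" using flat_corners f by (auto simp: potential_def)
  show "noncrossing (\<lambda>x y. S x y \<or> x = s \<and> y = r)" by (rule nc)
  show "S p r \<or> p = s \<and> r = r" if "p < r" using corners that by auto
  show "\<And>x y. S x y \<or> x = s \<and> y = r \<Longrightarrow> C x y \<and> \<Phi> x y = 0" using S sr zeros by auto
  have "s \<notin> circ p r \<and> r \<notin> circ p r"
  proof (cases "p < r")
    case True
    have "s + 2 * pi \<notin> circ p r" using not_in_circ(3)[OF True, of "s + 2 * pi"] bounds by auto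
    then show ?thesis
      using not_in_circ(2)[OF True] bounds circ_congr[OF congr2pi_shift(1), of s p r] by auto
  next
    case False
    then show ?thesis by (auto simp: circ_def)
  qed
  then show "\<And>x y. S x y \<or> x = s \<and> y = r \<Longrightarrow> x \<in> circ p r \<or> y \<in> circ p r \<Longrightarrow> f x = f y"
    using f(2) by (auto simp: flat_def)
qed

end

text \<open>
  The class of arc systems is closed under the shift and under the reflection
  \<open>(s, t) \<mapsto> (-s, 2\<pi> - t)\<close>. The shift rotates the gaps of an exchange, while the reflection
  reverses the order of the two crossing arcs.
\<close>

context arcs
begin

lemma shift_arcs: "arcs (\<lambda>s t. C (t - 2 * pi) s)"
proof
  fix s t s' t' :: real
  assume c: "C (t - 2 * pi) s" "C (t' - 2 * pi) s'"
  show "t < s' \<Longrightarrow> s + 2 * pi < t' \<Longrightarrow> False" using spread[OF c] by auto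
  assume x: "cross s t s' t'"
  then have x': "cross (t - 2 * pi) s (t' - 2 * pi) s'" by (auto simp: cross_def)
  show "s' < t \<Longrightarrow> C (t - 2 * pi) s'" using bottom_corner[OF c x'] by auto
  show "t' < s + 2 * pi \<Longrightarrow> C (t' - 2 * pi) s" using top_corner[OF c x'] by auto
next
  fix s t assume "C (t - 2 * pi) s"
  then show "s < t \<and> t < s + 2 * pi" using strip[of "t - 2 * pi" s] by auto
qed

lemma flip_arcs: "arcs (\<lambda>s t. C (- s) (2 * pi - t))"
proof
  fix s t s' t' :: real
  assume c: "C (- s) (2 * pi - t)" "C (- s') (2 * pi - t')"
  show "t < s' \<Longrightarrow> s + 2 * pi < t' \<Longrightarrow> False" using spread[OF c(2,1)] by auto
  assume x: "cross s t s' t'"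
  then have x': "cross (- s') (2 * pi - t') (- s) (2 * pi - t)" by (auto simp: cross_def)
  show "s' < t \<Longrightarrow> C (- s') (2 * pi - t)" using bottom_corner[OF c(2,1) x'] by auto
  show "t' < s + 2 * pi \<Longrightarrow> C (- s) (2 * pi - t')" using top_corner[OF c(2,1) x'] by auto
next
  fix s t assume "C (- s) (2 * pi - t)"
  then show "s < t \<and> t < s + 2 * pi" using strip[of "- s" "2 * pi - t"] by auto
qed

lemma shift_weight:
  assumes "weight \<Psi>" shows "arcs.weight (\<lambda>s t. C (t - 2 * pi) s) (\<lambda>s t. \<Psi> (t - 2 * pi) s)"
  unfolding arcs.weight_def[OF shift_arcs]
proof (intro conjI allI impI)
  show "\<And>s. \<Psi> (s - 2 * pi) s = 0" using assms unfolding weight_def by (metis diff_add_cancel)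
  show "\<And>s. \<Psi> (s + 2 * pi - 2 * pi) s = 0" using assms unfolding weight_def by simp
  show "\<And>s t. C (t - 2 * pi) s \<Longrightarrow> 0 \<le> \<Psi> (t - 2 * pi) s" using assms unfolding weight_def by simp
  fix s t s' t' assume "C (t - 2 * pi) s \<and> C (t' - 2 * pi) s' \<and> cross s t s' t'"
  moreover from this have "cross (t - 2 * pi) s (t' - 2 * pi) s'" by (auto simp: cross_def)
  ultimately show "\<Psi> (t - 2 * pi) s' + \<Psi> (t' - 2 * pi) s \<le> \<Psi> (t - 2 * pi) s + \<Psi> (t' - 2 * pi) s'"
    using assms unfolding weight_def by (smt (verit))
qed

lemma flip_weight:
  assumes "weight \<Psi>" shows "arcs.weight (\<lambda>s t. C (- s) (2 * pi - t)) (\<lambda>s t. \<Psi> (- s) (2 * pi - t))"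
  unfolding arcs.weight_def[OF flip_arcs]
proof (intro conjI allI impI)
  show "\<And>s. \<Psi> (- s) (2 * pi - s) = 0"
    using assms unfolding weight_def by (metis add.commute uminus_add_conv_diff)
  show "\<And>s. \<Psi> (- s) (2 * pi - (s + 2 * pi)) = 0" using assms unfolding weight_def by simp
  show "\<And>s t. C (- s) (2 * pi - t) \<Longrightarrow> 0 \<le> \<Psi> (- s) (2 * pi - t)" using assms unfolding weight_def by simp
  fix s t s' t' assume "C (- s) (2 * pi - t) \<and> C (- s') (2 * pi - t') \<and> cross s t s' t'"
  moreover from this have "cross (- s') (2 * pi - t') (- s) (2 * pi - t)" by (auto simp: cross_def)
  ultimately show "\<Psi> (- s') (2 * pi - t) + \<Psi> (- s) (2 * pi - t') \<le> \<Psi> (- s) (2 * pi - t) + \<Psi> (- s') (2 * pi - t')"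
    using assms unfolding weight_def by (smt (verit))
qed

text \<open>The shift turns sources into sinks, hence the sign. The reflection keeps them, so there
  only the argument changes.\<close>

lemma shift_potential:
  "arcs.potential (\<lambda>s t. C (t - 2 * pi) s) (\<lambda>s t. \<Psi> (t - 2 * pi) s) f \<longleftrightarrow> potential \<Psi> (\<lambda>x. - f x)"
proof -
  have "periodic2pi f \<longleftrightarrow> periodic2pi (\<lambda>x. - f x)" by (simp add: periodic2pi_def)
  moreover have "(\<forall>s t. C (t - 2 * pi) s \<longrightarrow> f t - f s \<le> \<Psi> (t - 2 * pi) s)
     \<longleftrightarrow> (\<forall>s t. C s t \<longrightarrow> - f t - - f s \<le> \<Psi> s t)" if "periodic2pi f"
  proof (intro iffI allI impI)
    fix s t assume a: "\<forall>s t. C (t - 2 * pi) s \<longrightarrow> f t - f s \<le> \<Psi> (t - 2 * pi) s" "C s t"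
    show "- f t - - f s \<le> \<Psi> s t" using a(1)[rule_format, of "s + 2 * pi" t] a(2) periodic2pi_shift[OF that] by simp
  next
    fix s t assume a: "\<forall>s t. C s t \<longrightarrow> - f t - - f s \<le> \<Psi> s t" "C (t - 2 * pi) s"
    show "f t - f s \<le> \<Psi> (t - 2 * pi) s" using a(1)[rule_format, of "t - 2 * pi" s] a(2) periodic2pi_shift[OF that] by simp
  qed
  ultimately show ?thesis unfolding arcs.potential_def[OF shift_arcs] potential_def by blast
qed

lemma flip_potential:
  "arcs.potential (\<lambda>s t. C (- s) (2 * pi - t)) (\<lambda>s t. \<Psi> (- s) (2 * pi - t)) f \<longleftrightarrow> potential \<Psi> (\<lambda>x. f (- x))"
proof -
  have "periodic2pi f \<longleftrightarrow> periodic2pi (\<lambda>x. f (- x))" using periodic2pi_reflect[of f] periodic2pi_reflect[of "\<lambda>x. f (- x)"] by auto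
  moreover have "(\<forall>s t. C (- s) (2 * pi - t) \<longrightarrow> f t - f s \<le> \<Psi> (- s) (2 * pi - t))
     \<longleftrightarrow> (\<forall>s t. C s t \<longrightarrow> f (- t) - f (- s) \<le> \<Psi> s t)" if "periodic2pi f"
  proof (intro iffI allI impI)
    fix s t assume a: "\<forall>s t. C (- s) (2 * pi - t) \<longrightarrow> f t - f s \<le> \<Psi> (- s) (2 * pi - t)" "C s t"
    show "f (- t) - f (- s) \<le> \<Psi> s t"
      using a(1)[rule_format, of "- s" "2 * pi - t"] a(2) periodic2pi_shift(1)[OF that, of "- t"] by (simp add: add.commute)
  next
    fix s t assume a: "\<forall>s t. C s t \<longrightarrow> f (- t) - f (- s) \<le> \<Psi> s t" "C (- s) (2 * pi - t)"
    show "f t - f s \<le> \<Psi> (- s) (2 * pi - t)"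
      using a(1)[rule_format, of "- s" "2 * pi - t"] a(2) periodic2pi_shift(2)[OF that, of t] by simp
  qed
  ultimately show ?thesis unfolding arcs.potential_def[OF flip_arcs] potential_def by blast
qed

lemma shift_determined:
  assumes "determined \<Psi> T"
  shows "arcs.determined (\<lambda>s t. C (t - 2 * pi) s) (\<lambda>s t. \<Psi> (t - 2 * pi) s) (\<lambda>s t. T (t - 2 * pi) s)"
  unfolding arcs.determined_def[OF shift_arcs] shift_potential
proof (intro allI impI)
  fix h s t assume a: "potential \<Psi> (\<lambda>x. - h x) \<and> (\<forall>s t. T (t - 2 * pi) s \<longrightarrow> h s = h t)" "C (t - 2 * pi) s"
  then have h: "periodic2pi h" using periodic2pi_uminus[of "\<lambda>x. - h x"] by (auto simp: potential_def)
  have "- h x = - h y" if "T x y" for x y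
    using a(1)[THEN conjunct2, rule_format, of "x + 2 * pi" y] that periodic2pi_shift[OF h] by simp
  then have "- h (t - 2 * pi) = - h s" using assms a unfolding determined_def by blast
  then show "h s = h t" using periodic2pi_shift[OF h] by simp
qed

lemma flip_determined:
  assumes "determined \<Psi> T"
  shows "arcs.determined (\<lambda>s t. C (- s) (2 * pi - t)) (\<lambda>s t. \<Psi> (- s) (2 * pi - t)) (\<lambda>s t. T (- s) (2 * pi - t))"
  unfolding arcs.determined_def[OF flip_arcs] flip_potential
proof (intro allI impI)
  fix h s t assume a: "potential \<Psi> (\<lambda>x. h (- x)) \<and> (\<forall>s t. T (- s) (2 * pi - t) \<longrightarrow> h s = h t)" "C (- s) (2 * pi - t)"
  then have h: "periodic2pi h" using periodic2pi_reflect[of "\<lambda>x. h (- x)"] by (auto simp: potential_def)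
  have "h (- x) = h (- y)" if "T x y" for x y
  proof -
    have "h (- x) = h (2 * pi - y)" using a(1)[THEN conjunct2, rule_format, of "- x" "2 * pi - y"] that by simp
    then show ?thesis using periodic2pi_shift(1)[OF h, of "- y"] by (simp add: add.commute)
  qed
  then have "h (- (- s)) = h (- (2 * pi - t))" using assms a unfolding determined_def by blast
  then show "h s = h t" using periodic2pi_shift(2)[OF h, of t] by simp
qed

end

context exchange
begin

lemma g_shift: "g (x + 2 * pi) = g x" "g (x - 2 * pi) = g x"
  using periodic2pi_shift g(1) by auto

lemma shifted: "exchange (\<lambda>s t. C (t - 2 * pi) s) r (s + 2 * pi) q (p + 2 * pi)
  (\<lambda>s t. S (t - 2 * pi) s) (\<lambda>s t. \<Phi> (t - 2 * pi) s) (\<lambda>s t. \<Phi>' (t - 2 * pi) s) (\<lambda>x. - g x)"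
proof -
  interpret A: arcs "\<lambda>s t. C (t - 2 * pi) s" by (rule shift_arcs)
  have eq: "S (y - 2 * pi) x \<or> x = r \<and> y = s + 2 * pi \<longleftrightarrow> S (y - 2 * pi) x \<or> y - 2 * pi = s \<and> x = r"
    "S (y - 2 * pi) x \<or> x = q \<and> y = p + 2 * pi \<longleftrightarrow> S (y - 2 * pi) x \<or> y - 2 * pi = p \<and> x = q" for x y
    by auto
  have n: "noncrossing (\<lambda>x y. T (y - 2 * pi) x)" if "noncrossing T" for T
    unfolding noncrossing_def
  proof (intro allI impI)
    fix x y x' y' assume "T (y - 2 * pi) x \<and> T (y' - 2 * pi) x'"
    then have "\<not> cross (y - 2 * pi) x (y' - 2 * pi) x'" using that unfolding noncrossing_def by blast
    then show "\<not> cross x y x' y'" by (auto simp: cross_def)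
  qed
  show ?thesis
  proof
    show "C (s + 2 * pi - 2 * pi) r" "C (p + 2 * pi - 2 * pi) q" using sr pq by auto
    show "cross r (s + 2 * pi) q (p + 2 * pi)" using crossing bounds by (auto simp: cross_def)
    show "A.weight (\<lambda>s t. \<Phi> (t - 2 * pi) s)" "A.weight (\<lambda>s t. \<Phi>' (t - 2 * pi) s)"
      by (rule shift_weight, rule weights)+
    show "S (y - 2 * pi) x \<Longrightarrow> C (y - 2 * pi) x \<and> \<Phi> (y - 2 * pi) x = 0 \<and> \<Phi>' (y - 2 * pi) x = 0" for x y
      by (rule S)
    show "\<Phi> (s + 2 * pi - 2 * pi) r = 0" "\<Phi>' (p + 2 * pi - 2 * pi) q = 0" using zeros by auto
    show "noncrossing (\<lambda>x y. S (y - 2 * pi) x \<or> x = r \<and> y = s + 2 * pi)"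
      "noncrossing (\<lambda>x y. S (y - 2 * pi) x \<or> x = q \<and> y = p + 2 * pi)"
      unfolding eq using n[OF nc(1)] n[OF nc(2)] by auto
    show "q < s + 2 * pi \<Longrightarrow> S (s + 2 * pi - 2 * pi) q" using corners by auto
    show "p + 2 * pi < r + 2 * pi \<Longrightarrow> S (p + 2 * pi - 2 * pi) r" using corners by auto
    show "periodic2pi (\<lambda>x. - g x)" using g periodic2pi_uminus by auto
    show "C (y - 2 * pi) x \<Longrightarrow> \<Phi>' (y - 2 * pi) x = \<Phi> (y - 2 * pi) x + - g x - - g y" for x y
      using g(2)[of "y - 2 * pi" x] g_shift by simp
    show "A.determined (\<lambda>s t. \<Phi> (t - 2 * pi) s) (\<lambda>x y. S (y - 2 * pi) x \<or> x = r \<and> y = s + 2 * pi)"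
      "A.determined (\<lambda>s t. \<Phi>' (t - 2 * pi) s) (\<lambda>x y. S (y - 2 * pi) x \<or> x = q \<and> y = p + 2 * pi)"
      unfolding eq using shift_determined[OF det(1)] shift_determined[OF det(2)] by auto
  qed
qed

text \<open>The two crossing arcs change places, and with them \<open>\<Phi>\<close> and
  \<open>\<Phi>'\<close>. This turns the argument that attaches the first gap to \<open>s\<close> by
  means of \<open>\<Phi>'\<close> into one that attaches it to \<open>p\<close> by means of
  \<open>\<Phi>\<close>.\<close>

lemma flipped: "exchange (\<lambda>s t. C (- s) (2 * pi - t)) (- p) (2 * pi - q) (- s) (2 * pi - r)
  (\<lambda>s t. S (- s) (2 * pi - t)) (\<lambda>s t. \<Phi>' (- s) (2 * pi - t)) (\<lambda>s t. \<Phi> (- s) (2 * pi - t)) (\<lambda>x. - g (- x))"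
proof -
  interpret A: arcs "\<lambda>s t. C (- s) (2 * pi - t)" by (rule flip_arcs)
  have eq: "S (- x) (2 * pi - y) \<or> x = - s \<and> y = 2 * pi - r \<longleftrightarrow> S (- x) (2 * pi - y) \<or> - x = s \<and> 2 * pi - y = r"
    "S (- x) (2 * pi - y) \<or> x = - p \<and> y = 2 * pi - q \<longleftrightarrow> S (- x) (2 * pi - y) \<or> - x = p \<and> 2 * pi - y = q" for x y
    by auto
  have n: "noncrossing (\<lambda>x y. T (- x) (2 * pi - y))" if "noncrossing T" for T
    unfolding noncrossing_def
  proof (intro allI impI)
    fix x y x' y' assume "T (- x) (2 * pi - y) \<and> T (- x') (2 * pi - y')"
    then have "\<not> cross (- x') (2 * pi - y') (- x) (2 * pi - y)" using that unfolding noncrossing_def by blast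
    then show "\<not> cross x y x' y'" by (auto simp: cross_def)
  qed
  show ?thesis
  proof
    show "C (- (- p)) (2 * pi - (2 * pi - q))" "C (- (- s)) (2 * pi - (2 * pi - r))" using sr pq by auto
    show "cross (- p) (2 * pi - q) (- s) (2 * pi - r)" using crossing bounds by (auto simp: cross_def)
    show "A.weight (\<lambda>s t. \<Phi>' (- s) (2 * pi - t))" "A.weight (\<lambda>s t. \<Phi> (- s) (2 * pi - t))"
      by (rule flip_weight, rule weights)+
    show "S (- x) (2 * pi - y) \<Longrightarrow> C (- x) (2 * pi - y) \<and> \<Phi>' (- x) (2 * pi - y) = 0 \<and> \<Phi> (- x) (2 * pi - y) = 0" for x y
      using S by blast
    show "\<Phi>' (- (- p)) (2 * pi - (2 * pi - q)) = 0" "\<Phi> (- (- s)) (2 * pi - (2 * pi - r)) = 0" using zeros by auto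
    show "noncrossing (\<lambda>x y. S (- x) (2 * pi - y) \<or> x = - p \<and> y = 2 * pi - q)"
      "noncrossing (\<lambda>x y. S (- x) (2 * pi - y) \<or> x = - s \<and> y = 2 * pi - r)"
      unfolding eq using n[OF nc(1)] n[OF nc(2)] by auto
    show "- s < 2 * pi - q \<Longrightarrow> S (- (- s)) (2 * pi - (2 * pi - q))" using corners by auto
    show "2 * pi - r < - p + 2 * pi \<Longrightarrow> S (- (- p)) (2 * pi - (2 * pi - r))" using corners by auto
    show "periodic2pi (\<lambda>x. - g (- x))" using g periodic2pi_uminus periodic2pi_reflect by auto
    show "C (- x) (2 * pi - y) \<Longrightarrow> \<Phi> (- x) (2 * pi - y) = \<Phi>' (- x) (2 * pi - y) + - g (- x) - - g (- y)" for x y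
      using g(2)[of "- x" "2 * pi - y"] g_shift(1)[of "- y"] by (simp add: add.commute)
    show "A.determined (\<lambda>s t. \<Phi>' (- s) (2 * pi - t)) (\<lambda>x y. S (- x) (2 * pi - y) \<or> x = - p \<and> y = 2 * pi - q)"
      "A.determined (\<lambda>s t. \<Phi> (- s) (2 * pi - t)) (\<lambda>x y. S (- x) (2 * pi - y) \<or> x = - s \<and> y = 2 * pi - r)"
      unfolding eq using flip_determined[OF det(1)] flip_determined[OF det(2)] by auto
  qed
qed

lemma circ_uminus: "- x \<in> circ a b \<longleftrightarrow> x \<in> circ (- b) (- a)"
proof
  assume "- x \<in> circ a b"
  then obtain y where "congr2pi (- x) y" "a < y" "y < b" by (auto simp: circ_def)
  then show "x \<in> circ (- b) (- a)" using congr2pi_uminus[of "- x" y] by (intro circI[of _ "- y"]) auto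
next
  assume "x \<in> circ (- b) (- a)"
  then obtain y where "congr2pi x y" "- b < y" "y < - a" by (auto simp: circ_def)
  then show "- x \<in> circ a b" using congr2pi_uminus[of x y] by (intro circI[of _ "- y"]) auto
qed

lemma first_gap_from_right_end:
  assumes no: "\<And>w. s < w \<Longrightarrow> w < p \<Longrightarrow> \<not> C s w"
    and h: "potential \<Phi> h" "flat h"
  shows "rigid_on (circ s p) h (h p)"
proof -
  interpret F: exchange "\<lambda>s t. C (- s) (2 * pi - t)" "- p" "2 * pi - q" "- s" "2 * pi - r"
    "\<lambda>s t. S (- s) (2 * pi - t)" "\<lambda>s t. \<Phi>' (- s) (2 * pi - t)" "\<lambda>s t. \<Phi> (- s) (2 * pi - t)" "\<lambda>x. - g (- x)"
    by (rule flipped)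
  have hp: "periodic2pi h" using h by (simp add: potential_def)
  have 1: "F.rigid_on (circ (- p) (- s)) (\<lambda>x. h (- x)) (h (- (- p)))"
  proof (rule F.first_gap_from_left_end)
    show "\<not> C (- (- s)) (2 * pi - (w + 2 * pi))" if "- p < w" "w < - s" for w
      using no[of "- w"] that by simp
    show "F.potential (\<lambda>s t. \<Phi> (- s) (2 * pi - t)) (\<lambda>x. h (- x))"
      unfolding flip_potential using h by simp
    show "F.flat (\<lambda>x. h (- x))" unfolding F.flat_def
    proof (intro allI impI)
      fix x y assume "S (- x) (2 * pi - y)"
      then have "h (- x) = h (2 * pi - y)" using h(2) by (auto simp: flat_def)
      then show "h (- x) = h (- y)" using periodic2pi_shift(1)[OF hp, of "- y"] by (simp add: add.commute)
    qed
  qed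
  show ?thesis unfolding rigid_on_def
  proof (intro allI impI)
    fix x y assume c: "C x y"
    have c': "C (- (- x)) (2 * pi - (2 * pi - y))" using c by simp
    have y: "h (- (2 * pi - y)) = h y" using periodic2pi_shift(2)[OF hp, of y] by simp
    have y': "2 * pi - y \<in> circ (- p) (- s) \<longleftrightarrow> y \<in> circ s p"
      using circ_uminus[of "2 * pi - y" s p] circ_congr[OF congr2pi_shift(3), of y s p] by simp
    have x': "- x \<in> circ (- p) (- s) \<longleftrightarrow> x \<in> circ s p" using circ_uminus[of "- x" s p] by simp
    show "(x \<in> circ s p \<and> y \<in> circ s p \<longrightarrow> h x = h y) \<and> (x \<in> circ s p \<and> y \<notin> circ s p \<longrightarrow> h x = h p) \<and>
        (x \<notin> circ s p \<and> y \<in> circ s p \<longrightarrow> h y = h p)"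
      using 1[unfolded F.rigid_on_def, rule_format, OF c'] unfolding x' y' y by simp
  qed
qed

text \<open>
  Whether the gap between \<open>s\<close> and \<open>p\<close> is rigidly attached to \<open>s\<close> or to \<open>p\<close> depends on the zigzag: by
  \<open>spread\<close>, it cannot contain targets of arcs from both of them.
\<close>

lemma first_gap:
  "(\<forall>f. potential \<Phi> f \<and> flat f \<longrightarrow> rigid_on (circ s p) f (f s)) \<or>
   (\<forall>f. potential \<Phi> f \<and> flat f \<longrightarrow> rigid_on (circ s p) f (f p))"
proof (cases "\<forall>w. s < w \<and> w < p \<longrightarrow> \<not> C p (w + 2 * pi)")
  case True
  have "rigid_on (circ s p) f (f s)" if f: "potential \<Phi> f" "flat f" for f
  proof -
    \<comment> \<open>Attachment to \<open>s\<close> is known for potentials relative to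
      \<open>\<Phi>'\<close>. It applies to \<open>f - g\<close> and, from the zero potential, to
      \<open>- g\<close>; their difference is \<open>f\<close>.\<close>
    have fl: "flat (\<lambda>x. f x - g x)" "flat (\<lambda>x. 0 - g x)"
      using f flat_g unfolding flat_def by auto
    have "rigid_on (circ s p) (\<lambda>x. f x - g x) (f s - g s)"
      by (rule first_gap_from_left_end) (use True f fl potential_change in auto)
    moreover have "rigid_on (circ s p) (\<lambda>x. 0 - g x) (0 - g s)"
      by (rule first_gap_from_left_end) (use True fl potential_change[OF potential_zero] in auto)
    ultimately show ?thesis unfolding rigid_on_def by (smt (verit))
  qed
  then show ?thesis by blast
next
  case False
  then obtain v where v: "s < v" "v < p" "C p (v + 2 * pi)" by auto
  have "\<not> C s w" if "s < w" "w < p" for w using spread[of s w p "v + 2 * pi"] v that by auto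
  then show ?thesis using first_gap_from_right_end by blast
qed

text \<open>The third and fourth gap are the first and second gap of the shifted exchange;
  potentials change their sign.\<close>

lemma later_gaps:
  "(\<forall>f. potential \<Phi> f \<and> flat f \<longrightarrow> rigid_on (circ r q) f (f r)) \<or>
   (\<forall>f. potential \<Phi> f \<and> flat f \<longrightarrow> rigid_on (circ r q) f (f q))"
  "\<And>f. potential \<Phi> f \<Longrightarrow> flat f \<Longrightarrow> rigid_on (circ q (s + 2 * pi)) f (f q)"
proof -
  interpret F: exchange "\<lambda>s t. C (t - 2 * pi) s" r "s + 2 * pi" q "p + 2 * pi"
    "\<lambda>s t. S (t - 2 * pi) s" "\<lambda>s t. \<Phi> (t - 2 * pi) s" "\<lambda>s t. \<Phi>' (t - 2 * pi) s" "\<lambda>x. - g x"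
    by (rule shifted)
  have F: "F.potential (\<lambda>s t. \<Phi> (t - 2 * pi) s) (\<lambda>x. - f x) \<and> F.flat (\<lambda>x. - f x)"
    if f: "potential \<Phi> f" "flat f" for f
  proof
    show "F.potential (\<lambda>s t. \<Phi> (t - 2 * pi) s) (\<lambda>x. - f x)" unfolding shift_potential using f by simp
    have fp: "periodic2pi f" using f by (simp add: potential_def)
    show "F.flat (\<lambda>x. - f x)" unfolding F.flat_def
    proof (intro allI impI)
      fix x y assume "S (y - 2 * pi) x"
      then have "f (y - 2 * pi) = f x" using f by (simp add: flat_def)
      then show "- f x = - f y" using periodic2pi_shift[OF fp] by simp
    qed
  qed
  have R: "rigid_on (circ a b) f z" if f: "potential \<Phi> f" and "F.rigid_on (circ a b) (\<lambda>x. - f x) (- z)" for f a b z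
    unfolding rigid_on_def
  proof (intro allI impI)
    fix x y assume c: "C x y"
    have fp: "periodic2pi f" using f by (simp add: potential_def)
    have c': "C (x + 2 * pi - 2 * pi) y" using c by simp
    show "(x \<in> circ a b \<and> y \<in> circ a b \<longrightarrow> f x = f y) \<and> (x \<in> circ a b \<and> y \<notin> circ a b \<longrightarrow> f x = z) \<and>
      (x \<notin> circ a b \<and> y \<in> circ a b \<longrightarrow> f y = z)"
      using that(2)[unfolded F.rigid_on_def, rule_format, OF c'] periodic2pi_shift[OF fp]
        circ_congr[OF congr2pi_shift(1), of x a b] by auto
  qed
  show "(\<forall>f. potential \<Phi> f \<and> flat f \<longrightarrow> rigid_on (circ r q) f (f r)) \<or>
   (\<forall>f. potential \<Phi> f \<and> flat f \<longrightarrow> rigid_on (circ r q) f (f q))"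
    using F.first_gap F R by blast
  show "rigid_on (circ q (s + 2 * pi)) f (f q)" if "potential \<Phi> f" "flat f" for f
    using F.second_gap F R that by blast
qed

text \<open>\<open>h\<close> is 1 at \<open>s\<close> and \<open>q\<close>, 0 at \<open>p\<close>
  and \<open>r\<close>, and on each gap it has the value of the vertex to which the gap is attached.
  The attachment does not depend on \<open>f\<close>, so one \<open>h\<close> serves for all flat
  potentials.\<close>

lemma edge_direction:
  "\<exists>h :: real \<Rightarrow> real. \<forall>f. potential \<Phi> f \<and> flat f \<longrightarrow> (\<forall>x y. C x y \<longrightarrow> f x - f y = (f s - f r) * (h x - h y))"
proof -
  \<comment> \<open>The vertex to which the gap is attached, named \<open>s\<close> or
    \<open>r\<close> because flat potentials agree at \<open>p\<close> and \<open>r\<close> and at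
    \<open>q\<close> and \<open>s\<close>.\<close>
  define k1 where "k1 = (if \<forall>f. potential \<Phi> f \<and> flat f \<longrightarrow> rigid_on (circ s p) f (f s) then s else r)"
  define k3 where "k3 = (if \<forall>f. potential \<Phi> f \<and> flat f \<longrightarrow> rigid_on (circ r q) f (f r) then r else s)"
  have k: "k1 = s \<or> k1 = r" "k3 = s \<or> k3 = r" by (auto simp: k1_def k3_def)
  \<comment> \<open>The representative in the period that starts at \<open>s\<close>; there the four
    gaps are consecutive intervals.\<close>
  define red where "red x = x - 2 * pi * \<lfloor>(x - s) / (2 * pi)\<rfloor>" for x
  have red: "congr2pi x (red x)" "s \<le> red x" "red x < s + 2 * pi" for x
  proof -
    define n where "n = \<lfloor>(x - s) / (2 * pi)\<rfloor>"
    have r: "red x = x - 2 * pi * n" by (simp add: red_def n_def)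
    show "congr2pi x (red x)" unfolding congr2pi_def r by (rule exI[of _ "- n"]) simp
    have "of_int n \<le> (x - s) / (2 * pi)" "(x - s) / (2 * pi) < of_int n + 1" unfolding n_def by linarith+
    then show "s \<le> red x" "red x < s + 2 * pi" using pi_gt_zero by (auto simp: r field_simps)
  qed
  have in_circ: "x \<in> circ a b \<longleftrightarrow> a < red x \<and> red x < b" if "s \<le> a" "b \<le> s + 2 * pi" for a b x
  proof
    assume "x \<in> circ a b"
    then obtain y where y: "congr2pi x y" "a < y" "y < b" by (auto simp: circ_def)
    have "congr2pi (red x) y" using congr2pi_trans[OF congr2pi_sym[OF red(1)] y(1)] .
    then have "y = red x" using congr2pi_cases[of "red x" y] red(2,3)[of x] y that by force
    then show "a < red x \<and> red x < b" using y by simp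
  next
    assume "a < red x \<and> red x < b"
    then show "x \<in> circ a b" using circI[OF red(1)] by blast
  qed
  define e where "e z = (if z = s then 1 else 0 :: real)" for z
  define h where "h x = (if red x = s then 1 else if red x < p then e k1 else if red x \<le> r then 0
     else if red x < q then e k3 else 1)" for x
  have "f x - f y = (f s - f r) * (h x - h y)" if f: "potential \<Phi> f" "flat f" and c: "C x y" for f x y
  proof -
    have fp: "periodic2pi f" using f by (simp add: potential_def)
    have fred: "f z = f (red z)" for z using fp red(1) unfolding periodic2pi_def by blast
    note fe = flat_corners[OF fp f(2)]
    \<comment> \<open>Affine interpolation with \<open>F 0 = f r\<close> and
      \<open>F 1 = f s\<close>. An arc within one gap contributes zero to both sides of the claim;
      at the ends of any other arc, \<open>f x = F (h x)\<close>.\<close>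
    define F where "F t = f r + (f s - f r) * t" for t
    have Fe: "f k1 = F (e k1)" "f k3 = F (e k3)" using k bounds by (auto simp: F_def e_def)
    have F01: "f s = F 1" "f r = F 0" by (auto simp: F_def)
    have R1: "rigid_on (circ s p) f (f k1)"
      using first_gap f flat_corners(1)[OF fp f(2)] unfolding k1_def by auto
    have R2: "rigid_on (circ p r) f (f r)" using second_gap[OF f] fe by simp
    have R3: "rigid_on (circ r q) f (f k3)"
      using later_gaps(1) f fe unfolding k3_def by auto
    have R4: "rigid_on (circ q (s + 2 * pi)) f (f s)" using later_gaps(2)[OF f] fe by simp
    note i = in_circ[of s p] in_circ[of p r] in_circ[of r q] in_circ[of q "s + 2 * pi"]
    define gap where "gap a b \<longleftrightarrow> a < red x \<and> red x < b \<and> a < red y \<and> red y < b" for a b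
    have r1: "(gap s p \<longrightarrow> f x = f y) \<and> (s < red x \<and> red x < p \<and> \<not> gap s p \<longrightarrow> f x = F (e k1)) \<and>
        (s < red y \<and> red y < p \<and> \<not> gap s p \<longrightarrow> f y = F (e k1))"
      using R1[unfolded rigid_on_def, rule_format, OF c] bounds i(1) Fe unfolding gap_def by auto
    have r2: "(gap p r \<longrightarrow> f x = f y) \<and> (p < red x \<and> red x < r \<and> \<not> gap p r \<longrightarrow> f x = F 0) \<and>
        (p < red y \<and> red y < r \<and> \<not> gap p r \<longrightarrow> f y = F 0)"
      using R2[unfolded rigid_on_def, rule_format, OF c] bounds i(2) F01 unfolding gap_def by auto
    have r3: "(gap r q \<longrightarrow> f x = f y) \<and> (r < red x \<and> red x < q \<and> \<not> gap r q \<longrightarrow> f x = F (e k3)) \<and>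
        (r < red y \<and> red y < q \<and> \<not> gap r q \<longrightarrow> f y = F (e k3))"
      using R3[unfolded rigid_on_def, rule_format, OF c] bounds i(3) Fe unfolding gap_def by auto
    have r4: "(gap q (s + 2 * pi) \<longrightarrow> f x = f y) \<and>
        (q < red x \<and> red x < s + 2 * pi \<and> \<not> gap q (s + 2 * pi) \<longrightarrow> f x = F 1) \<and>
        (q < red y \<and> red y < s + 2 * pi \<and> \<not> gap q (s + 2 * pi) \<longrightarrow> f y = F 1)"
      using R4[unfolded rigid_on_def, rule_format, OF c] bounds i(4) F01 unfolding gap_def by auto
    have vert: "red z = s \<Longrightarrow> f z = F 1" "red z = p \<Longrightarrow> f z = F 0" "red z = r \<Longrightarrow> f z = F 0" "red z = q \<Longrightarrow> f z = F 1" for z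
      using fred[of z] fe F01 by auto
    have cases: "z = s \<or> s < z \<and> z < p \<or> z = p \<or> p < z \<and> z < r \<or> z = r \<or> r < z \<and> z < q \<or> z = q \<or> q < z"
      if "s \<le> z" for z using that by linarith
    show ?thesis
    proof (cases "gap s p \<or> gap p r \<or> gap r q \<or> gap q (s + 2 * pi)")
      case True
      then have "f x = f y" using r1 r2 r3 r4 by blast
      moreover have "h x = h y" using True bounds unfolding gap_def h_def by auto
      ultimately show ?thesis by simp
    next
      case False
      have "f x = F (h x)"
        using cases[OF red(2)[of x]] vert[of x] r1 r2 r3 r4 False bounds red(3)[of x]
        unfolding h_def by (elim disjE) auto
      moreover have "f y = F (h y)"
        using cases[OF red(2)[of y]] vert[of y] r1 r2 r3 r4 False bounds red(3)[of y]
        unfolding h_def by (elim disjE) auto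
      ultimately show ?thesis by (simp add: F_def algebra_simps)
    qed
  qed
  then show ?thesis by (intro exI[of _ h]) blast
qed

end

section \<open>The strip and the zigzag\<close>

definition pt :: "real \<Rightarrow> real \<Rightarrow> real \<times> real" where
  "pt s t = ((s + t - pi) / 2, (s - t + pi) / 2)"

lemma pt_surj: "X = pt (fst X + snd X) (fst X - snd X + pi)"
  by (simp add: pt_def prod_eq_iff field_simps)

lemma pt_cases: obtains s t where "X = pt s t"
  using pt_surj by blast

lemma pt_coords [simp]: "fst (pt s t) + snd (pt s t) = s" "fst (pt s t) - snd (pt s t) + pi = t"
  by (simp_all add: pt_def field_simps)

lemma pt_eq_iff [simp]: "pt s t = pt s' t' \<longleftrightarrow> s = s' \<and> t = t'"
  by (metis pt_coords)

lemma pt_IndD: "pt s t \<in> IndD \<longleftrightarrow> s < t \<and> t < s + 2 * pi"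
  by (auto simp: pt_def IndD_def field_simps)

text \<open>The side parameters are \<open>a = (s' - s) / 2\<close> and
  \<open>b = (t' - t) / 2\<close>; their upper bounds become \<open>s' \<le> t\<close> and
  \<open>t' \<le> s + 2 * pi\<close>.\<close>

lemma tilting_rectangle_iff:
  "tilting_rectangle X Y W Z \<longleftrightarrow> (\<exists>s t s' t'. s < t \<and> t < s + 2 * pi \<and> cross s t s' t' \<and>
     X = pt s t \<and> Y = pt s' t \<and> W = pt s' t' \<and> Z = pt s t')"
proof
  assume "tilting_rectangle X Y W Z"
  then obtain x y a b where h: "(x, y) \<in> IndD" "0 < a" "a \<le> pi/2 - y" "0 < b" "b \<le> y + pi/2"
    "X = (x, y)" "Y = (x + a, y + a)" "W = (x + a + b, y + a - b)" "Z = (x + b, y - b)"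
    unfolding tilting_rectangle_def by blast
  show "\<exists>s t s' t'. s < t \<and> t < s + 2 * pi \<and> cross s t s' t' \<and>
     X = pt s t \<and> Y = pt s' t \<and> W = pt s' t' \<and> Z = pt s t'"
    by (rule exI[of _ "x + y"], rule exI[of _ "x - y + pi"], rule exI[of _ "x + y + 2 * a"],
        rule exI[of _ "x - y + pi + 2 * b"])
      (use h in \<open>auto simp: pt_def cross_def IndD_def field_simps\<close>)
next
  assume "\<exists>s t s' t'. s < t \<and> t < s + 2 * pi \<and> cross s t s' t' \<and>
     X = pt s t \<and> Y = pt s' t \<and> W = pt s' t' \<and> Z = pt s t'"
  then obtain s t s' t' where h: "s < t" "t < s + 2 * pi" "cross s t s' t'"
     "X = pt s t" "Y = pt s' t" "W = pt s' t'" "Z = pt s t'" by blast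
  show "tilting_rectangle X Y W Z"
    unfolding tilting_rectangle_def
    by (rule exI[of _ "(s + t - pi) / 2"], rule exI[of _ "(s - t + pi) / 2"], rule exI[of _ "(s' - s) / 2"],
        rule exI[of _ "(t' - t) / 2"])
      (use h in \<open>auto simp: pt_def cross_def IndD_def field_simps\<close>)
qed

lemma incompatible_iff:
  assumes "pt s t \<in> IndD" "pt s' t' \<in> IndD"
  shows "incompatible (pt s t) (pt s' t') \<longleftrightarrow> cross s t s' t' \<or> cross s' t' s t"
  using assms unfolding incompatible_def tilting_rectangle_iff pt_IndD pt_eq_iff by blast

section \<open>The zigzag as a Lipschitz graph over the vertical axis\<close>

lemma segment_displacement:
  fixes A B :: "real \<times> real"
  assumes "\<bar>fst B - fst A\<bar> = snd A - snd B" "(x, y) \<in> closed_segment A B"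
  shows "\<bar>x - fst A\<bar> = snd A - y" "\<bar>x - fst B\<bar> = y - snd B"
proof -
  obtain v where v: "0 \<le> v" "v \<le> 1" "x = (1 - v) * fst A + v * fst B" "y = (1 - v) * snd A + v * snd B"
    using assms(2) by (auto simp: closed_segment_def prod_eq_iff)
  have "x - fst A = v * (fst B - fst A)" "x - fst B = (1 - v) * (fst A - fst B)"
    using v by (auto simp: algebra_simps)
  then have "\<bar>x - fst A\<bar> = v * \<bar>fst B - fst A\<bar>" "\<bar>x - fst B\<bar> = (1 - v) * \<bar>fst B - fst A\<bar>"
    using v by (auto simp: abs_mult)
  then show "\<bar>x - fst A\<bar> = snd A - y" "\<bar>x - fst B\<bar> = y - snd B"
    using v assms(1) by (auto simp: algebra_simps)
qed

text \<open>Right angles pass the slope 1 or -1 of the first segment on to all the others, and the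
  heights decrease along the zigzag.\<close>

lemma zigzag_lipschitz:
  assumes "zigzag \<Z>" "(x, y) \<in> \<Z>" "(x', y') \<in> \<Z>"
  shows "\<bar>x - x'\<bar> \<le> \<bar>y - y'\<bar>"
proof -
  obtain n and P :: "nat \<Rightarrow> real \<times> real" where P: "1 \<le> n"
      "(snd (P 1) - snd (P 0)) / (fst (P 1) - fst (P 0)) \<in> {1, -1}"
      "\<And>i. i < n \<Longrightarrow> snd (P (Suc i)) < snd (P i)"
      "\<And>i. Suc i < n \<Longrightarrow> orthogonal (P (Suc i) - P i) (P (Suc (Suc i)) - P (Suc i))"
      "\<Z> = (\<Union>i<n. closed_segment (P i) (P (Suc i))) \<inter> IndD"
    using assms(1) unfolding zigzag_def by auto
  have slope: "\<bar>fst (P (Suc i)) - fst (P i)\<bar> = snd (P i) - snd (P (Suc i))" if "i < n" for i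
    using that
  proof (induction i)
    case 0
    then show ?case using P(2) P(3)[of 0] by (cases "fst (P 1) = fst (P 0)") (auto simp: field_simps)
  next
    case (Suc i)
    define a where "a = fst (P (Suc i)) - fst (P i)"
    define b where "b = snd (P (Suc i)) - snd (P i)"
    define a' where "a' = fst (P (Suc (Suc i))) - fst (P (Suc i))"
    define b' where "b' = snd (P (Suc (Suc i))) - snd (P (Suc i))"
    have "a * a' + b * b' = 0"
      using P(4)[OF Suc.prems] by (simp add: orthogonal_def inner_prod_def a_def b_def a'_def b'_def)
    then have "\<bar>a\<bar> * \<bar>a'\<bar> = \<bar>b\<bar> * \<bar>b'\<bar>" by (metis abs_minus_cancel abs_mult add_eq_0_iff)
    moreover have "\<bar>a\<bar> = \<bar>b\<bar>" "b < 0" "b' < 0" using Suc P(3)[of i] P(3)[of "Suc i"] by (auto simp: a_def b_def b'_def)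
    ultimately have "\<bar>b\<bar> * \<bar>a'\<bar> = \<bar>b\<bar> * \<bar>b'\<bar>" "\<bar>b\<bar> \<noteq> 0" by simp_all
    then have "\<bar>a'\<bar> = \<bar>b'\<bar>" using mult_left_cancel by blast
    then show ?case using \<open>b' < 0\<close> by (simp add: a'_def b'_def)
  qed
  define U where "U k = (\<Union>i<k. closed_segment (P i) (P (Suc i)))" for k
  \<comment> \<open>The bound to the vertex \<open>P k\<close> strengthens the induction: a point
    above it and a point on the next segment are compared through \<open>P k\<close>.\<close>
  have "(\<forall>x y. (x, y) \<in> U k \<longrightarrow> \<bar>x - fst (P k)\<bar> \<le> y - snd (P k)) \<and>
      (\<forall>x y x' y'. (x, y) \<in> U k \<and> (x', y') \<in> U k \<longrightarrow> \<bar>x - x'\<bar> \<le> \<bar>y - y'\<bar>)" if "k \<le> n" for k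
    using that
  proof (induction k)
    case 0
    then show ?case by (simp add: U_def)
  next
    case (Suc k)
    let ?A = "P k" and ?B = "P (Suc k)"
    have sl: "\<bar>fst ?B - fst ?A\<bar> = snd ?A - snd ?B" using slope Suc.prems by auto
    have IH: "\<And>x y. (x, y) \<in> U k \<Longrightarrow> \<bar>x - fst ?A\<bar> \<le> y - snd ?A"
      "\<And>x y x' y'. (x, y) \<in> U k \<Longrightarrow> (x', y') \<in> U k \<Longrightarrow> \<bar>x - x'\<bar> \<le> \<bar>y - y'\<bar>"
      using Suc by auto
    have un: "(x, y) \<in> U (Suc k) \<longleftrightarrow> (x, y) \<in> U k \<or> (x, y) \<in> closed_segment ?A ?B" for x y
      by (auto simp: U_def lessThan_Suc)
    note seg = segment_displacement[OF sl]
    have ss: "\<bar>x - x'\<bar> \<le> \<bar>y - y'\<bar>" if xy: "(x, y) \<in> closed_segment ?A ?B" "(x', y') \<in> closed_segment ?A ?B" for x y x' y'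
    proof -
      obtain v where v: "x = (1 - v) * fst ?A + v * fst ?B" "y = (1 - v) * snd ?A + v * snd ?B"
        using xy(1) by (auto simp: closed_segment_def prod_eq_iff)
      obtain v' where v': "x' = (1 - v') * fst ?A + v' * fst ?B" "y' = (1 - v') * snd ?A + v' * snd ?B"
        using xy(2) by (auto simp: closed_segment_def prod_eq_iff)
      have "x - x' = (v - v') * (fst ?B - fst ?A)" "y - y' = (v - v') * (snd ?B - snd ?A)"
        using v v' by (auto simp: algebra_simps)
      then show ?thesis using sl by (simp add: abs_mult)
    qed
    show ?case
    proof (intro conjI allI impI)
      fix x y assume "(x, y) \<in> U (Suc k)"
      then show "\<bar>x - fst ?B\<bar> \<le> y - snd ?B" unfolding un using IH(1)[of x y] seg[of x y] sl by fastforce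
    next
      fix x y x' y' assume "(x, y) \<in> U (Suc k) \<and> (x', y') \<in> U (Suc k)"
      then consider "(x, y) \<in> U k" "(x', y') \<in> U k" | "(x, y) \<in> U k" "(x', y') \<in> closed_segment ?A ?B"
        | "(x, y) \<in> closed_segment ?A ?B" "(x', y') \<in> U k"
        | "(x, y) \<in> closed_segment ?A ?B" "(x', y') \<in> closed_segment ?A ?B"
        unfolding un by blast
      then show "\<bar>x - x'\<bar> \<le> \<bar>y - y'\<bar>"
      proof cases
        case 1 then show ?thesis by (rule IH(2))
      next
        case 2
        from IH(1)[OF 2(1)] seg(1)[OF 2(2)] show ?thesis by linarith
      next
        case 3
        from IH(1)[OF 3(2)] seg(1)[OF 3(1)] show ?thesis by linarith
      next
        case 4 then show ?thesis by (rule ss)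
      qed
    qed
  qed
  from this[of n] show ?thesis using assms(2,3) unfolding P(5) U_def by blast
qed

lemma zigzag_abscissa_lipschitz:
  assumes "zigzag \<Z>" "- (pi/2) < y" "y < pi/2" "- (pi/2) < y'" "y' < pi/2"
  shows "\<bar>zigzag_abscissa \<Z> y - zigzag_abscissa \<Z> y'\<bar> \<le> \<bar>y - y'\<bar>"
proof (rule zigzag_lipschitz[OF assms(1)])
  show "(zigzag_abscissa \<Z> y, y) \<in> \<Z>" "(zigzag_abscissa \<Z> y', y') \<in> \<Z>"
    unfolding zigzag_abscissa_def
    using theI'[OF zigzag_unique_abscissa[OF assms(1,2,3)]] theI'[OF zigzag_unique_abscissa[OF assms(1,4,5)]] by auto
qed

definition arc_of :: "(real \<times> real) set \<Rightarrow> real \<Rightarrow> real \<Rightarrow> bool" where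
  "arc_of \<Z> s t \<longleftrightarrow> pt s t \<in> IndC \<Z>"

lemma IndC_subset: "IndC \<Z> \<subseteq> IndD"
  by (auto simp: IndC_def)

text \<open>The factor 2 avoids halves of the coordinates \<open>s\<close> and \<open>t\<close> in inequalities.\<close>

definition left_end :: "(real \<times> real) set \<Rightarrow> real \<Rightarrow> real" where
  "left_end \<Z> h = 2 * zigzag_abscissa \<Z> (h / 2)"

lemma arc_of_iff: "arc_of \<Z> s t \<longleftrightarrow> s < t \<and> t < s + 2 * pi \<and>
   left_end \<Z> (s - t + pi) \<le> s + t - pi \<and> s + t - pi \<le> left_end \<Z> (t - s - pi) + 2 * pi"
proof -
  have e: "- ((s - t + pi) / 2) = (t - s - pi) / 2" by (simp add: field_simps)
  define A where "A = zigzag_abscissa \<Z> ((s - t + pi) / 2)"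
  define B where "B = zigzag_abscissa \<Z> ((t - s - pi) / 2)"
  have "arc_of \<Z> s t \<longleftrightarrow> pt s t \<in> IndD \<and> A \<le> (s + t - pi) / 2 \<and> (s + t - pi) / 2 \<le> B + pi"
    unfolding arc_of_def IndC_def A_def B_def e[symmetric] by (simp add: pt_def)
  then show ?thesis
    unfolding left_end_def A_def[symmetric] B_def[symmetric] pt_IndD by (auto simp: field_simps)
qed

lemma left_end_lipschitz:
  assumes "zigzag \<Z>" "\<bar>h\<bar> < pi" "\<bar>h'\<bar> < pi"
  shows "\<bar>left_end \<Z> h - left_end \<Z> h'\<bar> \<le> \<bar>h - h'\<bar>"
proof -
  have "\<bar>zigzag_abscissa \<Z> (h / 2) - zigzag_abscissa \<Z> (h' / 2)\<bar> \<le> \<bar>h / 2 - h' / 2\<bar>"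
    by (rule zigzag_abscissa_lipschitz[OF assms(1)]) (use assms in \<open>auto simp: abs_less_iff\<close>)
  then show ?thesis unfolding left_end_def by linarith
qed

text \<open>Raising \<open>s\<close> and \<open>t\<close> moves a point to the right, with a change
  of height at most that of the abscissa. Such a move cannot lead from the right of a graph with
  Lipschitz constant 1 to its left; the right boundary is treated in reverse.\<close>

lemma arc_of_between:
  assumes z: "zigzag \<Z>" and a: "arc_of \<Z> s t" "arc_of \<Z> s' t'"
    and le: "s \<le> u" "u \<le> s'" "t \<le> v" "v \<le> t'" and uv: "u < v" "v < u + 2 * pi"
  shows "arc_of \<Z> u v"
proof -
  note a = a[unfolded arc_of_iff]
  have "\<bar>s - t + pi\<bar> < pi" "\<bar>u - v + pi\<bar> < pi" "\<bar>t' - s' - pi\<bar> < pi" "\<bar>v - u - pi\<bar> < pi"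
    using a uv unfolding abs_less_iff by linarith+
  then have "\<bar>left_end \<Z> (s - t + pi) - left_end \<Z> (u - v + pi)\<bar> \<le> \<bar>(s - t + pi) - (u - v + pi)\<bar>"
    and "\<bar>left_end \<Z> (t' - s' - pi) - left_end \<Z> (v - u - pi)\<bar> \<le> \<bar>(t' - s' - pi) - (v - u - pi)\<bar>"
    using left_end_lipschitz[OF z] by blast+
  then show ?thesis unfolding arc_of_iff using a le uv by linarith
qed

lemma arcs_arc_of:
  assumes z: "zigzag \<Z>"
  shows "arcs (arc_of \<Z>)"
proof
  show "arc_of \<Z> s t \<Longrightarrow> s < t \<and> t < s + 2 * pi" for s t by (simp add: arc_of_iff)
  fix s t s' t'
  assume a: "arc_of \<Z> s t" "arc_of \<Z> s' t'"
  note a' = a[unfolded arc_of_iff]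
  \<comment> \<open>The shift \<open>(t, s + 2 * pi)\<close> of the first point lies on or right of
    the shifted zigzag. A point strictly beyond it in both coordinates is past the right
    bound.\<close>
  show False if "t < s'" "s + 2 * pi < t'"
  proof -
    have "\<bar>s - t + pi\<bar> < pi" "\<bar>t' - s' - pi\<bar> < pi"
      using a' unfolding abs_less_iff by linarith+
    then have "\<bar>left_end \<Z> (t' - s' - pi) - left_end \<Z> (s - t + pi)\<bar> \<le> \<bar>(t' - s' - pi) - (s - t + pi)\<bar>"
      by (intro left_end_lipschitz[OF z])
    then show False using a' that by linarith
  qed
  assume x: "cross s t s' t'"
  show "s' < t \<Longrightarrow> arc_of \<Z> s' t"
    by (rule arc_of_between[OF z a]) (use x a' in \<open>auto simp: cross_def\<close>)
  show "t' < s + 2 * pi \<Longrightarrow> arc_of \<Z> s t'"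
    by (rule arc_of_between[OF z a]) (use x a' in \<open>auto simp: cross_def\<close>)
qed

section \<open>Tilting rectangles and their integrals\<close>

lemma rectangle_region_eq:
  assumes "s \<le> s'" "t \<le> t'"
  shows "rectangle_region (pt s t) (pt s' t) (pt s' t') (pt s t') =
    {X. s \<le> fst X + snd X \<and> fst X + snd X \<le> s' \<and> t \<le> fst X - snd X + pi \<and> fst X - snd X + pi \<le> t'}"
    (is "?R = ?B")
proof
  have "?B = {X. inner (1, 1) X \<ge> s} \<inter> {X. inner (1, 1) X \<le> s'} \<inter> {X. inner (1, -1) X \<ge> t - pi} \<inter> {X. inner (1, -1) X \<le> t' - pi}"
    by (auto simp: inner_prod_def)
  moreover have "convex ..."
    by (intro convex_Int convex_halfspace_le convex_halfspace_ge)
  ultimately have "convex ?B" by simp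
  then show "?R \<subseteq> ?B" unfolding rectangle_region_def
    by (intro hull_minimal) (use assms in auto)
  show "?B \<subseteq> ?R"
  proof
    fix X assume X: "X \<in> ?B"
    obtain u v where uv: "X = pt u v" by (rule pt_cases)
    have b: "s \<le> u" "u \<le> s'" "t \<le> v" "v \<le> t'" using X uv by auto
    have hull: "pt s t \<in> ?R" "pt s' t \<in> ?R" "pt s' t' \<in> ?R" "pt s t' \<in> ?R"
      unfolding rectangle_region_def by (auto intro: hull_inc)
    have cv: "convex ?R" by (simp add: rectangle_region_def convex_convex_hull)
    have seg: "pt ((1 - k) * a + k * a') ((1 - k) * b + k * b') \<in> ?R"
      if "pt a b \<in> ?R" "pt a' b' \<in> ?R" "0 \<le> k" "k \<le> 1" for a b a' b' k
    proof -
      have "pt ((1 - k) * a + k * a') ((1 - k) * b + k * b') = (1 - k) *\<^sub>R pt a b + k *\<^sub>R pt a' b'"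
        by (simp add: pt_def field_simps)
      then show ?thesis using cv that by (simp add: convex_alt)
    qed
    have par: "\<exists>k. 0 \<le> k \<and> k \<le> 1 \<and> m = (1 - k) * a + k * a'" if "a \<le> m" "m \<le> a'" for a m a' :: real
    proof (cases "a = a'")
      case True then show ?thesis using that by (intro exI[of _ 0]) auto
    next
      case False
      define k where "k = (m - a) / (a' - a)"
      have "k * (a' - a) = m - a" "0 \<le> k" "k \<le> 1" using that False by (auto simp: k_def field_simps)
      then show ?thesis by (intro exI[of _ k]) (auto simp: algebra_simps)
    qed
    obtain k where k: "0 \<le> k" "k \<le> 1" "u = (1 - k) * s + k * s'" using par[of s u s'] b by blast
    obtain l where l: "0 \<le> l" "l \<le> 1" "v = (1 - l) * t + l * t'" using par[of t v t'] b by blast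
    have w: "(1 - k) * c + k * c = c" for c by (simp add: algebra_simps)
    have w': "(1 - l) * c + l * c = c" for c by (simp add: algebra_simps)
    have "pt u t \<in> ?R" "pt u t' \<in> ?R" using seg[OF hull(1,2) k(1,2)] seg[OF hull(4,3) k(1,2)] k(3) by (simp_all add: w)
    then have "pt u v \<in> ?R" using seg[of u t u t' l] l by (simp add: w')
    then show "X \<in> ?R" using uv by simp
  qed
qed

definition area :: "(real \<times> real \<Rightarrow> real) \<Rightarrow> real \<Rightarrow> real \<Rightarrow> real \<Rightarrow> real \<Rightarrow> real" where
  "area c s t s' t' = set_lebesgue_integral lebesgue (rectangle_region (pt s t) (pt s' t) (pt s' t') (pt s t')) c"

text \<open>The rectangle lies in the region of the zigzag, apart from points outside the open
  strip, where \<open>c\<close> is 0. So the integrand is nonnegative, and it is positive on the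
  nonempty open set \<open>O1\<close>, which is not a null set.\<close>

lemma area_pos:
  assumes z: "zigzag \<Z>" and perm: "permissible c" and pos: "\<forall>X\<in>IndC \<Z>. 0 < c X"
    and a: "arc_of \<Z> s t" "arc_of \<Z> s' t'" and x: "cross s t s' t'"
  shows "0 < area c s t s' t'"
proof -
  let ?R = "rectangle_region (pt s t) (pt s' t) (pt s' t') (pt s t')"
  have lt: "s < s'" "t < t'" using x by (auto simp: cross_def)
  have R: "?R = {X. s \<le> fst X + snd X \<and> fst X + snd X \<le> s' \<and> t \<le> fst X - snd X + pi \<and> fst X - snd X + pi \<le> t'}"
    using rectangle_region_eq lt by auto
  have tr: "tilting_rectangle (pt s t) (pt s' t) (pt s' t') (pt s t')"
    unfolding tilting_rectangle_iff using x a(1) by (auto simp: arc_of_iff)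
  have int: "integrable lebesgue (\<lambda>X. indicator ?R X *\<^sub>R c X)"
    using perm tr unfolding permissible_def set_integrable_def by blast
  have in_C: "X \<in> IndC \<Z>" if "X \<in> ?R" "X \<in> IndD" for X
  proof -
    obtain u v where uv: "X = pt u v" by (rule pt_cases)
    have "arc_of \<Z> u v" by (rule arc_of_between[OF z a]) (use that uv R pt_IndD in auto)
    then show ?thesis using uv by (simp add: arc_of_def)
  qed
  have nn: "0 \<le> indicator ?R X *\<^sub>R c X" for X :: "real \<times> real"
  proof (cases "X \<in> ?R \<and> X \<in> IndD")
    case True then show ?thesis using in_C pos by (auto simp: less_imp_le)
  next
    case False
    have "c X = 0" if "X \<notin> IndD"
      using perm that unfolding permissible_def zero_extended_def by blast
    with False show ?thesis by (cases "X \<in> ?R") auto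
  qed
  have "0 \<le> area c s t s' t'" unfolding area_def set_lebesgue_integral_def using nn by (intro Bochner_Integration.integral_nonneg) auto
  moreover have "area c s t s' t' \<noteq> 0"
  proof
    assume "area c s t s' t' = 0"
    then have "AE X in lebesgue. indicator ?R X *\<^sub>R c X = 0"
      unfolding area_def set_lebesgue_integral_def using integral_nonneg_eq_0_iff_AE[OF int] nn by simp
    then obtain N where N: "N \<in> null_sets lebesgue" "{X. indicator ?R X *\<^sub>R c X \<noteq> 0} \<subseteq> N"
      by (auto simp: eventually_ae_filter)
    define O1 where "O1 = {X. s < fst X + snd X} \<inter> {X. fst X + snd X < s'} \<inter>
        {X. t < fst X - snd X + pi} \<inter> {X. fst X - snd X + pi < t'} \<inter> (UNIV \<times> {- (pi/2) <..< pi/2})"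
    have op: "open O1" unfolding O1_def
      by (intro open_Int open_Collect_less continuous_intros open_Times open_UNIV open_greaterThanLessThan)
    have "O1 \<noteq> {}"
    proof -
      have b: "s < t" "t < s + 2 * pi" "s' < t'" "t' < s' + 2 * pi" "s' \<le> t" "t' \<le> s + 2 * pi"
        using a x by (auto simp: arc_of_iff cross_def)
      \<comment> \<open>The centre of the rectangle, in the open strip because the left and right
        corners are.\<close>
      have "pt ((s + s') / 2) ((t + t') / 2) \<in> IndD" 
      proof -
        have "s + s' < t + t'" "t + t' < s + s' + 4 * pi" using b by linarith+
        then show ?thesis unfolding pt_IndD by (simp add: field_simps)
      qed
      then have "pt ((s + s') / 2) ((t + t') / 2) \<in> O1" using lt by (auto simp: O1_def IndD_def)
      then show ?thesis by blast
    qed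
    then have "\<not> negligible O1" using open_not_negligible[OF op] by simp
    moreover have "O1 \<subseteq> N"
    proof
      fix X assume X: "X \<in> O1"
      then have "X \<in> ?R" "X \<in> IndD" unfolding R by (auto simp: O1_def IndD_def)
      then have "indicator ?R X *\<^sub>R c X \<noteq> 0" using in_C pos by fastforce
      then show "X \<in> N" using N by blast
    qed
    ultimately show False using N(1) negligible_iff_null_sets negligible_subset by blast
  qed
  ultimately show ?thesis by simp
qed

text \<open>The corners are sides of the quadrilateral whose diagonals are the two crossing arcs;
  whatever crosses a side crosses a diagonal.\<close>

lemma corner_noncrossing:
  assumes "cross s t s' t'"
    and "\<not> cross a b s t" "\<not> cross s t a b" "\<not> cross a b s' t'" "\<not> cross s' t' a b"
  shows "\<not> cross a b s' t" "\<not> cross s' t a b" "\<not> cross a b s t'" "\<not> cross s t' a b"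
  using assms unfolding cross_def by linarith+

section \<open>Solutions and clusters\<close>

locale associahedron =
  fixes \<Z> :: "(real \<times> real) set" and c :: "real \<times> real \<Rightarrow> real"
  assumes zigzag: "zigzag \<Z>" and permissible: "permissible c" and positive: "\<forall>X\<in>IndC \<Z>. 0 < c X"

sublocale associahedron \<subseteq> arcs "arc_of \<Z>"
  by (rule arcs_arc_of) (rule zigzag)

context associahedron
begin

lemma solution_boundary:
  assumes "solution \<Z> c \<Phi>" "\<not> (s < t \<and> t < s + 2 * pi)"
  shows "\<Phi> (pt s t) = 0"
  using assms pt_IndD unfolding solution_def zero_extended_def by blast

lemma solution_rectangle:
  assumes "solution \<Z> c \<Phi>" "s < t" "t < s + 2 * pi" "cross s t s' t'"
  shows "\<Phi> (pt s t) + \<Phi> (pt s' t') = \<Phi> (pt s' t) + \<Phi> (pt s t') + area c s t s' t'"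
proof -
  have "tilting_rectangle (pt s t) (pt s' t) (pt s' t') (pt s t')"
    using assms unfolding tilting_rectangle_iff by blast
  then show ?thesis using assms(1) unfolding solution_def area_def by blast
qed

lemma solution_nonneg: "solution \<Z> c \<Phi> \<Longrightarrow> arc_of \<Z> s t \<Longrightarrow> 0 \<le> \<Phi> (pt s t)"
  by (simp add: solution_def arc_of_def)

lemma solution_corner_nonneg:
  assumes "solution \<Z> c \<Phi>" "arc_of \<Z> s t" "arc_of \<Z> s' t'" "cross s t s' t'"
  shows "0 \<le> \<Phi> (pt s' t)" "0 \<le> \<Phi> (pt s t')"
proof -
  show "0 \<le> \<Phi> (pt s' t)"
    using top_corner[OF assms(2-4)] solution_nonneg[OF assms(1), of s' t] solution_boundary[OF assms(1), of s' t]
    by (cases "s' < t") auto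
  show "0 \<le> \<Phi> (pt s t')"
    using bottom_corner[OF assms(2-4)] solution_nonneg[OF assms(1), of s t'] solution_boundary[OF assms(1), of s t']
    by (cases "t' < s + 2 * pi") auto
qed

text \<open>The corners have nonnegative values and the area is positive. Hence no solution vanishes
  on two incompatible arcs.\<close>

lemma solution_crossing_pos:
  assumes "solution \<Z> c \<Phi>" "arc_of \<Z> s t" "arc_of \<Z> s' t'" "cross s t s' t'"
  shows "0 < \<Phi> (pt s t) + \<Phi> (pt s' t')"
  using solution_corner_nonneg[OF assms] solution_rectangle[OF assms(1) _ _ assms(4)] strip[OF assms(2)]
    area_pos[OF zigzag permissible positive assms(2-4)] by simp

lemma solution_weight:
  assumes "solution \<Z> c \<Phi>"
  shows "weight (\<lambda>s t. \<Phi> (pt s t))"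
  unfolding weight_def
proof (intro conjI allI impI)
  show "\<And>s t. arc_of \<Z> s t \<Longrightarrow> 0 \<le> \<Phi> (pt s t)" by (rule solution_nonneg[OF assms])
  show "\<Phi> (pt s s) = 0" "\<Phi> (pt s (s + 2 * pi)) = 0" for s using solution_boundary[OF assms] by auto
  fix s t s' t' assume a: "arc_of \<Z> s t \<and> arc_of \<Z> s' t' \<and> cross s t s' t'"
  then show "\<Phi> (pt s' t) + \<Phi> (pt s t') \<le> \<Phi> (pt s t) + \<Phi> (pt s' t')"
    using solution_rectangle[OF assms, of s t s' t'] strip[of s t] area_pos[OF zigzag permissible positive, of s t s' t'] by auto
qed

section \<open>Solutions and potentials on the circle\<close>

lemma solution_add_potential:
  assumes \<Phi>: "solution \<Z> c \<Phi>" and f: "potential (\<lambda>s t. \<Phi> (pt s t)) f"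
  shows "\<exists>\<Psi>. solution \<Z> c \<Psi> \<and> (\<forall>s t. arc_of \<Z> s t \<longrightarrow> \<Psi> (pt s t) = \<Phi> (pt s t) + f s - f t)"
proof -
  define \<Psi> where "\<Psi> X = (if X \<in> IndD then \<Phi> X + f (fst X + snd X) - f (fst X - snd X + pi) else 0)" for X
  have fp: "periodic2pi f" using f by (simp add: potential_def)
  have val: "\<Psi> (pt s t) = \<Phi> (pt s t) + f s - f t" if "s \<le> t" "t \<le> s + 2 * pi" for s t
  proof (cases "s < t \<and> t < s + 2 * pi")
    case True
    then show ?thesis by (simp add: \<Psi>_def pt_IndD)
  next
    case False
    then have "t = s \<or> t = s + 2 * pi" using that by auto
    then have "f s = f t" using periodic2pi_shift(1)[OF fp] by auto
    then show ?thesis using False solution_boundary[OF \<Phi> False] by (auto simp: \<Psi>_def pt_IndD)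
  qed
  have "solution \<Z> c \<Psi>" unfolding solution_def
  proof (intro conjI allI impI ballI)
    show "zero_extended \<Psi>" by (simp add: zero_extended_def \<Psi>_def)
    fix X Y W Z assume "tilting_rectangle X Y W Z"
    then obtain s t s' t' where h: "s < t" "t < s + 2 * pi" "cross s t s' t'"
      "X = pt s t" "Y = pt s' t" "W = pt s' t'" "Z = pt s t'"
      unfolding tilting_rectangle_iff by blast
    \<comment> \<open>In the rectangle relation \<open>f\<close> contributes the same to both sides;
      periodicity makes the formula valid at degenerate corners too.\<close>
    have "\<Psi> (pt s t) = \<Phi> (pt s t) + f s - f t" "\<Psi> (pt s' t') = \<Phi> (pt s' t') + f s' - f t'"
      "\<Psi> (pt s' t) = \<Phi> (pt s' t) + f s' - f t" "\<Psi> (pt s t') = \<Phi> (pt s t') + f s - f t'"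
      by (rule val; use h in \<open>simp add: cross_def\<close>)+
    then show "\<Psi> X + \<Psi> W = \<Psi> Y + \<Psi> Z + set_lebesgue_integral lebesgue (rectangle_region X Y W Z) c"
      using solution_rectangle[OF \<Phi> h(1-3)] unfolding h(4-7) area_def by simp
  next
    fix X assume X: "X \<in> IndC \<Z>"
    obtain s t where st: "X = pt s t" by (rule pt_cases)
    then have a: "arc_of \<Z> s t" using X by (simp add: arc_of_def)
    have "f t - f s \<le> \<Phi> (pt s t)" using f a unfolding potential_def by blast
    then show "0 \<le> \<Psi> X" using val[of s t] strip[OF a] st by auto
  qed
  moreover have "\<Psi> (pt s t) = \<Phi> (pt s t) + f s - f t" if "arc_of \<Z> s t" for s t
    using val[of s t] strip[OF that] by auto
  ultimately show ?thesis by blast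
qed

text \<open>The difference \<open>h\<close> satisfies the rectangle relation without the integral,
  so it splits into a function of \<open>s\<close> and a function of \<open>t\<close>. The potential
  is read off from arcs starting at the base point 0.\<close>

lemma solution_difference:
  assumes \<Phi>: "solution \<Z> c \<Phi>" and \<Psi>: "solution \<Z> c \<Psi>"
  shows "\<exists>f. periodic2pi f \<and> (\<forall>s t. arc_of \<Z> s t \<longrightarrow> \<Psi> (pt s t) = \<Phi> (pt s t) + f s - f t)"
proof -
  define h where "h s t = \<Psi> (pt s t) - \<Phi> (pt s t)" for s t
  have h0: "h s t = 0" if "\<not> (s < t \<and> t < s + 2 * pi)" for s t
    using solution_boundary[OF \<Phi> that] solution_boundary[OF \<Psi> that] by (simp add: h_def)
  have rect: "h s t + h s' t' = h s' t + h s t'" if "s < t" "t < s + 2 * pi" "cross s t s' t'" for s t s' t'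
    using solution_rectangle[OF \<Phi> that] solution_rectangle[OF \<Psi> that] by (simp add: h_def)
  \<comment> \<open>The rectangle from \<open>(s, t)\<close> to its shift
    \<open>(t, s + 2 * pi)\<close> has both other corners on the boundary, where \<open>h\<close> is
    zero.\<close>
  have half: "h t (s + 2 * pi) = - h s t" if "s < t" "t < s + 2 * pi" for s t
    using rect[OF that, of t "s + 2 * pi"] that h0[of t t] h0[of s "s + 2 * pi"] by (auto simp: cross_def)
  have full: "h (s + 2 * pi) (t + 2 * pi) = h s t" if "s < t" "t < s + 2 * pi" for s t
    using half[OF that] half[of t "s + 2 * pi"] that by simp
  have full_nat: "h (s + 2 * pi * real n) (t + 2 * pi * real n) = h s t" if "s < t" "t < s + 2 * pi" for s t and n :: nat
  proof (induction n)
    case (Suc n)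
    then show ?case using full[of "s + 2 * pi * real n" "t + 2 * pi * real n"] that by (simp add: algebra_simps)
  qed simp
  have full_int: "h (s + 2 * pi * of_int n) (t + 2 * pi * of_int n) = h s t" if st: "s < t" "t < s + 2 * pi" for s t and n :: int
  proof (cases "0 \<le> n")
    case True
    then show ?thesis using full_nat[OF st, of "nat n"] by simp
  next
    case False
    have "h (s + 2 * pi * of_int n + 2 * pi * real (nat (- n))) (t + 2 * pi * of_int n + 2 * pi * real (nat (- n)))
      = h (s + 2 * pi * of_int n) (t + 2 * pi * of_int n)"
      by (rule full_nat) (use st in auto)
    moreover have "real (nat (- n)) = - of_int n" using False by simp
    ultimately show ?thesis by simp
  qed
  define red where "red x = x - 2 * pi * of_int \<lfloor>x / (2 * pi)\<rfloor>" for x :: real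
  have red: "0 \<le> red x" "red x < 2 * pi" for x
  proof -
    show "0 \<le> red x" "red x < 2 * pi" unfolding red_def
      using floor_divide_lower[of "2 * pi" x] floor_divide_upper[of "2 * pi" x]
      by (simp_all add: algebra_simps)
  qed
  have red_congr: "congr2pi x (red x)" for x
    unfolding congr2pi_def red_def by (rule exI[of _ "- \<lfloor>x / (2 * pi)\<rfloor>"]) simp
  have red_eq: "red x = y" if "congr2pi x y" "0 \<le> y" "y < 2 * pi" for x y
  proof (rule ccontr)
    assume "red x \<noteq> y"
    moreover have "congr2pi (red x) y" using congr2pi_trans[OF congr2pi_sym[OF red_congr] that(1)] .
    ultimately show False using congr2pi_cases[of "red x" y] red[of x] that by force
  qed
  define f where "f x = - h 0 (red x)" for x
  have per: "periodic2pi f" unfolding periodic2pi_def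
  proof (intro allI impI)
    fix x y assume "congr2pi x y"
    then have "red x = red y" using red_eq[of x "red y"] red[of y] red_congr[of y] congr2pi_trans by blast
    then show "f x = f y" by (simp add: f_def)
  qed
  have base: "h s t = f s - f t" if "0 \<le> s" "s < t" "t < 2 * pi" for s t
  proof -
    have r: "red s = s" "red t = t" using that by (auto intro: red_eq)
    show ?thesis
    proof (cases "s = 0")
      case True
      then show ?thesis using r h0[of 0 0] by (simp add: f_def)
    next
      case False
      \<comment> \<open>The rectangle from \<open>(0, s)\<close> to \<open>(s, t)\<close>, with the
        degenerate top corner \<open>(s, s)\<close>.\<close>
      then have "h 0 s + h s t = h s s + h 0 t" using rect[of 0 s s t] that by (auto simp: cross_def)
      then show ?thesis using r h0[of s s] by (simp add: f_def)
    qed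
  qed
  have "h s t = f s - f t" if st: "s < t" "t < s + 2 * pi" for s t
  proof -
    define n where "n = - \<lfloor>s / (2 * pi)\<rfloor>"
    define s0 where "s0 = s + 2 * pi * of_int n"
    define t0 where "t0 = t + 2 * pi * of_int n"
    have s0: "0 \<le> s0" "s0 < 2 * pi" "s0 < t0" "t0 < s0 + 2 * pi"
      using red[of s] st by (auto simp: red_def s0_def t0_def n_def)
    have "congr2pi s s0" "congr2pi t t0" unfolding congr2pi_def s0_def t0_def by auto
    then have fs: "f s = f s0" "f t = f t0" using per unfolding periodic2pi_def by auto
    have hh: "h s t = h s0 t0" using full_int[OF st, of n] by (simp add: s0_def t0_def)
    \<comment> \<open>\<open>s0\<close> lies in the base period. If \<open>t0\<close> does not,
      \<open>half\<close> trades the arc for the one from \<open>t0 - 2 * pi\<close> to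
      \<open>s0\<close>, up to sign.\<close>
    consider "t0 < 2 * pi" | "t0 = 2 * pi" | "2 * pi < t0" by linarith
    then have "h s0 t0 = f s0 - f t0"
    proof cases
      case 1
      then show ?thesis using base s0 by auto
    next
      case 2
      have "f t0 = 0" using periodic2pi_shift(1)[OF per, of 0] red_eq[of 0 0] h0[of 0 0] 2 by (simp add: f_def)
      moreover have "s0 \<noteq> 0" using 2 s0 by auto
      then have "h s0 (0 + 2 * pi) = - h 0 s0" using half[of 0 s0] s0 by auto
      ultimately show ?thesis using red_eq[of s0 s0] s0 2 by (simp add: f_def)
    next
      case 3
      have "h (t0 - 2 * pi) s0 = f (t0 - 2 * pi) - f s0" by (rule base) (use 3 s0 in auto)
      moreover have "h s0 (t0 - 2 * pi + 2 * pi) = - h (t0 - 2 * pi) s0" by (rule half) (use s0 3 in auto)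
      ultimately show ?thesis using periodic2pi_shift(2)[OF per, of t0] by simp
    qed
    then show ?thesis using hh fs by simp
  qed
  then have "\<Psi> (pt s t) = \<Phi> (pt s t) + f s - f t" if "arc_of \<Z> s t" for s t
    using strip[OF that] by (simp add: h_def algebra_simps)
  then show ?thesis using per by blast
qed

lemma coords_eq_iff: "coords \<Z> \<Phi> = coords \<Z> \<Psi> \<longleftrightarrow> (\<forall>s t. arc_of \<Z> s t \<longrightarrow> \<Phi> (pt s t) = \<Psi> (pt s t))"
proof
  assume "coords \<Z> \<Phi> = coords \<Z> \<Psi>"
  then have "coords \<Z> \<Phi> X = coords \<Z> \<Psi> X" for X by simp
  then show "\<forall>s t. arc_of \<Z> s t \<longrightarrow> \<Phi> (pt s t) = \<Psi> (pt s t)" by (simp add: coords_def arc_of_def) presburger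
next
  assume h: "\<forall>s t. arc_of \<Z> s t \<longrightarrow> \<Phi> (pt s t) = \<Psi> (pt s t)"
  show "coords \<Z> \<Phi> = coords \<Z> \<Psi>"
  proof
    fix X
    obtain s t where "X = pt s t" by (rule pt_cases)
    then show "coords \<Z> \<Phi> X = coords \<Z> \<Psi> X" using h by (simp add: coords_def arc_of_def)
  qed
qed

lemma solution_convex:
  assumes "solution \<Z> c \<Phi>" "solution \<Z> c \<Psi>" "0 \<le> u" "u \<le> 1"
  shows "solution \<Z> c (\<lambda>X. (1 - u) * \<Phi> X + u * \<Psi> X)"
  unfolding solution_def
proof (intro conjI allI impI ballI)
  show "zero_extended (\<lambda>X. (1 - u) * \<Phi> X + u * \<Psi> X)"
    using assms by (simp add: solution_def zero_extended_def)
  show "0 \<le> (1 - u) * \<Phi> X + u * \<Psi> X" if "X \<in> IndC \<Z>" for X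
    using assms that by (simp add: solution_def)
  fix X Y W Z assume t: "tilting_rectangle X Y W Z"
  have "\<Phi> X + \<Phi> W = \<Phi> Y + \<Phi> Z + set_lebesgue_integral lebesgue (rectangle_region X Y W Z) c"
    "\<Psi> X + \<Psi> W = \<Psi> Y + \<Psi> Z + set_lebesgue_integral lebesgue (rectangle_region X Y W Z) c"
    using assms(1,2) t unfolding solution_def by blast+
  then have "(1 - u) * (\<Phi> X + \<Phi> W) + u * (\<Psi> X + \<Psi> W) =
      (1 - u) * (\<Phi> Y + \<Phi> Z + set_lebesgue_integral lebesgue (rectangle_region X Y W Z) c) +
      u * (\<Psi> Y + \<Psi> Z + set_lebesgue_integral lebesgue (rectangle_region X Y W Z) c)"
    by simp
  then show "(1 - u) * \<Phi> X + u * \<Psi> X + ((1 - u) * \<Phi> W + u * \<Psi> W) =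
      (1 - u) * \<Phi> Y + u * \<Psi> Y + ((1 - u) * \<Phi> Z + u * \<Psi> Z) +
      set_lebesgue_integral lebesgue (rectangle_region X Y W Z) c"
    by (simp add: algebra_simps)
qed

lemma segment_iff:
  "x \<in> closed_segment a b \<longleftrightarrow> (\<exists>u. 0 \<le> u \<and> u \<le> 1 \<and> (\<forall>X. x X = (1 - u) * a X + u * b X))"
  for x :: "real \<times> real \<Rightarrow> real"
  by (simp add: closed_segment_def fun_eq_iff scaleR_fun_def del: split_paired_All) blast

lemma segment_subset_associahedron:
  assumes "solution \<Z> c \<Phi>" "solution \<Z> c \<Psi>"
  shows "closed_segment (coords \<Z> \<Phi>) (coords \<Z> \<Psi>) \<subseteq> continuous_associahedron \<Z> c"
proof
  fix x assume "x \<in> closed_segment (coords \<Z> \<Phi>) (coords \<Z> \<Psi>)"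
  then obtain u where u: "0 \<le> u" "u \<le> 1" "\<And>X. x X = (1 - u) * coords \<Z> \<Phi> X + u * coords \<Z> \<Psi> X"
    unfolding segment_iff by blast
  have "x = coords \<Z> (\<lambda>X. (1 - u) * \<Phi> X + u * \<Psi> X)" by (rule ext) (simp add: u(3) coords_def)
  then show "x \<in> continuous_associahedron \<Z> c"
    using solution_convex[OF assms u(1,2)] unfolding continuous_associahedron_def by blast
qed

section \<open>Clusters and vanishing solutions\<close>

abbreviation member :: "(real \<times> real) set \<Rightarrow> real \<Rightarrow> real \<Rightarrow> bool" where
  "member T s t \<equiv> pt s t \<in> T"

lemma incompatible_arcs:
  assumes "arc_of \<Z> s t" "arc_of \<Z> s' t'"
  shows "incompatible (pt s t) (pt s' t') \<longleftrightarrow> cross s t s' t' \<or> cross s' t' s t"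
  by (rule incompatible_iff) (use assms IndC_subset in \<open>auto simp: arc_of_def\<close>)

lemma cluster_arc: "T_cluster \<Z> T \<Longrightarrow> pt s t \<in> T \<Longrightarrow> arc_of \<Z> s t"
  by (auto simp: T_cluster_def arc_of_def)

lemma cluster_noncrossing: "T_cluster \<Z> T \<Longrightarrow> pt s t \<in> T \<Longrightarrow> pt s' t' \<in> T \<Longrightarrow> \<not> cross s t s' t'"
  using incompatible_arcs[of s t s' t'] cluster_arc[of T] unfolding T_cluster_def by blast

lemma cluster_maximal:
  assumes "T_cluster \<Z> T" "arc_of \<Z> u v" "\<And>s t. pt s t \<in> T \<Longrightarrow> \<not> cross s t u v \<and> \<not> cross u v s t"
  shows "pt u v \<in> T"
proof (rule ccontr)
  assume n: "pt u v \<notin> T"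
  then obtain X where X: "X \<in> T" "incompatible (pt u v) X"
    using assms(1,2) unfolding T_cluster_def arc_of_def by blast
  obtain s t where st: "X = pt s t" by (rule pt_cases)
  then show False using X assms(3)[of s t] incompatible_arcs[OF assms(2) cluster_arc[OF assms(1)]] by blast
qed

text \<open>Two zeros of a solution never cross, so maximality of the cluster applies.\<close>

lemma zeros_of_cluster_solution:
  assumes "T_cluster \<Z> T" "solution \<Z> c \<Phi>" "\<forall>X\<in>T. \<Phi> X = 0" "arc_of \<Z> u v" "\<Phi> (pt u v) = 0"
  shows "pt u v \<in> T"
proof (rule cluster_maximal[OF assms(1,4)])
  fix s t assume st: "pt s t \<in> T"
  then have "\<Phi> (pt s t) = 0" "arc_of \<Z> s t" using assms cluster_arc by auto
  then show "\<not> cross s t u v \<and> \<not> cross u v s t"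
    using solution_crossing_pos[OF assms(2), of s t u v] solution_crossing_pos[OF assms(2), of u v s t] assms(4,5) by auto
qed

text \<open>The arc is moved horizontally by a small \<open>e\<close>. At each height the zigzag
  lies strictly left of its shift, by the Lipschitz bound, so there is room on at least one
  side.\<close>

lemma exists_crossing:
  assumes a: "arc_of \<Z> s t"
  shows "\<exists>u v. arc_of \<Z> u v \<and> (cross u v s t \<or> cross s t u v)"
proof -
  define h where "h = s - t + pi"
  have st: "s < t" "t < s + 2 * pi" using strip[OF a] by auto
  have hb: "\<bar>h\<bar> < pi" "\<bar>- h\<bar> < pi" using st unfolding h_def by (auto simp: abs_less_iff)
  have lip: "left_end \<Z> h - left_end \<Z> (- h) < 2 * pi"
    using left_end_lipschitz[OF zigzag hb] hb by linarith
  have arc: "arc_of \<Z> (s + e) (t + e) \<longleftrightarrow> left_end \<Z> h \<le> s + t + 2 * e - pi \<and> s + t + 2 * e - pi \<le> left_end \<Z> (- h) + 2 * pi" for e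
    unfolding arc_of_iff h_def using st by (auto simp: algebra_simps)
  have a0: "left_end \<Z> h \<le> s + t - pi" "s + t - pi \<le> left_end \<Z> (- h) + 2 * pi" using arc[of 0] a by auto
  consider "left_end \<Z> h < s + t - pi" | "s + t - pi < left_end \<Z> (- h) + 2 * pi" using lip by linarith
  then show ?thesis
  proof cases
    case 1
    \<comment> \<open>The first bound keeps the translate in the region; the other two make it cross
      the given arc.\<close>
    define e where "e = min ((s + t - pi - left_end \<Z> h) / 2) (min (t - s) (s + 2 * pi - t))"
    have e: "0 < e" "e \<le> t - s" "e \<le> s + 2 * pi - t" "e \<le> (s + t - pi - left_end \<Z> h) / 2"
      using 1 st by (simp_all only: e_def min_less_iff_conj min_le_iff_disj) auto
    have "2 * e \<le> s + t - pi - left_end \<Z> h" using e(4) by (simp add: field_simps)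
    then have "arc_of \<Z> (s + - e) (t + - e)" using arc[of "- e"] a0 e(1) by linarith
    moreover have "cross (s + - e) (t + - e) s t" using e by (auto simp: cross_def)
    ultimately show ?thesis by blast
  next
    case 2
    define e where "e = min ((left_end \<Z> (- h) + 2 * pi - (s + t - pi)) / 2) (min (t - s) (s + 2 * pi - t))"
    have e: "0 < e" "e \<le> t - s" "e \<le> s + 2 * pi - t" "e \<le> (left_end \<Z> (- h) + 2 * pi - (s + t - pi)) / 2"
      using 2 st by (simp_all only: e_def min_less_iff_conj min_le_iff_disj) auto
    have "2 * e \<le> left_end \<Z> (- h) + 2 * pi - (s + t - pi)" using e(4) by (simp add: field_simps)
    then have "arc_of \<Z> (s + e) (t + e)" using arc[of e] a0 e(1) by linarith
    moreover have "cross s t (s + e) (t + e)" using e by (auto simp: cross_def)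
    ultimately show ?thesis by blast
  qed
qed

text \<open>Adding the tight potential to \<open>\<Phi>\<close> lowers the coordinate at
  \<open>(u, v)\<close> by \<open>f v - f u = \<Phi> (pt u v)\<close> and keeps the zeros on
  \<open>S\<close>.\<close>

lemma vanishing_solution_exists:
  assumes \<Phi>: "solution \<Z> c \<Phi>" and uv: "arc_of \<Z> u v"
    and S: "\<And>s t. S s t \<Longrightarrow> arc_of \<Z> s t \<and> \<Phi> (pt s t) = 0"
    and nc: "\<And>s t. S s t \<Longrightarrow> \<not> cross s t u v \<and> \<not> cross u v s t"
  shows "\<exists>\<Psi>. solution \<Z> c \<Psi> \<and> (\<forall>s t. S s t \<longrightarrow> \<Psi> (pt s t) = 0) \<and> \<Psi> (pt u v) = 0"
proof -
  have "noncrossing S" unfolding noncrossing_def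
  proof (intro allI impI notI)
    fix s t s' t' assume st: "S s t \<and> S s' t'" "cross s t s' t'"
    then show False using S[of s t] S[of s' t'] solution_crossing_pos[OF \<Phi>, of s t s' t'] by simp
  qed
  then obtain f where f: "potential (\<lambda>s t. \<Phi> (pt s t)) f" "\<And>s t. S s t \<Longrightarrow> f s = f t" "f v - f u = \<Phi> (pt u v)"
    using tight_potential_exists[OF solution_weight[OF \<Phi>] uv S _ nc] by blast
  obtain \<Psi> where \<Psi>: "solution \<Z> c \<Psi>" "\<And>s t. arc_of \<Z> s t \<Longrightarrow> \<Psi> (pt s t) = \<Phi> (pt s t) + f s - f t"
    using solution_add_potential[OF \<Phi> f(1)] by blast
  show ?thesis
    using \<Psi> S f uv by (intro exI[of _ \<Psi>]) auto
qed

text \<open>A solution \<open>\<Psi>\<close> vanishing on an arc that crosses an element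
  \<open>(s, t)\<close> of the cluster is positive at \<open>(s, t)\<close>. The segment from
  \<open>\<Psi>\<close> cannot go on past \<open>\<Phi>\<close>, where this coordinate has dropped
  to 0.\<close>

lemma cluster_solution_on_boundary:
  assumes T: "T_cluster \<Z> T" and \<Phi>: "solution \<Z> c \<Phi>" "\<forall>X\<in>T. \<Phi> X = 0"
  shows "on_boundary (coords \<Z> \<Phi>) (continuous_associahedron \<Z> c)"
proof -
  have "T \<noteq> {}"
  proof
    assume e: "T = {}"
    have "arc_of \<Z> u v \<Longrightarrow> False" for u v using cluster_maximal[OF T] e by auto
    moreover have "\<exists>u v. arc_of \<Z> u v"
    proof -
      \<comment> \<open>The point where the zigzag meets the line \<open>y = 0\<close>.\<close>
      have "arc_of \<Z> (left_end \<Z> 0 / 2) (left_end \<Z> 0 / 2 + pi)"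
        unfolding arc_of_iff by simp
      then show ?thesis by blast
    qed
    ultimately show False by blast
  qed
  then obtain s t where st: "pt s t \<in> T" using pt_surj by (metis ex_in_conv)
  have a: "arc_of \<Z> s t" by (rule cluster_arc[OF T st])
  have X: "pt s t \<in> IndC \<Z>" using a by (simp add: arc_of_def)
  obtain u v where uv: "arc_of \<Z> u v" "cross u v s t \<or> cross s t u v" using exists_crossing[OF a] by blast
  obtain \<Psi> where \<Psi>: "solution \<Z> c \<Psi>" "\<Psi> (pt u v) = 0"
    using vanishing_solution_exists[OF \<Phi>(1) uv(1), of "\<lambda>_ _. False"] by auto
  have pos: "0 < coords \<Z> \<Psi> (pt s t)"
    using solution_crossing_pos[OF \<Psi>(1), of s t u v] solution_crossing_pos[OF \<Psi>(1), of u v s t] uv a \<Psi>(2) X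
    by (auto simp: coords_def)
  have zero: "coords \<Z> \<Phi> (pt s t) = 0" using \<Phi> st by (simp add: coords_def)
  have nn: "0 \<le> x (pt s t)" if "x \<in> continuous_associahedron \<Z> c" for x
    using that X by (auto simp: continuous_associahedron_def coords_def solution_def)
  show ?thesis unfolding on_boundary_def
  proof (intro conjI exI[of _ "coords \<Z> \<Psi>"])
    show "coords \<Z> \<Phi> \<in> continuous_associahedron \<Z> c" using \<Phi> unfolding continuous_associahedron_def by blast
    show "coords \<Z> \<Psi> \<noteq> coords \<Z> \<Phi>" using pos zero by auto
    show "closed_segment (coords \<Z> \<Psi>) (coords \<Z> \<Phi>) \<subseteq> continuous_associahedron \<Z> c"
      by (rule segment_subset_associahedron[OF \<Psi>(1) \<Phi>(1)])
    show "\<not> (\<exists>A B. closed_segment (coords \<Z> \<Psi>) (coords \<Z> \<Phi>) \<subseteq> closed_segment A B \<and>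
       coords \<Z> \<Phi> \<noteq> A \<and> coords \<Z> \<Phi> \<noteq> B \<and> closed_segment A B \<subseteq> continuous_associahedron \<Z> c)"
    proof (intro notI, elim exE conjE)
      fix A B assume h: "closed_segment (coords \<Z> \<Psi>) (coords \<Z> \<Phi>) \<subseteq> closed_segment A B"
        "coords \<Z> \<Phi> \<noteq> A" "coords \<Z> \<Phi> \<noteq> B" "closed_segment A B \<subseteq> continuous_associahedron \<Z> c"
      have AB: "0 \<le> A (pt s t)" "0 \<le> B (pt s t)" using nn h(4) by auto
      have "coords \<Z> \<Phi> \<in> closed_segment A B" "coords \<Z> \<Psi> \<in> closed_segment A B" using h(1) by auto
      then obtain k l where k: "0 \<le> k" "k \<le> 1" "\<And>X. coords \<Z> \<Phi> X = (1 - k) * A X + k * B X"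
        and l: "0 \<le> l" "l \<le> 1" "\<And>X. coords \<Z> \<Psi> X = (1 - l) * A X + l * B X"
        unfolding segment_iff by blast
      \<comment> \<open>A strict convex combination of nonnegative coordinates is 0 only if both
        are, and then the coordinate of \<open>\<Psi>\<close> would be 0 as well.\<close>
      have "k \<noteq> 0" "k \<noteq> 1" using h(2,3) k(3) by (auto simp: fun_eq_iff)
      then have k': "0 < k" "0 < 1 - k" using k by auto
      have "(1 - k) * A (pt s t) + k * B (pt s t) = 0" using k(3) zero by metis
      then have "(1 - k) * A (pt s t) = 0" "k * B (pt s t) = 0"
        using mult_nonneg_nonneg[OF less_imp_le[OF k'(1)] AB(2)] mult_nonneg_nonneg[OF less_imp_le[OF k'(2)] AB(1)]
        by linarith+
      then have "A (pt s t) = 0" "B (pt s t) = 0" using k' by auto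
      then show False using l(3)[of "pt s t"] pos by simp
    qed
  qed
qed

text \<open>A potential that is constant along the cluster turns \<open>\<Phi>\<close> into another
  solution vanishing on it, which has the same coordinates.\<close>

lemma determined_by_cluster:
  assumes u: "unique_vanishing_solution \<Z> c T \<Phi>" and T: "T_cluster \<Z> T"
  shows "determined (\<lambda>s t. \<Phi> (pt s t)) (member T)"
  unfolding determined_def
proof (intro allI impI)
  fix g s t assume g: "potential (\<lambda>s t. \<Phi> (pt s t)) g \<and> (\<forall>s t. pt s t \<in> T \<longrightarrow> g s = g t)" and a: "arc_of \<Z> s t"
  have \<Phi>: "solution \<Z> c \<Phi>" "\<forall>X\<in>T. \<Phi> X = 0" using u unfolding unique_vanishing_solution_def by blast+
  obtain \<Psi> where \<Psi>: "solution \<Z> c \<Psi>" "\<And>s t. arc_of \<Z> s t \<Longrightarrow> \<Psi> (pt s t) = \<Phi> (pt s t) + g s - g t"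
    using solution_add_potential[OF \<Phi>(1) conjunct1[OF g]] by blast
  have "\<Psi> X = 0" if X: "X \<in> T" for X
  proof -
    obtain s t where st: "X = pt s t" by (rule pt_cases)
    have "g s = g t" using conjunct2[OF g] X st by blast
    moreover have "\<Phi> (pt s t) = 0" "arc_of \<Z> s t" using \<Phi>(2) X st cluster_arc[OF T] by auto
    ultimately show ?thesis using \<Psi>(2) st by simp
  qed
  then have "coords \<Z> \<Psi> = coords \<Z> \<Phi>" using u \<Psi>(1) unfolding unique_vanishing_solution_def by blast
  then show "g s = g t" using \<Psi>(2)[OF a] a unfolding coords_eq_iff by simp
qed

section \<open>Faces, edges and mutations\<close>

definition face :: "(real \<times> real) set \<Rightarrow> (real \<times> real \<Rightarrow> real) set" where
  "face S = (\<Inter>X\<in>S. hyperplane \<Z> X) \<inter> continuous_associahedron \<Z> c"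

lemma face_iff:
  assumes "S \<subseteq> IndC \<Z>"
  shows "x \<in> face S \<longleftrightarrow> (\<exists>\<Psi>. x = coords \<Z> \<Psi> \<and> solution \<Z> c \<Psi> \<and> (\<forall>X\<in>S. \<Psi> X = 0))"
proof
  assume x: "x \<in> face S"
  then obtain \<Psi> where \<Psi>: "x = coords \<Z> \<Psi>" "solution \<Z> c \<Psi>"
    by (auto simp: face_def continuous_associahedron_def)
  have "\<Psi> X = 0" if "X \<in> S" for X
  proof -
    have "x X = 0" using x that by (auto simp: face_def hyperplane_def)
    then show ?thesis using \<Psi>(1) that assms by (auto simp: coords_def)
  qed
  then show "\<exists>\<Psi>. x = coords \<Z> \<Psi> \<and> solution \<Z> c \<Psi> \<and> (\<forall>X\<in>S. \<Psi> X = 0)" using \<Psi> by blast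
next
  assume "\<exists>\<Psi>. x = coords \<Z> \<Psi> \<and> solution \<Z> c \<Psi> \<and> (\<forall>X\<in>S. \<Psi> X = 0)"
  then obtain \<Psi> where "x = coords \<Z> \<Psi>" "solution \<Z> c \<Psi>" "\<forall>X\<in>S. \<Psi> X = 0" by blast
  then show "x \<in> face S"
    by (auto simp: face_def continuous_associahedron_def hyperplane_def ambient_def coords_def)
qed

text \<open>If the cluster \<open>A\<close> consists of \<open>S\<close> and \<open>(s, r)\<close>,
  this is its maximality. It also follows from a face being a segment, before \<open>A\<close> is
  known to have this form.\<close>

definition forces :: "(real \<times> real) set \<Rightarrow> real \<Rightarrow> real \<Rightarrow> (real \<times> real) set \<Rightarrow> bool" where
  "forces S s r A \<longleftrightarrow> (\<forall>u v. arc_of \<Z> u v \<and> \<not> cross s r u v \<and> \<not> cross u v s r \<and>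
     (\<forall>x y. pt x y \<in> S \<longrightarrow> \<not> cross x y u v \<and> \<not> cross u v x y) \<longrightarrow> pt u v \<in> A)"

lemma forcesD:
  assumes "forces S s r A" "arc_of \<Z> u v" "\<not> cross s r u v" "\<not> cross u v s r"
    "\<And>x y. pt x y \<in> S \<Longrightarrow> \<not> cross x y u v \<and> \<not> cross u v x y"
  shows "pt u v \<in> A"
  using assms unfolding forces_def by blast

text \<open>\<open>\<Phi>\<close> is moved to a solution \<open>\<Psi>\<close> that keeps the zeros
  on \<open>T \<inter> T'\<close> and \<open>(s, r)\<close> and vanishes on \<open>(u, v)\<close>
  too. It lies on the segment, where only the endpoint \<open>\<Phi>\<close> has coordinate 0 at
  \<open>(s, r)\<close>. So \<open>\<Phi>\<close> already vanishes on \<open>(u, v)\<close>.\<close>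

lemma forced_into_cluster:
  assumes T: "T_cluster \<Z> T" and \<Phi>: "solution \<Z> c \<Phi>" "\<forall>X\<in>T. \<Phi> X = 0"
    and T': "T_cluster \<Z> T'" and \<Phi>': "solution \<Z> c \<Phi>'" "\<forall>X\<in>T'. \<Phi>' X = 0"
    and seg: "face (T \<inter> T') = closed_segment (coords \<Z> \<Phi>) (coords \<Z> \<Phi>')"
    and T0: "pt s r \<in> T" "pt s r \<notin> T'"
  shows "forces (T \<inter> T') s r T"
  unfolding forces_def
proof (intro allI impI, elim conjE)
  fix u v
  assume uv: "arc_of \<Z> u v" "\<not> cross s r u v" "\<not> cross u v s r"
    and S: "\<forall>x y. pt x y \<in> T \<inter> T' \<longrightarrow> \<not> cross x y u v \<and> \<not> cross u v x y"
  define S' where "S' x y \<longleftrightarrow> pt x y \<in> T \<inter> T' \<or> x = s \<and> y = r" for x y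
  have sub: "T \<inter> T' \<subseteq> IndC \<Z>" using T by (auto simp: T_cluster_def)
  have sr: "arc_of \<Z> s r" using cluster_arc[OF T T0(1)] .
  obtain \<Psi> where \<Psi>: "solution \<Z> c \<Psi>" "\<And>x y. S' x y \<Longrightarrow> \<Psi> (pt x y) = 0" "\<Psi> (pt u v) = 0"
  proof -
    have "arc_of \<Z> x y \<and> \<Phi> (pt x y) = 0" if "S' x y" for x y
      using that \<Phi>(2) T0 cluster_arc[OF T, of x y] sr by (auto simp: S'_def)
    moreover have "\<not> cross x y u v \<and> \<not> cross u v x y" if "S' x y" for x y
      using that S uv(2,3) by (auto simp: S'_def)
    ultimately show ?thesis
      using vanishing_solution_exists[OF \<Phi>(1) uv(1), of S'] that by metis
  qed
  have "\<Psi> X = 0" if "X \<in> T \<inter> T'" for X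
    using \<Psi>(2) that pt_surj[of X] unfolding S'_def by metis
  then have "coords \<Z> \<Psi> \<in> closed_segment (coords \<Z> \<Phi>) (coords \<Z> \<Phi>')"
    using \<Psi>(1) face_iff[OF sub] unfolding seg[symmetric] by blast
  then obtain k where k: "\<And>X. coords \<Z> \<Psi> X = (1 - k) * coords \<Z> \<Phi> X + k * coords \<Z> \<Phi>' X"
    unfolding segment_iff by blast
  have "\<Phi>' (pt s r) \<noteq> 0" using zeros_of_cluster_solution[OF T' \<Phi>' sr] T0 by blast
  moreover have "\<Psi> (pt s r) = 0" "\<Phi> (pt s r) = 0" using \<Psi>(2) \<Phi>(2) T0 by (auto simp: S'_def)
  ultimately have "k = 0" using k[of "pt s r"] sr by (simp add: coords_def arc_of_def)
  then have "\<Phi> (pt u v) = 0" using k[of "pt u v"] uv(1) \<Psi>(3) by (simp add: coords_def arc_of_def)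
  then show "pt u v \<in> T" by (rule zeros_of_cluster_solution[OF T \<Phi> uv(1)])
qed

text \<open>The corners cross neither a common arc, by \<open>corner_noncrossing\<close>, nor one of
  the two exchanged arcs; so \<open>forces\<close> applies for both clusters.\<close>

lemma edge_corners:
  assumes T: "T_cluster \<Z> T" "T_cluster \<Z> T'"
    and f: "forces (T \<inter> T') s r T" "forces (T \<inter> T') p q T'"
    and mem: "pt s r \<in> T" "pt p q \<in> T'" and x: "cross s r p q"
  shows "p < r \<Longrightarrow> pt p r \<in> T \<inter> T'" "q < s + 2 * pi \<Longrightarrow> pt s q \<in> T \<inter> T'"
proof -
  have a: "arc_of \<Z> s r" "arc_of \<Z> p q" using cluster_arc T mem by auto
  have nc: "\<not> cross x y p r \<and> \<not> cross p r x y \<and> \<not> cross x y s q \<and> \<not> cross s q x y"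
    if "pt x y \<in> T \<inter> T'" for x y
  proof -
    have "\<not> cross x y s r" "\<not> cross s r x y" "\<not> cross x y p q" "\<not> cross p q x y"
      using cluster_noncrossing[OF T(1), of x y s r] cluster_noncrossing[OF T(1), of s r x y]
        cluster_noncrossing[OF T(2), of x y p q] cluster_noncrossing[OF T(2), of p q x y] mem that by auto
    then show ?thesis using corner_noncrossing[OF x, of x y] by blast
  qed
  have own: "\<not> cross s r p r" "\<not> cross p r s r" "\<not> cross s r s q" "\<not> cross s q s r"
    "\<not> cross p q p r" "\<not> cross p r p q" "\<not> cross p q s q" "\<not> cross s q p q"
    using x by (auto simp: cross_def)
  show "pt p r \<in> T \<inter> T'" if "p < r"
  proof
    show "pt p r \<in> T" by (rule forcesD[OF f(1) top_corner[OF a x that]]) (use nc own in auto)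
    show "pt p r \<in> T'" by (rule forcesD[OF f(2) top_corner[OF a x that]]) (use nc own in auto)
  qed
  show "pt s q \<in> T \<inter> T'" if "q < s + 2 * pi"
  proof
    show "pt s q \<in> T" by (rule forcesD[OF f(1) bottom_corner[OF a x that]]) (use nc own in auto)
    show "pt s q \<in> T'" by (rule forcesD[OF f(2) bottom_corner[OF a x that]]) (use nc own in auto)
  qed
qed

text \<open>Every element of \<open>T - T'\<close> crosses \<open>(p, q)\<close>, which would
  otherwise be forced into \<open>T\<close>; the nondegenerate corners of this crossing lie in
  \<open>T\<close>. For two different elements on the same side of \<open>(p, q)\<close>, a corner
  of one would cross the other. On opposite sides this is avoided only by violating
  \<open>spread\<close>.\<close>

lemma unique_exchange_partner:
  assumes T: "T_cluster \<Z> T" "T_cluster \<Z> T'"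
    and fT: "\<And>s r. pt s r \<in> T \<Longrightarrow> pt s r \<notin> T' \<Longrightarrow> forces (T \<inter> T') s r T"
    and fT': "\<And>s r. pt s r \<in> T' \<Longrightarrow> pt s r \<notin> T \<Longrightarrow> forces (T \<inter> T') s r T'"
    and T0: "pt s r \<in> T" "pt s r \<notin> T'" and T0': "pt s' r' \<in> T" "pt s' r' \<notin> T'"
    and T1: "pt p q \<in> T'" "pt p q \<notin> T"
  shows "pt s r = pt s' r'"
proof -
  have ex: "cross a b p q \<or> cross p q a b" if "pt a b \<in> T" "pt a b \<notin> T'" for a b
  proof (rule ccontr)
    assume n: "\<not> (cross a b p q \<or> cross p q a b)"
    have "pt p q \<in> T"
      by (rule forcesD[OF fT[OF that]]) (use n cluster_arc[OF T(2)] cluster_noncrossing[OF T(2)] T1 in auto)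
    then show False using T1 by simp
  qed
  have left: "(p < b \<longrightarrow> pt p b \<in> T) \<and> (q < a + 2 * pi \<longrightarrow> pt a q \<in> T)"
    if "pt a b \<in> T" "pt a b \<notin> T'" "cross a b p q" for a b
    using edge_corners[OF T fT[OF that(1,2)] fT'[OF T1] that(1) T1(1) that(3)] by simp
  have right: "(a < q \<longrightarrow> pt a q \<in> T) \<and> (b < p + 2 * pi \<longrightarrow> pt p b \<in> T)"
    if "pt a b \<in> T" "pt a b \<notin> T'" "cross p q a b" for a b
  proof -
    note f = fT'[OF T1] fT[OF that(1,2)]
    show ?thesis
      using edge_corners[OF T(2,1) f[unfolded Int_commute[of T]] T1(1) that(1) that(3)] by simp
  qed
  note nc = cluster_noncrossing[OF T(1)]
  have LL: "\<not> a < a' \<and> \<not> b < b'"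
    if "pt a b \<in> T" "pt a b \<notin> T'" "cross a b p q" "pt a' b' \<in> T" "pt a' b' \<notin> T'" "cross a' b' p q" for a b a' b'
    using left[OF that(4-6)] nc[OF that(1), of a' q] nc[OF that(1), of p b'] that(3,6) unfolding cross_def by auto
  have RR: "\<not> a < a' \<and> \<not> b < b'"
    if "pt a b \<in> T" "pt a b \<notin> T'" "cross p q a b" "pt a' b' \<in> T" "pt a' b' \<notin> T'" "cross p q a' b'" for a b a' b'
    using right[OF that(1-3)] nc[OF _ that(4), of a q] nc[OF _ that(4), of p b] that(3,6) unfolding cross_def by auto
  have LR: False
    if "pt a b \<in> T" "pt a b \<notin> T'" "cross a b p q" "pt a' b' \<in> T" "pt a' b' \<notin> T'" "cross p q a' b'" for a b a' b'
  proof -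
    have "b < a'"
      using right[OF that(4-6)] nc[OF that(1), of a' q] that(3,6) unfolding cross_def by auto
    moreover have "a + 2 * pi < b'"
      using right[OF that(4-6)] nc[OF that(1), of p b'] that(3,6) unfolding cross_def by (smt (verit))
    ultimately show False using spread cluster_arc[OF T(1)] that by blast
  qed
  consider "cross s r p q" "cross s' r' p q" | "cross p q s r" "cross p q s' r'"
    | "cross s r p q" "cross p q s' r'" | "cross p q s r" "cross s' r' p q"
    using ex T0 T0' by blast
  then show ?thesis
  proof cases
    case 1
    then show ?thesis using LL[OF T0 1(1) T0' 1(2)] LL[OF T0' 1(2) T0 1(1)] by auto
  next
    case 2
    then show ?thesis using RR[OF T0 2(1) T0' 2(2)] RR[OF T0' 2(2) T0 2(1)] by auto
  next
    case 3
    then show ?thesis using LR[OF T0 3(1) T0' 3(2)] by blast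
  next
    case 4
    then show ?thesis using LR[OF T0' 4(2) T0 4(1)] by blast
  qed
qed

lemma mutation_of_edge:
  assumes T: "T_cluster \<Z> T" "T_cluster \<Z> T'"
    and \<Phi>: "solution \<Z> c \<Phi>" "\<forall>X\<in>T. \<Phi> X = 0" and \<Phi>': "solution \<Z> c \<Phi>'" "\<forall>X\<in>T'. \<Phi>' X = 0"
    and u: "unique_vanishing_solution \<Z> c T \<Phi>"
    and ne: "coords \<Z> \<Phi> \<noteq> coords \<Z> \<Phi>'"
    and seg: "face (T \<inter> T') = closed_segment (coords \<Z> \<Phi>) (coords \<Z> \<Phi>')"
  shows "T_mutation T T'"
proof -
  \<comment> \<open>By maximality a cluster contained in another one equals it, so both differences
    are nonempty.\<close>
  have nsub: "\<exists>s t. pt s t \<in> A \<and> pt s t \<notin> B" if "T_cluster \<Z> A" "T_cluster \<Z> B" "A \<noteq> B" for A B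
  proof (rule ccontr)
    assume n: "\<not> ?thesis"
    have sub: "pt s t \<in> A \<longleftrightarrow> pt s t \<in> B" for s t
    proof
      show "pt s t \<in> A \<Longrightarrow> pt s t \<in> B" using n by blast
      assume b: "pt s t \<in> B"
      show "pt s t \<in> A"
        by (rule cluster_maximal[OF that(1) cluster_arc[OF that(2) b]])
          (use n cluster_noncrossing[OF that(2)] b in blast)
    qed
    have "X \<in> A \<longleftrightarrow> X \<in> B" for X using sub pt_surj[of X] by metis
    then show False using that(3) by blast
  qed
  have neT: "T \<noteq> T'" using u \<Phi>' ne unfolding unique_vanishing_solution_def by metis
  obtain s r where T0: "pt s r \<in> T" "pt s r \<notin> T'" using nsub[OF T neT] by blast
  obtain p q where T1: "pt p q \<in> T'" "pt p q \<notin> T" using nsub[OF T(2,1)] neT by blast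
  note f = forced_into_cluster[OF T(1) \<Phi> T(2) \<Phi>' seg]
  have seg': "face (T' \<inter> T) = closed_segment (coords \<Z> \<Phi>') (coords \<Z> \<Phi>)"
    using seg by (simp add: Int_commute closed_segment_commute)
  note f' = forced_into_cluster[OF T(2) \<Phi>' T(1) \<Phi> seg', unfolded Int_commute[of T']]
  have 1: "X = pt s r" if "X \<in> T" "X \<notin> T'" for X
  proof -
    obtain a b where ab: "X = pt a b" by (rule pt_cases)
    have "pt s r = pt a b"
    proof (rule unique_exchange_partner[OF T _ _ T0 _ _ T1])
      show "pt a b \<in> T" "pt a b \<notin> T'" using that ab by auto
    qed (use f f' in auto)
    then show ?thesis using ab by simp
  qed
  have 2: "X = pt p q" if "X \<in> T'" "X \<notin> T" for X
  proof -
    obtain a b where ab: "X = pt a b" by (rule pt_cases)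
    have "pt p q = pt a b"
    proof (rule unique_exchange_partner[OF T(2,1) _ _ T1 _ _ T0])
      show "pt a b \<in> T'" "pt a b \<notin> T" using that ab by auto
    qed (use f f' in \<open>auto simp: Int_commute\<close>)
    then show ?thesis using ab by simp
  qed
  have "T' = (T - {pt s r}) \<union> {pt p q}" using 1 2 T0 T1 by blast
  then show ?thesis unfolding T_mutation_def using T0 T1 by blast
qed

text \<open>The exchange yields one direction for all solutions vanishing on the common arcs. So
  each of them is determined by its coordinate at \<open>(s, r)\<close> and lies on the line through
  \<open>\<Phi>\<close> and \<open>\<Phi>'\<close>.\<close>

lemma edge_of_oriented_mutation:
  assumes T: "T_cluster \<Z> T" "T_cluster \<Z> T'"
    and u: "unique_vanishing_solution \<Z> c T \<Phi>" "unique_vanishing_solution \<Z> c T' \<Phi>'"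
    and T0: "pt s r \<in> T" "pt s r \<notin> T'" and T1: "pt p q \<in> T'" "pt p q \<notin> T"
    and TS: "T - {pt s r} = T' - {pt p q}" and x: "cross s r p q"
  shows "face (T \<inter> T') \<subseteq> closed_segment (coords \<Z> \<Phi>) (coords \<Z> \<Phi>')"
proof
  have \<Phi>: "solution \<Z> c \<Phi>" "\<forall>X\<in>T. \<Phi> X = 0" and \<Phi>': "solution \<Z> c \<Phi>'" "\<forall>X\<in>T'. \<Phi>' X = 0"
    using u unfolding unique_vanishing_solution_def by blast+
  have a: "arc_of \<Z> s r" "arc_of \<Z> p q" using cluster_arc T T0 T1 by auto
  have memT: "pt a b \<in> T \<longleftrightarrow> pt a b \<in> T \<inter> T' \<or> a = s \<and> b = r" for a b
    using T0 TS T1 pt_eq_iff by blast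
  have memT': "pt a b \<in> T' \<longleftrightarrow> pt a b \<in> T \<inter> T' \<or> a = p \<and> b = q" for a b
    using T0 TS T1 pt_eq_iff by blast
  have corners: "p < r \<Longrightarrow> pt p r \<in> T \<inter> T'" "q < s + 2 * pi \<Longrightarrow> pt s q \<in> T \<inter> T'"
  proof -
    have f: "forces (T \<inter> T') s r T" "forces (T \<inter> T') p q T'"
      unfolding forces_def using cluster_maximal[OF T(1)] cluster_maximal[OF T(2)] memT memT' by metis+
    show "p < r \<Longrightarrow> pt p r \<in> T \<inter> T'" "q < s + 2 * pi \<Longrightarrow> pt s q \<in> T \<inter> T'"
      using edge_corners[OF T f T0(1) T1(1) x] by blast+
  qed
  obtain g where g: "periodic2pi g" "\<And>s t. arc_of \<Z> s t \<Longrightarrow> \<Phi>' (pt s t) = \<Phi> (pt s t) + g s - g t"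
    using solution_difference[OF \<Phi>(1) \<Phi>'(1)] by blast
  interpret E: exchange "arc_of \<Z>" s r p q "member (T \<inter> T')" "\<lambda>s t. \<Phi> (pt s t)" "\<lambda>s t. \<Phi>' (pt s t)" g
  proof
    show "arc_of \<Z> s r" "arc_of \<Z> p q" "cross s r p q" by (fact a x)+
    show "weight (\<lambda>s t. \<Phi> (pt s t))" "weight (\<lambda>s t. \<Phi>' (pt s t))"
      using solution_weight \<Phi> \<Phi>' by auto
    show "arc_of \<Z> a b \<and> \<Phi> (pt a b) = 0 \<and> \<Phi>' (pt a b) = 0" if "pt a b \<in> T \<inter> T'" for a b
      using that cluster_arc[OF T(1)] \<Phi> \<Phi>' by auto
    show "\<Phi> (pt s r) = 0" "\<Phi>' (pt p q) = 0" using \<Phi> \<Phi>' T0 T1 by auto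
    show "noncrossing (\<lambda>a b. pt a b \<in> T \<inter> T' \<or> a = s \<and> b = r)"
      "noncrossing (\<lambda>a b. pt a b \<in> T \<inter> T' \<or> a = p \<and> b = q)"
      unfolding memT[symmetric] memT'[symmetric] noncrossing_def
      using cluster_noncrossing[OF T(1)] cluster_noncrossing[OF T(2)] by blast+
    show "p < r \<Longrightarrow> pt p r \<in> T \<inter> T'" "q < s + 2 * pi \<Longrightarrow> pt s q \<in> T \<inter> T'" by (fact corners)+
    show "periodic2pi g" by (fact g)
    show "arc_of \<Z> a b \<Longrightarrow> \<Phi>' (pt a b) = \<Phi> (pt a b) + g a - g b" for a b by (fact g(2))
    show "determined (\<lambda>s t. \<Phi> (pt s t)) (\<lambda>a b. pt a b \<in> T \<inter> T' \<or> a = s \<and> b = r)"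
      "determined (\<lambda>s t. \<Phi>' (pt s t)) (\<lambda>a b. pt a b \<in> T \<inter> T' \<or> a = p \<and> b = q)"
      unfolding memT[symmetric] memT'[symmetric]
      using determined_by_cluster[OF u(1) T(1)] determined_by_cluster[OF u(2) T(2)] by simp_all
  qed
  obtain h :: "real \<Rightarrow> real" where h: "\<And>f x y. potential (\<lambda>s t. \<Phi> (pt s t)) f \<Longrightarrow> E.flat f \<Longrightarrow> arc_of \<Z> x y \<Longrightarrow>
      f x - f y = (f s - f r) * (h x - h y)"
    using E.edge_direction by blast
  have diff: "\<Psi> (pt x y) - \<Phi> (pt x y) = \<Psi> (pt s r) * (h x - h y)"
    if \<Psi>: "solution \<Z> c \<Psi>" "\<forall>X\<in>T\<inter>T'. \<Psi> X = 0" and xy: "arc_of \<Z> x y" for \<Psi> x y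
  proof -
    obtain f where f: "periodic2pi f" "\<And>s t. arc_of \<Z> s t \<Longrightarrow> \<Psi> (pt s t) = \<Phi> (pt s t) + f s - f t"
      using solution_difference[OF \<Phi>(1) \<Psi>(1)] by blast
    have "f t - f s \<le> \<Phi> (pt s t)" if "arc_of \<Z> s t" for s t
      using f(2)[OF that] solution_nonneg[OF \<Psi>(1) that] by linarith
    then have "potential (\<lambda>s t. \<Phi> (pt s t)) f" using f(1) by (simp add: potential_def)
    moreover have "E.flat f" unfolding E.flat_def
    proof (intro allI impI)
      fix a b assume ab: "pt a b \<in> T \<inter> T'"
      then show "f a = f b" using f(2)[of a b] cluster_arc[OF T(1), of a b] \<Psi>(2) \<Phi>(2) by auto
    qed
    ultimately have "f x - f y = (f s - f r) * (h x - h y)" using h xy by blast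
    moreover have "f s - f r = \<Psi> (pt s r)" using f(2)[OF a(1)] \<Phi>(2) T0 by simp
    ultimately show ?thesis using f(2)[OF xy] by simp
  qed
  fix z assume z: "z \<in> face (T \<inter> T')"
  have sub: "T \<inter> T' \<subseteq> IndC \<Z>" using T by (auto simp: T_cluster_def)
  obtain \<Psi> where \<Psi>: "z = coords \<Z> \<Psi>" "solution \<Z> c \<Psi>" "\<forall>X\<in>T\<inter>T'. \<Psi> X = 0"
    using z face_iff[OF sub] by blast
  \<comment> \<open>The position on the line is read off at \<open>(s, r)\<close>, where
    \<open>\<Phi>\<close> is 0 and \<open>\<Phi>'\<close> positive; this gives
    \<open>0 \<le> k\<close>. At \<open>(p, q)\<close> the roles are reversed, which gives
    \<open>k \<le> 1\<close>.\<close>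
  define k where "k = \<Psi> (pt s r) / \<Phi>' (pt s r)"
  have K: "0 < \<Phi>' (pt s r)"
    using zeros_of_cluster_solution[OF T(2) \<Phi>' a(1)] solution_nonneg[OF \<Phi>'(1) a(1)] T0 by force
  have K1: "0 < \<Phi> (pt p q)"
    using zeros_of_cluster_solution[OF T(1) \<Phi> a(2)] solution_nonneg[OF \<Phi>(1) a(2)] T1 by force
  have comb: "\<Psi> (pt x y) = (1 - k) * \<Phi> (pt x y) + k * \<Phi>' (pt x y)" if xy: "arc_of \<Z> x y" for x y
  proof -
    have "\<Psi> (pt x y) - \<Phi> (pt x y) = k * (\<Phi>' (pt x y) - \<Phi> (pt x y))"
      using diff[OF \<Psi>(2,3) xy] diff[OF \<Phi>'(1) _ xy] \<Phi>'(2) K by (simp add: k_def)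
    then show ?thesis by (simp add: algebra_simps)
  qed
  have k0: "0 \<le> k" using K solution_nonneg[OF \<Psi>(2) a(1)] by (simp add: k_def)
  have "0 \<le> (1 - k) * \<Phi> (pt p q)"
    using comb[OF a(2)] solution_nonneg[OF \<Psi>(2) a(2)] \<Phi>'(2) T1 by simp
  then have k1: "k \<le> 1" using K1 by (simp add: zero_le_mult_iff)
  have "z X = (1 - k) * coords \<Z> \<Phi> X + k * coords \<Z> \<Phi>' X" for X
  proof -
    obtain x y where "X = pt x y" by (rule pt_cases)
    then show ?thesis using comb[of x y] \<Psi>(1) by (simp add: coords_def arc_of_def)
  qed
  then show "z \<in> closed_segment (coords \<Z> \<Phi>) (coords \<Z> \<Phi>')" unfolding segment_iff using k0 k1 by blast
qed

lemma edge_of_mutation: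
  assumes T: "T_cluster \<Z> T" "T_cluster \<Z> T'"
    and u: "unique_vanishing_solution \<Z> c T \<Phi>" "unique_vanishing_solution \<Z> c T' \<Phi>'"
    and m: "T_mutation T T'"
  shows "coords \<Z> \<Phi> \<noteq> coords \<Z> \<Phi>'" "face (T \<inter> T') = closed_segment (coords \<Z> \<Phi>) (coords \<Z> \<Phi>')"
proof -
  have \<Phi>: "solution \<Z> c \<Phi>" "\<forall>X\<in>T. \<Phi> X = 0" and \<Phi>': "solution \<Z> c \<Phi>'" "\<forall>X\<in>T'. \<Phi>' X = 0"
    using u unfolding unique_vanishing_solution_def by blast+
  obtain A B where AB: "A \<in> T" "B \<notin> T" "T' = (T - {A}) \<union> {B}" using m by (auto simp: T_mutation_def)
  obtain s r where A: "A = pt s r" by (rule pt_cases)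
  obtain p q where B: "B = pt p q" by (rule pt_cases)
  have T0: "pt s r \<in> T" "pt s r \<notin> T'" and T1: "pt p q \<in> T'" "pt p q \<notin> T"
    and TS: "T - {pt s r} = T' - {pt p q}" using AB A B by auto
  have a: "arc_of \<Z> s r" "arc_of \<Z> p q" using cluster_arc T T0 T1 by auto
  have "\<Phi> (pt s r) = 0" "\<Phi>' (pt s r) \<noteq> 0"
    using \<Phi> T0 zeros_of_cluster_solution[OF T(2) \<Phi>' a(1)] by auto
  then have "\<Phi> (pt s r) \<noteq> \<Phi>' (pt s r)" by simp
  then show "coords \<Z> \<Phi> \<noteq> coords \<Z> \<Phi>'" unfolding coords_eq_iff using a(1) by blast
  \<comment> \<open>Otherwise \<open>(p, q)\<close> would be compatible with all of \<open>T\<close>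
    and hence belong to it. The order of the crossing decides which cluster plays the role of
    \<open>T\<close>; the claim is symmetric.\<close>
  have "cross s r p q \<or> cross p q s r"
  proof (rule ccontr)
    assume n: "\<not> ?thesis"
    have "pt p q \<in> T"
    proof (rule cluster_maximal[OF T(1) a(2)])
      fix x y assume xy: "pt x y \<in> T"
      show "\<not> cross x y p q \<and> \<not> cross p q x y"
      proof (cases "pt x y = pt s r")
        case True then show ?thesis using n by simp
      next
        case False
        then have "pt x y \<in> T'" using xy TS by blast
        then show ?thesis using cluster_noncrossing[OF T(2)] T1 by blast
      qed
    qed
    then show False using T1 by simp
  qed
  then have "face (T \<inter> T') \<subseteq> closed_segment (coords \<Z> \<Phi>) (coords \<Z> \<Phi>')"
  proof
    assume "cross s r p q"
    then show ?thesis by (rule edge_of_oriented_mutation[OF T u T0 T1 TS])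
  next
    assume "cross p q s r"
    then have "face (T' \<inter> T) \<subseteq> closed_segment (coords \<Z> \<Phi>') (coords \<Z> \<Phi>)"
      by (rule edge_of_oriented_mutation[OF T(2,1) u(2,1) T1 T0 TS[symmetric]])
    then show ?thesis by (simp add: Int_commute closed_segment_commute)
  qed
  moreover have "closed_segment (coords \<Z> \<Phi>) (coords \<Z> \<Phi>') \<subseteq> face (T \<inter> T')"
  proof
    fix z assume z: "z \<in> closed_segment (coords \<Z> \<Phi>) (coords \<Z> \<Phi>')"
    then obtain k where k: "\<And>X. z X = (1 - k) * coords \<Z> \<Phi> X + k * coords \<Z> \<Phi>' X"
      unfolding segment_iff by blast
    have "z \<in> continuous_associahedron \<Z> c" using segment_subset_associahedron[OF \<Phi>(1) \<Phi>'(1)] z by blast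
    moreover have "z \<in> hyperplane \<Z> X" if "X \<in> T \<inter> T'" for X
      using k that \<Phi>(2) \<Phi>'(2) by (auto simp: hyperplane_def ambient_def coords_def)
    ultimately show "z \<in> face (T \<inter> T')" by (simp add: face_def)
  qed
  ultimately show "face (T \<inter> T') = closed_segment (coords \<Z> \<Phi>) (coords \<Z> \<Phi>')" by blast
qed

end

theorem theorem2:
  fixes \<Z> :: "(real \<times> real) set" and c :: "real \<times> real \<Rightarrow> real"
  assumes "zigzag \<Z>"
    and "permissible c"
    and "\<forall>X\<in>IndC \<Z>. 0 < c X"
  shows "(\<forall>\<T> \<Phi>. T_cluster \<Z> \<T> \<and> solution \<Z> c \<Phi> \<and> (\<forall>X\<in>\<T>. \<Phi> X = 0) \<longrightarrow>
           on_boundary (coords \<Z> \<Phi>) (continuous_associahedron \<Z> c)) \<and>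
         (\<forall>\<T> \<T>' \<Phi> \<Phi>'.
           T_cluster \<Z> \<T> \<and> T_cluster \<Z> \<T>' \<and>
           unique_vanishing_solution \<Z> c \<T> \<Phi> \<and> unique_vanishing_solution \<Z> c \<T>' \<Phi>' \<longrightarrow>
           (T_mutation \<T> \<T>' \<longleftrightarrow>
             (\<exists>E. coords \<Z> \<Phi> \<noteq> coords \<Z> \<Phi>' \<and>
                  E = closed_segment (coords \<Z> \<Phi>) (coords \<Z> \<Phi>') \<and>
                  E \<subseteq> continuous_associahedron \<Z> c \<and>
                  E = (\<Inter>X\<in>\<T> \<inter> \<T>'. hyperplane \<Z> X) \<inter> continuous_associahedron \<Z> c)))"
proof -
  interpret associahedron \<Z> c by standard (fact assms)+
  show ?thesis
  proof (intro conjI allI impI; (elim conjE)?)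
    fix T \<Phi> assume "T_cluster \<Z> T" "solution \<Z> c \<Phi>" "\<forall>X\<in>T. \<Phi> X = 0"
    then show "on_boundary (coords \<Z> \<Phi>) (continuous_associahedron \<Z> c)"
      by (rule cluster_solution_on_boundary)
  next
    fix T T' \<Phi> \<Phi>'
    assume T: "T_cluster \<Z> T" "T_cluster \<Z> T'"
      and u: "unique_vanishing_solution \<Z> c T \<Phi>" "unique_vanishing_solution \<Z> c T' \<Phi>'"
    have s: "solution \<Z> c \<Phi>" "\<forall>X\<in>T. \<Phi> X = 0" "solution \<Z> c \<Phi>'" "\<forall>X\<in>T'. \<Phi>' X = 0"
      using u unfolding unique_vanishing_solution_def by blast+
    show "T_mutation T T' \<longleftrightarrow> (\<exists>E. coords \<Z> \<Phi> \<noteq> coords \<Z> \<Phi>' \<and>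
        E = closed_segment (coords \<Z> \<Phi>) (coords \<Z> \<Phi>') \<and> E \<subseteq> continuous_associahedron \<Z> c \<and>
        E = (\<Inter>X\<in>T \<inter> T'. hyperplane \<Z> X) \<inter> continuous_associahedron \<Z> c)"
      unfolding face_def[symmetric]
      using edge_of_mutation[OF T u] mutation_of_edge[OF T s u(1)] segment_subset_associahedron[OF s(1,3)]
      by blast
  qed
qed

end
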